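(* Let $n\geq 2$, let $\Omega\subset\mathbb{C}^n$ be a $C^2$-smooth bounded pseudoconvex domain, and let $N_1:L^2_{(0,1)}(\Omega)\to L^2_{(0,1)}(\Omega)$ denote the $\overline{\partial}$-Neumann operator on $\Omega$. Then the operator $\overline{\partial}^*N_1:L^2_{(0,1)}(\Omega)\to L^2(\Omega)$ is not in the Schatten class $S_4$, and $N_1$ is not Hilbert-Schmidt.
   Context: $L^2_{(0,q)}(\Omega)$ is the Hilbert space of $(0,q)$-forms on $\Omega$ with square integrable coefficients (with respect to Lebesgue measure). $\overline{\partial}$ denotes the (maximally extended, densely defined, closed) Cauchy-Riemann operator $L^2_{(0,q)}(\Omega)\to L^2_{(0,q+1)}(\Omega)$, and $\overline{\partial}^*$ its Hilbert space adjoint. The complex Laplacian $\overline{\partial}\,\overline{\partial}^*+\overline{\partial}^*\overline{\partial}$ on $L^2_{(0,1)}(\Omega)$ is an unbounded, self-adjoint, closed operator. By a theorem of Hörmander, on a bounded pseudoconvex domain in $\mathbb{C}^n$ it has a bounded solution operator (bounded inverse) $N_1$ on $L^2_{(0,1)}(\Omega)$, called the $\overline{\partial}$-Neumann operator. The operator $\overline{\partial}^*N_1$ is the canonical solution operator to $\overline{\partial}$. A self-adjoint compact operator on a separable Hilbert space is in the trace class $S_1$ if its eigenvalues (counted with multiplicity) are absolutely summable. For $0<p<\infty$, an operator $T$ is in the Schatten $p$-class $S_p$ if $(T^*T)^{p/2}$ is in the trace class $S_1$ (in particular, $(T^*T)^{p/2}$ is compact). $S_2$ is the class of Hilbert-Schmidt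 operators. *)

theory Defs
  imports "HOL-Analysis.Analysis" "HOL-Computational_Algebra.Polynomial"
begin

definition sq_integrable :: "('a::euclidean_space \<Rightarrow> 'b::euclidean_space) \<Rightarrow> bool" where
  "sq_integrable f \<longleftrightarrow>
     f \<in> borel_measurable lebesgue \<and> integrable lebesgue (\<lambda>x. (norm (f x))\<^sup>2)"

lemma sq_integrable_bound:
  assumes "f \<in> borel_measurable lebesgue" "integrable lebesgue h" "\<And>x. (norm (f x))\<^sup>2 \<le> h x"
  shows "sq_integrable f"
  unfolding sq_integrable_def
proof
  show "integrable lebesgue (\<lambda>x. (norm (f x))\<^sup>2)"
  proof (rule Bochner_Integration.integrable_bound[OF assms(2)])
    show "(\<lambda>x. (norm (f x))\<^sup>2) \<in> borel_measurable lebesgue"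
      using assms(1) by measurable
    show "AE x in lebesgue. norm ((norm (f x))\<^sup>2) \<le> norm (h x)"
      using assms(3) by (intro AE_I2) (simp add: order_trans[OF assms(3)])
  qed
qed (rule assms(1))

lemma sq_integrable_zero: "sq_integrable (\<lambda>x. 0)"
  by (simp add: sq_integrable_def)

lemma norm_add_sq_le: "(norm (a + b))\<^sup>2 \<le> 2 * (norm a)\<^sup>2 + 2 * (norm (b::'a::real_normed_vector))\<^sup>2"
proof -
  have "(norm (a + b))\<^sup>2 \<le> (norm a + norm b)\<^sup>2"
    by (rule power_mono) (auto intro: norm_triangle_ineq)
  also have "\<dots> \<le> 2 * (norm a)\<^sup>2 + 2 * (norm b)\<^sup>2"
    using sum_squares_bound[of "norm a" "norm b"] by (simp add: power2_sum)
  finally show ?thesis .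
qed

lemma sq_integrable_add:
  assumes "sq_integrable f" "sq_integrable g"
  shows "sq_integrable (\<lambda>x. f x + g x)"
  by (rule sq_integrable_bound[where h = "\<lambda>x. 2 * (norm (f x))\<^sup>2 + 2 * (norm (g x))\<^sup>2"])
     (use assms in \<open>auto simp: sq_integrable_def intro!: norm_add_sq_le\<close>)

lemma sq_integrable_uminus: "sq_integrable f \<Longrightarrow> sq_integrable (\<lambda>x. - f x)"
  by (simp add: sq_integrable_def)

lemma sq_integrable_diff:
  assumes "sq_integrable f" "sq_integrable g"
  shows "sq_integrable (\<lambda>x. f x - g x)"
  using sq_integrable_add[OF assms(1) sq_integrable_uminus[OF assms(2)]] by simp

lemma sq_integrable_scaleR: "sq_integrable f \<Longrightarrow> sq_integrable (\<lambda>x. c *\<^sub>R f x)"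
  by (auto simp: sq_integrable_def power_mult_distrib)

lemma norm_vector_smult: "norm (c *s (x :: complex^'m)) = norm c * norm x"
  by (simp add: norm_vec_def norm_mult L2_set_right_distrib)

lemma vector_smult_measurable:
  fixes f :: "'a::euclidean_space \<Rightarrow> complex^'m"
  assumes "f \<in> borel_measurable lebesgue"
  shows "(\<lambda>x. c *s f x) \<in> borel_measurable lebesgue"
proof -
  have "continuous_on UNIV (\<lambda>v :: complex^'m. c *s v)"
    unfolding vector_scalar_mult_def by (intro continuous_intros)
  from borel_measurable_continuous_on[OF this assms] show ?thesis .
qed

lemma sq_integrable_smult:
  fixes f :: "'a::euclidean_space \<Rightarrow> complex^'m"
  shows "sq_integrable f \<Longrightarrow> sq_integrable (\<lambda>x. c *s f x)"
  by (simp add: sq_integrable_def power_mult_distrib norm_vector_smult vector_smult_measurable)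

lemma integrable_inner_sq:
  assumes "sq_integrable f" "sq_integrable g"
  shows "integrable lebesgue (\<lambda>x. inner (f x) (g x))"
proof (rule Bochner_Integration.integrable_bound)
  show "integrable lebesgue (\<lambda>x. (norm (f x))\<^sup>2 + (norm (g x))\<^sup>2)"
    using assms by (auto simp: sq_integrable_def)
  show "(\<lambda>x. inner (f x) (g x)) \<in> borel_measurable lebesgue"
    using assms by (auto simp: sq_integrable_def)
  show "AE x in lebesgue. norm (inner (f x) (g x)) \<le> norm ((norm (f x))\<^sup>2 + (norm (g x))\<^sup>2)"
  proof (intro AE_I2)
    fix x
    have "norm (inner (f x) (g x)) \<le> norm (f x) * norm (g x)"
      using Cauchy_Schwarz_ineq2 by auto
    also have "\<dots> \<le> (norm (f x))\<^sup>2 + (norm (g x))\<^sup>2"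
      using sum_squares_bound[of "norm (f x)" "norm (g x)"]
        mult_nonneg_nonneg[OF norm_ge_zero[of "f x"] norm_ge_zero[of "g x"]]
      unfolding mult.assoc by linarith
    finally show "norm (inner (f x) (g x)) \<le> norm ((norm (f x))\<^sup>2 + (norm (g x))\<^sup>2)"
      by simp
  qed
qed

lemma integral_cong_AE_lebesgue:
  fixes f g :: "'a::euclidean_space \<Rightarrow> 'b::euclidean_space"
  assumes eq: "AE x in lebesgue. f x = g x"
  shows "(LINT x|lebesgue. f x) = (LINT x|lebesgue. g x)"
proof (cases "f \<in> borel_measurable lebesgue")
  case True
  then show ?thesis
    using borel_measurable_AE[OF True eq] eq by (intro integral_cong_AE) auto
next
  case False
  have "AE x in lebesgue. g x = f x"
    using eq by eventually_elim simp
  then have "g \<notin> borel_measurable lebesgue"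
    using False borel_measurable_AE by blast
  with False show ?thesis
    by (metis borel_measurable_integrable not_integrable_integral_eq)
qed

quotient_type (overloaded) ('a, 'm) l2 =
  "'a::euclidean_space \<Rightarrow> complex ^ ('m::finite)" / partial:
  "\<lambda>f g. sq_integrable f \<and> sq_integrable g \<and> (AE x in lebesgue. f x = g x)"
proof (rule part_equivpI)
  show "\<exists>f :: 'a \<Rightarrow> complex ^ 'm. sq_integrable f \<and> sq_integrable f \<and> (AE x in lebesgue. f x = f x)"
    using sq_integrable_zero by auto
  show "symp (\<lambda>f g :: 'a \<Rightarrow> complex ^ 'm.
      sq_integrable f \<and> sq_integrable g \<and> (AE x in lebesgue. f x = g x))"
    by (auto simp: symp_def eq_commute)
  show "transp (\<lambda>f g :: 'a \<Rightarrow> complex ^ 'm.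
      sq_integrable f \<and> sq_integrable g \<and> (AE x in lebesgue. f x = g x))"
  proof (rule transpI, intro conjI; (elim conjE)?)
    fix f g h :: "'a \<Rightarrow> complex ^ 'm"
    assume "AE x in lebesgue. f x = g x" "AE x in lebesgue. g x = h x"
    then show "AE x in lebesgue. f x = h x" by eventually_elim simp
  qed auto
qed

instantiation l2 :: (euclidean_space, finite) real_vector
begin

lift_definition zero_l2 :: "('a, 'b) l2" is "\<lambda>x. 0"
  by (simp add: sq_integrable_zero)

lift_definition plus_l2 :: "('a, 'b) l2 \<Rightarrow> ('a, 'b) l2 \<Rightarrow> ('a, 'b) l2" is "\<lambda>f g x. f x + g x"
  by (auto simp: sq_integrable_add)

lift_definition minus_l2 :: "('a, 'b) l2 \<Rightarrow> ('a, 'b) l2 \<Rightarrow> ('a, 'b) l2" is "\<lambda>f g x. f x - g x"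
  by (auto simp: sq_integrable_diff)

lift_definition uminus_l2 :: "('a, 'b) l2 \<Rightarrow> ('a, 'b) l2" is "\<lambda>f x. - f x"
  by (auto simp: sq_integrable_uminus)

lift_definition scaleR_l2 :: "real \<Rightarrow> ('a, 'b) l2 \<Rightarrow> ('a, 'b) l2" is "\<lambda>c f x. c *\<^sub>R f x"
  by (auto simp: sq_integrable_scaleR)

instance
proof
  fix f g h :: "('a, 'b) l2" and c d :: real
  show "f + g + h = f + (g + h)"
    by transfer (simp add: sq_integrable_add add.assoc)
  show "f + g = g + f"
    by transfer (simp add: sq_integrable_add add.commute)
  show "0 + f = f"
    by transfer (simp add: sq_integrable_zero)
  show "- f + f = 0"
    by transfer (simp add: sq_integrable_zero)
  show "f - g = f + - g"
    by transfer (simp add: sq_integrable_diff)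
  show "c *\<^sub>R (f + g) = c *\<^sub>R f + c *\<^sub>R g"
    by transfer (simp add: sq_integrable_add sq_integrable_scaleR scaleR_add_right)
  show "(c + d) *\<^sub>R f = c *\<^sub>R f + d *\<^sub>R f"
    by transfer (simp add: sq_integrable_add sq_integrable_scaleR scaleR_add_left)
  show "c *\<^sub>R d *\<^sub>R f = (c * d) *\<^sub>R f"
    by transfer (simp add: sq_integrable_scaleR)
  show "1 *\<^sub>R f = f"
    by transfer simp
qed

end

instantiation l2 :: (euclidean_space, finite) real_inner
begin

lift_definition inner_l2 :: "('a, 'b) l2 \<Rightarrow> ('a, 'b) l2 \<Rightarrow> real" is
  "\<lambda>f g. LINT x|lebesgue. inner (f x) (g x)"
proof (elim conjE)
  fix f f' g g' :: "'a \<Rightarrow> complex ^ 'b"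
  assume "AE x in lebesgue. f x = f' x" "AE x in lebesgue. g x = g' x"
  then have "AE x in lebesgue. inner (f x) (g x) = inner (f' x) (g' x)"
    by eventually_elim simp
  then show "(LINT x|lebesgue. inner (f x) (g x)) = (LINT x|lebesgue. inner (f' x) (g' x))"
    by (rule integral_cong_AE_lebesgue)
qed

definition norm_l2 :: "('a, 'b) l2 \<Rightarrow> real" where
  "norm_l2 f = sqrt (inner f f)"

definition sgn_l2 :: "('a, 'b) l2 \<Rightarrow> ('a, 'b) l2" where
  "sgn_l2 f = f /\<^sub>R norm f"

definition dist_l2 :: "('a, 'b) l2 \<Rightarrow> ('a, 'b) l2 \<Rightarrow> real" where
  "dist_l2 f g = norm (f - g)"

definition uniformity_l2 :: "(('a, 'b) l2 \<times> ('a, 'b) l2) filter" where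
  "uniformity_l2 = (INF e\<in>{0 <..}. principal {(x, y). dist x y < e})"

definition open_l2 :: "('a, 'b) l2 set \<Rightarrow> bool" where
  "open_l2 U \<longleftrightarrow> (\<forall>x\<in>U. \<forall>\<^sub>F (x', y) in uniformity. x' = x \<longrightarrow> y \<in> U)"

instance
proof
  fix f g h :: "('a, 'b) l2" and c :: real and U :: "('a, 'b) l2 set"
  show "dist f g = norm (f - g)" by (rule dist_l2_def)
  show "sgn f = f /\<^sub>R norm f" by (rule sgn_l2_def)
  show "uniformity = (INF e\<in>{0 <..}. principal {(x :: ('a, 'b) l2, y). dist x y < e})"
    by (rule uniformity_l2_def)
  show "open U \<longleftrightarrow> (\<forall>x\<in>U. \<forall>\<^sub>F (x', y) in uniformity. x' = x \<longrightarrow> y \<in> U)"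
    by (rule open_l2_def)
  show "norm f = sqrt (inner f f)" by (rule norm_l2_def)
  show "inner f g = inner g f" by transfer (simp add: inner_commute)
  show "inner (f + g) h = inner f h + inner g h"
    by transfer (simp add: inner_add_left integrable_inner_sq)
  show "inner (c *\<^sub>R f) g = c * inner f g"
    by transfer simp
  show "0 \<le> inner f f"
    by transfer simp
  show "inner f f = 0 \<longleftrightarrow> f = 0"
    by transfer
       (auto simp: sq_integrable_zero integrable_inner_sq integral_nonneg_eq_0_iff_AE)
qed

end

lift_definition scaleC_l2 ::
    "complex \<Rightarrow> ('a::euclidean_space, 'm::finite) l2 \<Rightarrow> ('a, 'm) l2" (infixr "*\<^sub>C" 75)
  is "\<lambda>c f x. c *s f x"
  by (auto simp: sq_integrable_smult)

global_interpretation l2_complex: vector_space scaleC_l2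
proof
  fix f g :: "('a::euclidean_space, 'm::finite) l2" and c d :: complex
  show "c *\<^sub>C (f + g) = c *\<^sub>C f + c *\<^sub>C g"
    by transfer (simp add: sq_integrable_add sq_integrable_smult vector_add_ldistrib)
  show "(c + d) *\<^sub>C f = c *\<^sub>C f + d *\<^sub>C f"
    by transfer (simp add: sq_integrable_add sq_integrable_smult vector_sadd_rdistrib)
  show "c *\<^sub>C d *\<^sub>C f = (c * d) *\<^sub>C f"
    by transfer (simp add: sq_integrable_smult vector_smult_assoc)
  show "1 *\<^sub>C f = f"
    by transfer simp
qed

lift_definition cinner_l2 ::
    "('a::euclidean_space, 'm::finite) l2 \<Rightarrow> ('a, 'm) l2 \<Rightarrow> complex"
  is "\<lambda>f g. LINT x|lebesgue. (\<Sum>J\<in>UNIV. f x $ J * cnj (g x $ J))"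
proof (elim conjE)
  fix f f' g g' :: "'a \<Rightarrow> complex ^ 'm"
  assume "AE x in lebesgue. f x = f' x" "AE x in lebesgue. g x = g' x"
  then have "AE x in lebesgue.
      (\<Sum>J\<in>UNIV. f x $ J * cnj (g x $ J)) = (\<Sum>J\<in>UNIV. f' x $ J * cnj (g' x $ J))"
    by eventually_elim simp
  then show "(LINT x|lebesgue. (\<Sum>J\<in>UNIV. f x $ J * cnj (g x $ J))) =
      (LINT x|lebesgue. (\<Sum>J\<in>UNIV. f' x $ J * cnj (g' x $ J)))"
    by (rule integral_cong_AE_lebesgue)
qed

lemma scaleC_of_real: "complex_of_real c *\<^sub>C f = c *\<^sub>R f"
proof (transfer, intro conjI)
  fix c and f :: "'a \<Rightarrow> complex ^ 'b"
  assume f: "sq_integrable f \<and> sq_integrable f \<and> (AE x in lebesgue. f x = f x)"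
  show "sq_integrable (\<lambda>x. complex_of_real c *s f x)" "sq_integrable (\<lambda>x. c *\<^sub>R f x)"
    using f by (auto simp only: sq_integrable_smult sq_integrable_scaleR)
  have "complex_of_real c *s v = c *\<^sub>R v" for v :: "complex ^ 'b"
    by (simp add: vec_eq_iff scaleR_conv_of_real[where 'a = complex])
  then show "AE x in lebesgue. complex_of_real c *s f x = c *\<^sub>R f x"
    by (intro AE_I2)
qed

lemma Re_cinner_l2: "Re (cinner_l2 f g) = inner f g"
proof (transfer, elim conjE)
  fix f g :: "'a \<Rightarrow> complex ^ 'b"
  assume f: "sq_integrable f" and g: "sq_integrable g"
  have re: "Re (\<Sum>J\<in>UNIV. u $ J * cnj (v $ J)) = inner u v" for u v :: "complex ^ 'b"
    by (simp add: inner_vec_def inner_complex_def)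
  have im: "Im (\<Sum>J\<in>UNIV. u $ J * cnj (v $ J)) = inner u (\<i> *s v)" for u v :: "complex ^ 'b"
    by (simp add: inner_vec_def inner_complex_def algebra_simps)
  have "integrable lebesgue (\<lambda>x. complex_of_real (inner (f x) (g x)) +
      \<i> * complex_of_real (inner (f x) (\<i> *s g x)))"
    using f g by (intro Bochner_Integration.integrable_add integrable_mult_right
        integrable_of_real integrable_inner_sq sq_integrable_smult)
  also have "(\<lambda>x. complex_of_real (inner (f x) (g x)) +
      \<i> * complex_of_real (inner (f x) (\<i> *s g x))) = (\<lambda>x. \<Sum>J\<in>UNIV. f x $ J * cnj (g x $ J))"
    by (rule ext, subst re[symmetric], subst im[symmetric], rule complex_eq[symmetric])
  finally show "Re (LINT x|lebesgue. (\<Sum>J\<in>UNIV. f x $ J * cnj (g x $ J))) =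
      (LINT x|lebesgue. inner (f x) (g x))"
    unfolding re[symmetric] by (rule integral_Re[symmetric])
qed

text \<open>
  The Hilbert spaces below are closed complex subspaces of a fixed type \<open>l2\<close>.
  Bounded operators are functions of which only the values on the first subspace matter;
  unbounded operators are given by their graphs.
\<close>

type_synonym ('a, 'm) l2_op = "('a, 'm) l2 \<Rightarrow> ('a, 'm) l2"
type_synonym ('a, 'm) l2_graph = "(('a, 'm) l2 \<times> ('a, 'm) l2) set"

definition bounded_operator ::
    "('a::euclidean_space, 'm::finite) l2 set \<Rightarrow> ('a, 'm) l2 set \<Rightarrow> ('a, 'm) l2_op \<Rightarrow> bool" where
  "bounded_operator H1 H2 T \<longleftrightarrow>
     (\<forall>f\<in>H1. T f \<in> H2) \<and>
     (\<forall>f\<in>H1. \<forall>g\<in>H1. T (f + g) = T f + T g) \<and>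
     (\<forall>c. \<forall>f\<in>H1. T (c *\<^sub>C f) = c *\<^sub>C T f) \<and>
     (\<exists>M. \<forall>f\<in>H1. norm (T f) \<le> M * norm f)"

definition is_adjoint ::
    "('a::euclidean_space, 'm::finite) l2 set \<Rightarrow> ('a, 'm) l2 set \<Rightarrow>
     ('a, 'm) l2_op \<Rightarrow> ('a, 'm) l2_op \<Rightarrow> bool" where
  "is_adjoint H1 H2 T S \<longleftrightarrow>
     (\<forall>g\<in>H2. S g \<in> H1) \<and> (\<forall>f\<in>H1. \<forall>g\<in>H2. cinner_l2 (T f) g = cinner_l2 f (S g))"

definition compact_operator ::
    "('a::euclidean_space, 'm::finite) l2 set \<Rightarrow> ('a, 'm) l2 set \<Rightarrow> ('a, 'm) l2_op \<Rightarrow> bool" where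
  "compact_operator H1 H2 T \<longleftrightarrow>
     bounded_operator H1 H2 T \<and> compact (closure (T ` (H1 \<inter> cball 0 1)))"

definition eigenspace ::
    "('a::euclidean_space, 'm::finite) l2 set \<Rightarrow> ('a, 'm) l2_op \<Rightarrow> complex \<Rightarrow> ('a, 'm) l2 set" where
  "eigenspace H B \<mu> = {f \<in> H. B f = \<mu> *\<^sub>C f}"

text \<open>
  The eigenvalue 0 is left out of the sum, to which it contributes nothing; the eigenspaces for
  the other eigenvalues of a compact operator are finite-dimensional.
\<close>

definition trace_class ::
    "('a::euclidean_space, 'm::finite) l2 set \<Rightarrow> ('a, 'm) l2_op \<Rightarrow> bool" where
  "trace_class H B \<longleftrightarrow>
     is_adjoint H H B B \<and> compact_operator H H B \<and>
     (\<lambda>\<mu>. real (l2_complex.dim (eigenspace H B \<mu>)) * norm \<mu>)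
       summable_on {\<mu>. \<mu> \<noteq> 0 \<and> (\<exists>f\<in>eigenspace H B \<mu>. f \<noteq> 0)}"

definition poly_operator ::
    "real poly \<Rightarrow> ('a::euclidean_space, 'm::finite) l2_op \<Rightarrow> ('a, 'm) l2_op" where
  "poly_operator P A f = (\<Sum>i\<le>degree P. coeff P i *\<^sub>R (A ^^ i) f)"

text \<open>
  For a positive bounded operator \<open>A\<close> on \<open>H\<close> and \<open>s > 0\<close>, the operator \<open>A\<^sup>s\<close> of the continuous
  functional calculus: the limit in operator norm of \<open>P\<^sub>k(A)\<close>, where the polynomials \<open>P\<^sub>k\<close>
  converge to \<open>x\<^sup>s\<close> uniformly on an interval \<open>[0, M]\<close> containing the spectrum of \<open>A\<close>.
  Such polynomials exist, and the limit does not depend on their choice.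
\<close>

definition is_operator_powr ::
    "('a::euclidean_space, 'm::finite) l2 set \<Rightarrow> ('a, 'm) l2_op \<Rightarrow> real \<Rightarrow> ('a, 'm) l2_op \<Rightarrow> bool" where
  "is_operator_powr H A s B \<longleftrightarrow>
     bounded_operator H H B \<and>
     (\<forall>M P. (\<forall>f\<in>H. norm (A f) \<le> M * norm f) \<longrightarrow>
        uniform_limit {0..M} (\<lambda>k. poly (P k)) (\<lambda>x. x powr s) sequentially \<longrightarrow>
        (\<forall>\<epsilon>>0. \<forall>\<^sub>F k in sequentially.
           \<forall>f\<in>H. norm (poly_operator (P k) A f - B f) \<le> \<epsilon> * norm f))"

definition schatten_class ::
    "real \<Rightarrow> ('a::euclidean_space, 'm::finite) l2 set \<Rightarrow> ('a, 'm) l2 set \<Rightarrow> ('a, 'm) l2_op \<Rightarrow> bool" where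
  "schatten_class p H1 H2 T \<longleftrightarrow>
     bounded_operator H1 H2 T \<and>
     (\<exists>S B. is_adjoint H1 H2 T S \<and> is_operator_powr H1 (S \<circ> T) (p / 2) B \<and> trace_class H1 B)"

definition hilbert_schmidt ::
    "('a::euclidean_space, 'm::finite) l2 set \<Rightarrow> ('a, 'm) l2 set \<Rightarrow> ('a, 'm) l2_op \<Rightarrow> bool" where
  "hilbert_schmidt = schatten_class 2"

definition graph_adjoint ::
    "('a::euclidean_space, 'm::finite) l2 set \<Rightarrow> ('a, 'm) l2 set \<Rightarrow>
     ('a, 'm) l2_graph \<Rightarrow> ('a, 'm) l2_graph" where
  "graph_adjoint H1 H2 A =
     {(g, h). g \<in> H2 \<and> h \<in> H1 \<and> (\<forall>(f, Af)\<in>A. cinner_l2 Af g = cinner_l2 f h)}"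

definition graph_apply :: "('a, 'm) l2_graph \<Rightarrow> ('a::euclidean_space, 'm::finite) l2_op" where
  "graph_apply A f = (SOME g. (f, g) \<in> A)"

text \<open>For open \<open>S\<close>, \<open>Ck_on k f S\<close> means that \<open>f\<close> is of class \<open>C\<^sup>k\<close> on \<open>S\<close> in the real sense.\<close>

fun Ck_on :: "nat \<Rightarrow> ('a::euclidean_space \<Rightarrow> 'b::real_normed_vector) \<Rightarrow> 'a set \<Rightarrow> bool" where
  "Ck_on 0 f S \<longleftrightarrow> continuous_on S f"
| "Ck_on (Suc k) f S \<longleftrightarrow>
     (\<forall>x\<in>S. f differentiable (at x)) \<and>
     (\<forall>v. Ck_on k (\<lambda>x. frechet_derivative f (at x) v) S)"

definition test_function :: "(complex ^ 'n \<Rightarrow> complex) \<Rightarrow> (complex ^ 'n) set \<Rightarrow> bool" where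
  "test_function \<phi> \<Omega> \<longleftrightarrow>
     (\<forall>k. Ck_on k \<phi> UNIV) \<and> compact (closure {z. \<phi> z \<noteq> 0}) \<and> closure {z. \<phi> z \<noteq> 0} \<subseteq> \<Omega>"

definition dzbar :: "'n::finite \<Rightarrow> (complex ^ 'n \<Rightarrow> complex) \<Rightarrow> complex ^ 'n \<Rightarrow> complex" where
  "dzbar k \<phi> z =
     (frechet_derivative \<phi> (at z) (axis k 1) + \<i> * frechet_derivative \<phi> (at z) (axis k \<i>)) / 2"

definition bounded_domain :: "(complex ^ 'n) set \<Rightarrow> bool" where
  "bounded_domain \<Omega> \<longleftrightarrow> open \<Omega> \<and> connected \<Omega> \<and> \<Omega> \<noteq> {} \<and> bounded \<Omega>"

definition C2_boundary :: "(complex ^ 'n) set \<Rightarrow> bool" where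
  "C2_boundary \<Omega> \<longleftrightarrow>
     (\<forall>p\<in>frontier \<Omega>. \<exists>U (r :: complex ^ 'n \<Rightarrow> real).
        open U \<and> p \<in> U \<and> Ck_on 2 r U \<and> \<Omega> \<inter> U = {z \<in> U. r z < 0} \<and>
        (\<forall>z\<in>U. frechet_derivative r (at z) \<noteq> (\<lambda>v. 0)))"

definition continuous_psh_on :: "(complex ^ 'n) set \<Rightarrow> (complex ^ 'n \<Rightarrow> real) \<Rightarrow> bool" where
  "continuous_psh_on \<Omega> u \<longleftrightarrow>
     continuous_on \<Omega> u \<and>
     (\<forall>z w. (\<forall>\<tau>. norm \<tau> \<le> 1 \<longrightarrow> z + \<tau> *s w \<in> \<Omega>) \<longrightarrow>
        u z \<le> integral {0..2 * pi} (\<lambda>t. u (z + cis t *s w)) / (2 * pi))"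

definition pseudoconvex :: "(complex ^ 'n) set \<Rightarrow> bool" where
  "pseudoconvex \<Omega> \<longleftrightarrow>
     (\<exists>u. continuous_psh_on \<Omega> u \<and> (\<forall>c. compact {z \<in> \<Omega>. u z \<le> c}))"

text \<open>
  A form \<open>\<Sum>\<^sub>J f\<^sub>J dz\<^sub>J\<close>-bar has one coefficient for each set \<open>J\<close> of indices, the
  differentials being taken in increasing order.  Forms on a domain are extended by zero
  to all of \<open>\<complex>\<^sup>n\<close>, so that the spaces \<open>L\<^sup>2\<^bsub>(0,q)\<^esub>(\<Omega>)\<close> are closed subspaces of a single type.
\<close>

type_synonym 'n form = "(complex ^ 'n, 'n set) l2"

lift_definition is_form :: "'n::finite form \<Rightarrow> (complex ^ 'n) set \<Rightarrow> nat \<Rightarrow> bool"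
  is "\<lambda>f \<Omega> q. AE z in lebesgue. \<forall>J. f z $ J \<noteq> 0 \<longrightarrow> z \<in> \<Omega> \<and> card J = q"
proof (elim conjE, intro ext)
  fix f g :: "complex ^ 'n \<Rightarrow> complex ^ 'n set" and \<Omega> :: "(complex ^ 'n) set" and q
  assume "AE z in lebesgue. f z = g z"
  then have "AE z in lebesgue. (\<forall>J. f z $ J \<noteq> 0 \<longrightarrow> z \<in> \<Omega> \<and> card J = q) \<longleftrightarrow>
      (\<forall>J. g z $ J \<noteq> 0 \<longrightarrow> z \<in> \<Omega> \<and> card J = q)"
    by eventually_elim simp
  then show "(AE z in lebesgue. \<forall>J. f z $ J \<noteq> 0 \<longrightarrow> z \<in> \<Omega> \<and> card J = q) =
      (AE z in lebesgue. \<forall>J. g z $ J \<noteq> 0 \<longrightarrow> z \<in> \<Omega> \<and> card J = q)"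
    by (rule eventually_subst)
qed

definition L2_forms :: "nat \<Rightarrow> (complex ^ 'n) set \<Rightarrow> 'n::finite form set" where
  "L2_forms q \<Omega> = {f. is_form f \<Omega> q}"

lift_definition l2_pairing ::
    "('a::euclidean_space, 'm::finite) l2 \<Rightarrow> 'm \<Rightarrow> ('a \<Rightarrow> complex) \<Rightarrow> complex"
  is "\<lambda>f J \<phi>. LINT z|lebesgue. f z $ J * \<phi> z"
proof (elim conjE, intro ext)
  fix f g :: "'a \<Rightarrow> complex ^ 'm" and J and \<phi> :: "'a \<Rightarrow> complex"
  assume "AE x in lebesgue. f x = g x"
  then have "AE z in lebesgue. f z $ J * \<phi> z = g z $ J * \<phi> z"
    by eventually_elim simp
  then show "(LINT z|lebesgue. f z $ J * \<phi> z) = (LINT z|lebesgue. g z $ J * \<phi> z)"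
    by (rule integral_cong_AE_lebesgue)
qed

text \<open>\<open>dz\<^sub>k \<and> dz\<^bsub>K - {k}\<^esub> = wedge_sign k K dz\<^sub>K\<close> for \<open>k \<in> K\<close>, all differentials conjugated.\<close>

definition wedge_sign :: "'n::linorder \<Rightarrow> 'n set \<Rightarrow> complex" where
  "wedge_sign k K = (-1) ^ card {j \<in> K. j < k}"

text \<open>The maximal extension: the derivatives are taken in the sense of distributions on \<open>\<Omega>\<close>.\<close>

definition dbar ::
    "nat \<Rightarrow> (complex ^ 'n::{finite,linorder}) set \<Rightarrow> ('n form \<times> 'n form) set" where
  "dbar q \<Omega> =
     {(f, g). f \<in> L2_forms q \<Omega> \<and> g \<in> L2_forms (q + 1) \<Omega> \<and>
        (\<forall>K \<phi>. card K = q + 1 \<longrightarrow> test_function \<phi> \<Omega> \<longrightarrow>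
           l2_pairing g K \<phi> =
             - (\<Sum>k\<in>K. wedge_sign k K * l2_pairing f (K - {k}) (dzbar k \<phi>)))}"

text \<open>\<open>dbar_adj q \<Omega>\<close> maps \<open>(0,q+1)\<close>-forms to \<open>(0,q)\<close>-forms.\<close>

definition dbar_adj ::
    "nat \<Rightarrow> (complex ^ 'n::{finite,linorder}) set \<Rightarrow> ('n form \<times> 'n form) set" where
  "dbar_adj q \<Omega> = graph_adjoint (L2_forms q \<Omega>) (L2_forms (q + 1) \<Omega>) (dbar q \<Omega>)"

definition complex_laplacian ::
    "(complex ^ 'n::{finite,linorder}) set \<Rightarrow> ('n form \<times> 'n form) set" where
  "complex_laplacian \<Omega> =
     {(f, g + h) | f g h. (f, g) \<in> dbar_adj 0 \<Omega> O dbar 0 \<Omega> \<and> (f, h) \<in> dbar 1 \<Omega> O dbar_adj 1 \<Omega>}"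

definition is_dbar_Neumann_operator ::
    "(complex ^ 'n::{finite,linorder}) set \<Rightarrow> ('n form \<Rightarrow> 'n form) \<Rightarrow> bool" where
  "is_dbar_Neumann_operator \<Omega> N \<longleftrightarrow>
     bounded_operator (L2_forms 1 \<Omega>) (L2_forms 1 \<Omega>) N \<and>
     (\<forall>f\<in>L2_forms 1 \<Omega>. (N f, f) \<in> complex_laplacian \<Omega>) \<and>
     (\<forall>(f, g)\<in>complex_laplacian \<Omega>. N g = f)"

end

theory Submission
  imports Defs
begin

text \<open>
  Both claims concern a positive operator \<open>A\<close> on \<open>(0,1)\<close>-forms, \<open>A = N\<close> or \<open>A = T\<^sup>*T\<close> with
  \<open>T = dbar\<^sup>* N\<close>, whose square would be of trace class.  If \<open>u\<close> is orthogonal to the kernel of \<open>dbar\<close>,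
  then \<open>dbar\<^sup>* N (dbar u) = u\<close>, hence \<open>\<langle>A v, v\<rangle> \<ge> \<parallel>u\<parallel>\<^sup>2\<close> for \<open>v = dbar u\<close> in both cases.  Derivatives
  \<open>u = \<partial>\<phi>/\<partial>z\<^sub>j\<close> of test functions are such functions, and for \<open>\<phi>\<close> living on a ball of radius
  \<open>\<epsilon>\<close> they give \<open>\<langle>A v, v\<rangle> \<ge> c \<epsilon>\<^sup>2 \<parallel>v\<parallel>\<^sup>2\<close>.  There is room in the domain for about \<open>\<epsilon>\<^bsup>-2n\<^esup>\<close> disjoint
  balls, so the normalised forms \<open>e\<close> satisfy \<open>\<Sum> \<langle>A e, e\<rangle>\<^sup>2 \<ge> c' \<epsilon>\<^bsup>4-2n\<^esup>\<close>, which is bounded away from 0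
  as \<open>n \<ge> 2\<close>.  But if \<open>A\<^sup>2\<close> is of trace class, these sums tend to 0 with \<open>\<epsilon>\<close>: up to a small
  Hilbert-Schmidt error \<open>A\<close> has finite rank, and the \<open>e\<close> tend to 0 weakly, uniformly over the balls.
\<close>

section \<open>Compact squares of positive operators\<close>

text \<open>The case n = 2 dictates the form of the argument: there the lower bound for the sums
  does not grow as \<epsilon> tends to 0, so boundedness of the Hilbert-Schmidt sums gives no
  contradiction and their smallness has to be proved, uniformly in the number of forms. The factor
  \<epsilon>^2 counts derivatives: u contains one derivative of a rescaled function and dbar u
  contains two. The exponents of the theorem are exactly those for which the power in the Schatten
  condition is a square of A: p = 4 gives the power 2 of T^*T, and p = 2 gives the power 1 of N^*N,
  which is N^2 as N is symmetric. Hence compactness is available for A^2 and not directly for A;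
  eigenvectors are found for A^2 and transferred to A by positivity. The spectral argument uses the
  real inner product, the real part of the complex one; the complex structure enters it only through
  the multiplicities of eigenvalues, at the price of a factor 2.\<close>

definition orthonormal_family :: "'i set \<Rightarrow> ('i \<Rightarrow> 'a::real_inner) \<Rightarrow> bool" where
  "orthonormal_family I e \<longleftrightarrow>
     (\<forall>i\<in>I. norm (e i) = 1) \<and> (\<forall>i\<in>I. \<forall>j\<in>I. i \<noteq> j \<longrightarrow> inner (e i) (e j) = 0)"

lemma orthonormal_family_inner:
  "orthonormal_family I e \<Longrightarrow> i \<in> I \<Longrightarrow> j \<in> I \<Longrightarrow> inner (e i) (e j) = (if i = j then 1 else 0)"
  by (auto simp: orthonormal_family_def norm_eq_1)

lemma orthonormal_family_subset:
  "orthonormal_family I e \<Longrightarrow> J \<subseteq> I \<Longrightarrow> orthonormal_family J e"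
  by (auto simp: orthonormal_family_def)

lemma inner_orthonormal_sum:
  assumes "orthonormal_family I e" "finite I" "j \<in> I"
  shows "inner (\<Sum>i\<in>I. c i *\<^sub>R e i) (e j) = c j"
proof -
  have "inner (\<Sum>i\<in>I. c i *\<^sub>R e i) (e j) = (\<Sum>i\<in>I. if i = j then c i else 0)"
    unfolding inner_sum_left
    by (rule sum.cong) (auto simp: orthonormal_family_inner[OF assms(1)] assms(3))
  then show ?thesis using assms by simp
qed

lemma inner_orthonormal_sum_self:
  assumes "orthonormal_family I e" "finite I"
  shows "inner (\<Sum>i\<in>I. c i *\<^sub>R e i) (\<Sum>i\<in>I. d i *\<^sub>R e i) = (\<Sum>i\<in>I. c i * d i)"
proof -
  have "inner (\<Sum>i\<in>I. c i *\<^sub>R e i) (\<Sum>i\<in>I. d i *\<^sub>R e i)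
      = (\<Sum>j\<in>I. d j * inner (\<Sum>i\<in>I. c i *\<^sub>R e i) (e j))"
    by (subst inner_sum_right) simp
  also have "\<dots> = (\<Sum>j\<in>I. d j * c j)"
    by (rule sum.cong) (auto simp: inner_orthonormal_sum[OF assms])
  finally show ?thesis by (simp add: mult.commute)
qed

lemma orthonormal_residual:
  fixes x :: "'a::real_inner"
  assumes "orthonormal_family I e" "finite I"
  defines "s \<equiv> x - (\<Sum>i\<in>I. inner x (e i) *\<^sub>R e i)"
  shows "\<And>j. j \<in> I \<Longrightarrow> inner s (e j) = 0"
    and "(norm s)\<^sup>2 + (\<Sum>i\<in>I. (inner x (e i))\<^sup>2) = (norm x)\<^sup>2"
proof -
  show 1: "inner s (e j) = 0" if "j \<in> I" for j
    using that by (simp add: s_def inner_diff_left inner_orthonormal_sum[OF assms(1,2)])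
  define p where "p = (\<Sum>i\<in>I. inner x (e i) *\<^sub>R e i)"
  have "inner s p = 0" by (simp add: p_def inner_sum_right 1)
  moreover have "inner p p = (\<Sum>i\<in>I. (inner x (e i))\<^sup>2)"
    unfolding p_def inner_orthonormal_sum_self[OF assms(1,2)] by (simp add: power2_eq_square)
  moreover have "x = s + p" by (simp add: s_def p_def)
  ultimately show "(norm s)\<^sup>2 + (\<Sum>i\<in>I. (inner x (e i))\<^sup>2) = (norm x)\<^sup>2"
    by (simp add: power2_norm_eq_inner inner_add_left inner_add_right inner_commute)
qed

lemma Bessel_inequality:
  assumes "orthonormal_family I e" "finite I"
  shows "(\<Sum>i\<in>I. (inner x (e i))\<^sup>2) \<le> (norm x)\<^sup>2"
  using orthonormal_residual(2)[OF assms, of x] zero_le_power2[of "norm (x - (\<Sum>i\<in>I. inner x (e i) *\<^sub>R e i))"]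
  by linarith

text \<open>The trace class hypothesis speaks about the square, so compactness is required of A
  applied twice. Boundedness of A is a consequence of this and not an axiom. All conditions are
  confined to \<open>H\<close>, since operators are total functions on the type of which only the
  values on a subspace matter.\<close>

locale compact_square =
  fixes H :: "'a::real_inner set" and A :: "'a \<Rightarrow> 'a"
  assumes subspace_H: "subspace H"
    and closed_H: "closed H"
    and A_mem: "x \<in> H \<Longrightarrow> A x \<in> H"
    and A_add: "x \<in> H \<Longrightarrow> y \<in> H \<Longrightarrow> A (x + y) = A x + A y"
    and A_scale: "x \<in> H \<Longrightarrow> A (c *\<^sub>R x) = c *\<^sub>R A x"
    and A_sym: "x \<in> H \<Longrightarrow> y \<in> H \<Longrightarrow> inner (A x) y = inner x (A y)"
    and A_pos: "x \<in> H \<Longrightarrow> 0 \<le> inner (A x) x"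
    and compact_AA: "compact (closure ((\<lambda>x. A (A x)) ` (H \<inter> cball 0 1)))"
begin

lemma H_simps [simp, intro]:
  "0 \<in> H" "x \<in> H \<Longrightarrow> y \<in> H \<Longrightarrow> x + y \<in> H" "x \<in> H \<Longrightarrow> y \<in> H \<Longrightarrow> x - y \<in> H"
  "x \<in> H \<Longrightarrow> c *\<^sub>R x \<in> H" "x \<in> H \<Longrightarrow> A x \<in> H"
  using subspace_H A_mem by (auto simp: subspace_0 subspace_add subspace_diff subspace_scale)

lemma A_zero [simp]: "A 0 = 0"
  using A_scale[of 0 0] by simp

lemma A_diff: "x \<in> H \<Longrightarrow> y \<in> H \<Longrightarrow> A (x - y) = A x - A y"
  using A_add[of x "(-1) *\<^sub>R y"] A_scale[of y "-1"] H_simps(4)[of y "-1"] by simp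

lemma A_sum: "(\<And>i. i \<in> I \<Longrightarrow> x i \<in> H) \<Longrightarrow> A (\<Sum>i\<in>I. c i *\<^sub>R x i) = (\<Sum>i\<in>I. c i *\<^sub>R A (x i))"
  and sum_mem: "(\<And>i. i \<in> I \<Longrightarrow> x i \<in> H) \<Longrightarrow> (\<Sum>i\<in>I. c i *\<^sub>R x i) \<in> H"
proof -
  show s: "(\<Sum>i\<in>I. c i *\<^sub>R x i) \<in> H" if "\<And>i. i \<in> I \<Longrightarrow> x i \<in> H" for I
    using that by (intro subspace_sum subspace_H) auto
  show "A (\<Sum>i\<in>I. c i *\<^sub>R x i) = (\<Sum>i\<in>I. c i *\<^sub>R A (x i))" if "\<And>i. i \<in> I \<Longrightarrow> x i \<in> H"
    using that
  proof (induction I rule: infinite_finite_induct)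
    case (insert i I)
    then show ?case using s[of I] by (simp add: A_add A_scale)
  qed auto
qed

lemma norm_A_sq: "x \<in> H \<Longrightarrow> (norm (A x))\<^sup>2 = inner (A (A x)) x"
  by (simp add: power2_norm_eq_inner A_sym)

text \<open>From A^2 - \<alpha>^2 = (A + \<alpha>)(A - \<alpha>), the vector g = Ax - \<alpha>x
  satisfies Ag = -\<alpha>g, and positivity of A leaves only g = 0.\<close>

lemma AA_eigen_imp_A_eigen:
  assumes x: "x \<in> H" "A (A x) = \<alpha>\<^sup>2 *\<^sub>R x" and "\<alpha> > 0"
  shows "A x = \<alpha> *\<^sub>R x"
proof -
  define g where "g = A x - \<alpha> *\<^sub>R x"
  have g: "g \<in> H" using x by (simp add: g_def)
  have "A g = - \<alpha> *\<^sub>R g"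
    using x by (simp add: g_def A_diff A_scale algebra_simps power2_eq_square)
  then have "0 \<le> - \<alpha> * inner g g" using A_pos[OF g] by simp
  then have "inner g g \<le> 0"
    using \<open>\<alpha> > 0\<close> by (simp add: zero_le_mult_iff mult_le_0_iff)
  then have "g = 0" by (metis inner_gt_zero_iff not_less)
  then show ?thesis by (simp add: g_def)
qed

lemma A_bounded: "\<exists>M. \<forall>x\<in>H. norm x = 1 \<longrightarrow> (norm (A x))\<^sup>2 \<le> M"
proof -
  obtain M where M: "\<And>y. y \<in> (\<lambda>x. A (A x)) ` (H \<inter> cball 0 1) \<Longrightarrow> norm y \<le> M"
    using bounded_subset[OF compact_imp_bounded[OF compact_AA] closure_subset]
    by (auto simp: bounded_iff)
  have "(norm (A x))\<^sup>2 \<le> M" if "x \<in> H" "norm x = 1" for x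
  proof -
    have "(norm (A x))\<^sup>2 \<le> norm (A (A x)) * norm x"
      unfolding norm_A_sq[OF that(1)] by (rule norm_cauchy_schwarz)
    then show ?thesis using M[of "A (A x)"] that by auto
  qed
  then show ?thesis by blast
qed

text \<open>A maximising sequence for the Rayleigh quotient of A^2 on the unit sphere of K consists
  of approximate eigenvectors; compactness makes a subsequence converge, and the limit is an
  eigenvector of A^2, hence of A. The invariant closed subspace K allows an application to the
  orthogonal complement of eigenvectors already at hand.\<close>

lemma exists_eigenvector:
  assumes K: "subspace K" "closed K" "K \<subseteq> H" "\<And>x. x \<in> K \<Longrightarrow> A x \<in> K"
    and x0: "x0 \<in> K" "(norm (A x0))\<^sup>2 > \<delta>\<^sup>2 * (norm x0)\<^sup>2" "\<delta> > 0"
  shows "\<exists>g\<in>K. \<exists>\<alpha>>\<delta>. norm g = 1 \<and> A g = \<alpha> *\<^sub>R g"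
proof -
  define U where "U = {x \<in> K. norm x = 1}"
  define s where "s = (SUP x\<in>U. (norm (A x))\<^sup>2)"
  have bdd: "bdd_above ((\<lambda>x. (norm (A x))\<^sup>2) ` U)"
    using A_bounded K(3) unfolding U_def bdd_above_def by fastforce
  have scale: "(norm (A x))\<^sup>2 \<le> s * (norm x)\<^sup>2" if "x \<in> K" for x
  proof (cases "x = 0")
    case False
    define y where "y = x /\<^sub>R norm x"
    have "y \<in> U" using False that K(1) by (simp add: U_def y_def subspace_scale)
    then have "(norm (A y))\<^sup>2 \<le> s" unfolding s_def by (rule cSUP_upper[OF _ bdd])
    moreover have "A y = A x /\<^sub>R norm x" using that K(3) by (auto simp: y_def A_scale)
    ultimately show ?thesis using False by (simp add: power_mult_distrib field_simps)
  qed auto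
  have "x0 \<noteq> 0" using x0 by auto
  have "\<delta>\<^sup>2 * (norm x0)\<^sup>2 < s * (norm x0)\<^sup>2"
    using scale[OF x0(1)] x0(2) by linarith
  then have s: "s > \<delta>\<^sup>2" by (simp add: mult_less_cancel_right not_less)
  then have s0: "s > 0" by (meson le_less_trans zero_le_power2)
  have Une: "U \<noteq> {}"
  proof -
    have "x0 /\<^sub>R norm x0 \<in> U" using \<open>x0 \<noteq> 0\<close> x0 K(1) by (simp add: U_def subspace_scale)
    then show ?thesis by blast
  qed
  have "\<exists>x\<in>U. (norm (A x))\<^sup>2 > s - 1 / Suc n" for n
    using less_cSUP_iff[OF Une bdd, of "s - 1 / Suc n"] unfolding s_def[symmetric] by simp
  then obtain x where x: "\<And>n. x n \<in> U" "\<And>n. (norm (A (x n)))\<^sup>2 > s - 1 / Suc n"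
    by metis
  have xK: "x n \<in> K" "norm (x n) = 1" "x n \<in> H" for n using x(1)[of n] K(3) by (auto simp: U_def)
  \<comment> \<open>As Ax lies in K, |A^2 x|^2 is at most s |Ax|^2. The expanded square is therefore
    at most s (s - |Ax|^2), which is small by the choice of the sequence.\<close>
  have est: "(norm (A (A (x n)) - s *\<^sub>R x n))\<^sup>2 \<le> s * (1 / Suc n)" for n
  proof -
    have "(norm (A (A (x n)) - s *\<^sub>R x n))\<^sup>2
        = (norm (A (A (x n))))\<^sup>2 - 2 * s * (norm (A (x n)))\<^sup>2 + s\<^sup>2"
      using xK(2)[of n] unfolding norm_A_sq[OF xK(3)] power2_norm_eq_inner norm_eq_1
      using A_sym[of "x n" "A (x n)"] xK(3)[of n]
      by (simp add: inner_diff_left inner_diff_right power2_eq_square inner_commute)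
    also have "\<dots> \<le> s * (s - (norm (A (x n)))\<^sup>2)"
      using scale[OF K(4)[OF xK(1)], of n] by (simp add: algebra_simps power2_eq_square)
    also have "\<dots> \<le> s * (1 / Suc n)"
      using x(2)[of n] s0 by (intro mult_left_mono) auto
    finally show ?thesis .
  qed
  have "(\<lambda>n. (norm (A (A (x n)) - s *\<^sub>R x n))\<^sup>2) \<longlonglongrightarrow> 0"
  proof (rule tendsto_sandwich[OF _ _ tendsto_const])
    show "(\<lambda>n. s * (1 / Suc n)) \<longlonglongrightarrow> 0"
      using tendsto_mult[OF tendsto_const LIMSEQ_Suc[OF lim_1_over_n], of s] by simp
  qed (use est in auto)
  then have "(\<lambda>n. sqrt ((norm (A (A (x n)) - s *\<^sub>R x n))\<^sup>2)) \<longlonglongrightarrow> sqrt 0"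
    by (intro tendsto_intros)
  then have diff0: "(\<lambda>n. A (A (x n)) - s *\<^sub>R x n) \<longlonglongrightarrow> 0"
    by (simp add: tendsto_norm_zero_iff)
  have "seq_compact (closure ((\<lambda>x. A (A x)) ` (H \<inter> cball 0 1)))"
    using compact_AA by (simp add: compact_eq_seq_compact_metric)
  moreover have "\<forall>n. A (A (x n)) \<in> closure ((\<lambda>x. A (A x)) ` (H \<inter> cball 0 1))"
    using xK by (intro allI subsetD[OF closure_subset]) (auto simp: dist_norm)
  ultimately obtain l r where r: "strict_mono r" "(\<lambda>n. A (A (x (r n)))) \<longlonglongrightarrow> l"
    by (elim seq_compactE) (auto simp: o_def)
  have lK: "l \<in> K"
    using closed_sequentially[OF K(2) _ r(2)] xK(1) K(4) by blast
  \<comment> \<open>The vector s x_n is A^2 x_n minus a null sequence, so convergence of the images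
    passes to the vectors themselves after division by s > 0.\<close>
  have "(\<lambda>n. A (A (x (r n))) - (A (A (x (r n))) - s *\<^sub>R x (r n))) \<longlonglongrightarrow> l - 0"
    using r(2) LIMSEQ_subseq_LIMSEQ[OF diff0 r(1)] by (intro tendsto_diff) (auto simp: o_def)
  then have "(\<lambda>n. (1/s) *\<^sub>R (s *\<^sub>R x (r n))) \<longlonglongrightarrow> (1/s) *\<^sub>R l"
    by (intro tendsto_intros) simp
  then have lim: "(\<lambda>n. x (r n)) \<longlonglongrightarrow> (1/s) *\<^sub>R l" using s0 by simp
  define y where "y = (1/s) *\<^sub>R l"
  have y: "y \<in> K" "y \<in> H" using lK K by (auto simp: y_def subspace_scale)
  have "(\<lambda>n. norm (x (r n))) \<longlonglongrightarrow> norm y"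
    using lim unfolding y_def by (intro tendsto_norm)
  then have ny: "norm y = 1" using xK by (simp add: LIMSEQ_const_iff)
  have bdA: "norm (A z) \<le> sqrt s * norm z" if "z \<in> K" for z
    using real_sqrt_le_mono[OF scale[OF that]] by (simp add: real_sqrt_mult)
  have bd: "norm (A (A z)) \<le> s * norm z" if "z \<in> K" for z
  proof -
    have "norm (A (A z)) \<le> sqrt s * (sqrt s * norm z)"
      using s0 by (intro order_trans[OF bdA[OF K(4)[OF that]] mult_left_mono[OF bdA[OF that]]]) simp
    then show ?thesis using s0 by (simp add: mult.assoc[symmetric])
  qed
  have "(\<lambda>n. A (A (x (r n)))) \<longlonglongrightarrow> A (A y)"
  proof (rule LIM_zero_cancel, rule Lim_null_comparison)
    show "\<forall>\<^sub>F n in sequentially. norm (A (A (x (r n))) - A (A y)) \<le> s * norm (x (r n) - y)"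
    proof (intro always_eventually allI)
      fix n
      have "A (A (x (r n))) - A (A y) = A (A (x (r n) - y))"
        using xK y by (simp add: A_diff)
      then show "norm (A (A (x (r n))) - A (A y)) \<le> s * norm (x (r n) - y)"
        using bd[of "x (r n) - y"] xK y K(1) by (simp add: subspace_diff)
    qed
    have "(\<lambda>n. s * norm (x (r n) - y)) \<longlonglongrightarrow> s * norm (y - y)"
      using lim unfolding y_def by (intro tendsto_intros)
    then show "(\<lambda>n. s * norm (x (r n) - y)) \<longlonglongrightarrow> 0" by simp
  qed
  then have "A (A y) = l" using r(2) LIMSEQ_unique by blast
  then have "A (A y) = (sqrt s)\<^sup>2 *\<^sub>R y" using s0 by (simp add: y_def)
  then have "A y = sqrt s *\<^sub>R y" using y s0 by (intro AA_eigen_imp_A_eigen) auto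
  moreover have "sqrt s > \<delta>" using s x0(3) by (simp add: real_less_rsqrt)
  ultimately show ?thesis using y ny by blast
qed

section \<open>Unit eigenvectors for positive eigenvalues\<close>

definition eigenvectors :: "'a set" where
  "eigenvectors = {f \<in> H. norm f = 1 \<and> (\<exists>\<alpha>>0. A f = \<alpha> *\<^sub>R f)}"

definition ev :: "'a \<Rightarrow> real" where "ev f = inner (A f) f"

lemma eigenvectorsD:
  assumes "f \<in> eigenvectors"
  shows "f \<in> H" "norm f = 1" "A f = ev f *\<^sub>R f" "ev f > 0"
  using assms by (auto simp: eigenvectors_def ev_def norm_eq_1)

text \<open>For orthonormal eigenvectors u and v the squared distance between A^2 u and A^2 v is
  \<open>(ev u)^4 + (ev v)^4\<close>, here at least \<delta>^4, so infinitely many of them would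
  contradict sequential compactness.\<close>

lemma finite_large_eigenvectors:
  assumes C: "C \<subseteq> eigenvectors" "orthonormal_family C id" and "\<delta> > 0"
  shows "finite {f \<in> C. ev f > \<delta>}"
proof (rule ccontr)
  assume "infinite {f \<in> C. ev f > \<delta>}"
  then obtain x :: "nat \<Rightarrow> 'a" where x: "inj x" "range x \<subseteq> {f \<in> C. ev f > \<delta>}"
    by (meson infinite_countable_subset)
  have xC: "x n \<in> C" "ev (x n) > \<delta>" "x n \<in> eigenvectors" for n using x(2) C(1) by auto
  have AA: "A (A (x n)) = (ev (x n))\<^sup>2 *\<^sub>R x n" for n
    using eigenvectorsD[OF xC(3)[of n]] A_scale[of "x n" "ev (x n)"] by (simp add: power2_eq_square)
  have "seq_compact (closure ((\<lambda>x. A (A x)) ` (H \<inter> cball 0 1)))"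
    using compact_AA by (simp add: compact_eq_seq_compact_metric)
  moreover have "\<forall>n. A (A (x n)) \<in> closure ((\<lambda>x. A (A x)) ` (H \<inter> cball 0 1))"
    using eigenvectorsD(1,2)[OF xC(3)]
    by (intro allI subsetD[OF closure_subset] image_eqI[OF refl]) (simp add: dist_norm)
  ultimately obtain l r where r: "strict_mono r" "(\<lambda>n. A (A (x (r n)))) \<longlonglongrightarrow> l"
    by (elim seq_compactE) (auto simp: o_def)
  have "Cauchy (\<lambda>n. A (A (x (r n))))" using r(2) LIMSEQ_imp_Cauchy by blast
  then obtain M where M: "\<And>m n. m \<ge> M \<Longrightarrow> n \<ge> M \<Longrightarrow> norm (A (A (x (r m))) - A (A (x (r n)))) < \<delta>\<^sup>2"
    using \<open>\<delta> > 0\<close> unfolding Cauchy_iff by (meson zero_less_power)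
  define u v where "u = x (r M)" and "v = x (r (Suc M))"
  have "u \<noteq> v" using x(1) r(1) by (auto simp: u_def v_def inj_eq strict_mono_eq)
  then have o: "inner u v = 0" "inner u u = 1" "inner v v = 1"
    using xC(1) C(2) orthonormal_family_inner[OF C(2), of u v]
      orthonormal_family_inner[OF C(2), of u u] orthonormal_family_inner[OF C(2), of v v]
    by (auto simp: u_def v_def)
  have "(norm (A (A u) - A (A v)))\<^sup>2 = (ev u)^4 + (ev v)^4"
    using AA[of "r M"] AA[of "r (Suc M)"] o unfolding u_def[symmetric] v_def[symmetric] power2_norm_eq_inner
    by (simp add: inner_diff_left inner_diff_right inner_commute power2_eq_square power4_eq_xxxx)
  moreover have "(norm (A (A u) - A (A v)))\<^sup>2 < (\<delta>\<^sup>2)\<^sup>2"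
    using M[of M "Suc M"] unfolding u_def v_def by (intro power_strict_mono) auto
  moreover have "(ev u)^4 \<ge> \<delta>^4" using xC(2)[of "r M"] \<open>\<delta> > 0\<close> unfolding u_def by (intro power_mono) auto
  moreover have "(ev v)^4 \<ge> 0" by simp
  ultimately show False by simp
qed

lemma eigenvectors_orthogonal:
  assumes "f \<in> H" "g \<in> H" "A f = \<alpha> *\<^sub>R f" "A g = \<mu> *\<^sub>R g" "\<alpha> \<noteq> \<mu>"
  shows "inner f g = 0"
  using A_sym[OF assms(1,2)] assms(3-5) by simp

text \<open>Zorn's lemma on orthonormal sets of eigenvectors. Maximality is recorded in the form in
  which it is applied: no eigenvector for a positive eigenvalue is orthogonal to all of
  \<open>C\<close>.\<close>

lemma maximal_orthonormal_eigenvectors: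
  obtains C where "C \<subseteq> eigenvectors" "orthonormal_family C id"
    "\<And>g. g \<in> eigenvectors \<Longrightarrow> \<exists>f\<in>C. inner g f \<noteq> 0"
proof -
  define \<C> where "\<C> = {C. C \<subseteq> eigenvectors \<and> orthonormal_family C id}"
  have "\<exists>C\<in>\<C>. \<forall>X\<in>\<C>. C \<subseteq> X \<longrightarrow> X = C"
  proof (rule subset_Zorn_nonempty)
    show "\<C> \<noteq> {}" by (auto simp: \<C>_def orthonormal_family_def intro: exI[of _ "{}"])
    fix \<X> assume X: "\<X> \<noteq> {}" "subset.chain \<C> \<X>"
    have "orthonormal_family (\<Union>\<X>) id"
      unfolding orthonormal_family_def id_def
    proof (intro conjI ballI impI)
      fix f assume "f \<in> \<Union>\<X>" then show "norm f = 1"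
        using X(2) by (auto simp: subset.chain_def \<C>_def eigenvectors_def)
    next
      fix f g assume "f \<in> \<Union>\<X>" "g \<in> \<Union>\<X>" "f \<noteq> g"
      then obtain Y where "Y \<in> \<X>" "f \<in> Y" "g \<in> Y"
        using X(2) by (auto simp: subset.chain_def subset_iff) blast
      moreover have "Y \<in> \<C>" using X(2) \<open>Y \<in> \<X>\<close> by (auto simp: subset.chain_def)
      ultimately show "inner f g = 0" using \<open>f \<noteq> g\<close> by (auto simp: \<C>_def orthonormal_family_def)
    qed
    then show "\<Union>\<X> \<in> \<C>" using X(2) by (auto simp: \<C>_def subset.chain_def)
  qed
  then obtain C where C: "C \<in> \<C>" "\<And>X. X \<in> \<C> \<Longrightarrow> C \<subseteq> X \<Longrightarrow> X = C" by blast
  show thesis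
  proof
    show "C \<subseteq> eigenvectors" "orthonormal_family C id" using C(1) by (auto simp: \<C>_def)
    fix g assume g: "g \<in> eigenvectors"
    show "\<exists>f\<in>C. inner g f \<noteq> 0"
    proof (rule ccontr)
      assume n: "\<not> ?thesis"
      then have "insert g C \<in> \<C>"
        using C(1) g by (auto simp: \<C>_def orthonormal_family_def eigenvectorsD inner_commute)
      then have "g \<in> C" using C(2)[of "insert g C"] by auto
      then show False using n eigenvectorsD(2)[OF g] by (auto simp: norm_eq_1)
    qed
  qed
qed

text \<open>The orthogonal complement of \<open>D\<close> in \<open>H\<close> is closed and
  invariant, so a violation would produce in it a unit eigenvector g with eigenvalue above \<delta>.
  By maximality some f in \<open>C\<close> is not orthogonal to g; this f lies outside
  \<open>D\<close>, so its eigenvalue is at most \<delta>, and different eigenvalues force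
  orthogonality.\<close>

lemma norm_A_le_orthogonal:
  assumes C: "C \<subseteq> eigenvectors" "\<And>g. g \<in> eigenvectors \<Longrightarrow> \<exists>f\<in>C. inner g f \<noteq> 0"
    and "\<delta> > 0" and D: "{f \<in> C. ev f > \<delta>} \<subseteq> D" "D \<subseteq> C"
    and x: "x \<in> H" "\<And>f. f \<in> D \<Longrightarrow> inner x f = 0"
  shows "norm (A x) \<le> \<delta> * norm x"
proof (rule ccontr)
  assume "\<not> ?thesis"
  then have "(norm (A x))\<^sup>2 > (\<delta> * norm x)\<^sup>2"
    using \<open>\<delta> > 0\<close> by (intro power_strict_mono) auto
  then have big: "(norm (A x))\<^sup>2 > \<delta>\<^sup>2 * (norm x)\<^sup>2" by (simp add: power_mult_distrib)
  define K where "K = {y \<in> H. \<forall>f\<in>D. inner y f = 0}"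
  have "subspace K"
    by (auto simp: K_def subspace_def inner_add_left)
  moreover have "closed K"
  proof -
    have "K = H \<inter> (\<Inter>f\<in>D. {y. inner f y = 0})" by (auto simp: K_def inner_commute)
    then show ?thesis using closed_H by (auto intro!: closed_INT closed_hyperplane)
  qed
  moreover have "A y \<in> K" if "y \<in> K" for y
  proof -
    have "inner (A y) f = 0" if "f \<in> D" for f
    proof -
      have f: "f \<in> eigenvectors" using that D C by auto
      have "inner (A y) f = inner y (A f)" using A_sym \<open>y \<in> K\<close> eigenvectorsD(1)[OF f] by (auto simp: K_def)
      also have "\<dots> = ev f * inner y f" by (subst eigenvectorsD(3)[OF f]) simp
      finally show ?thesis using \<open>y \<in> K\<close> that by (simp add: K_def)
    qed
    then show ?thesis using that by (auto simp: K_def)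
  qed
  moreover have "x \<in> K" "K \<subseteq> H" using x by (auto simp: K_def)
  ultimately obtain g \<alpha> where g: "g \<in> K" "\<alpha> > \<delta>" "norm g = 1" "A g = \<alpha> *\<^sub>R g"
    using exists_eigenvector[of K x \<delta>] big \<open>\<delta> > 0\<close> by blast
  have gE: "g \<in> eigenvectors" using g \<open>\<delta> > 0\<close> by (auto simp: eigenvectors_def K_def intro!: exI[of _ \<alpha>])
  obtain f where f: "f \<in> C" "inner g f \<noteq> 0" using C(2)[OF gE] by blast
  then have fE: "f \<in> eigenvectors" using C by auto
  have "f \<notin> D" using f g by (auto simp: K_def)
  then have "ev f \<le> \<delta>" using D(1) f(1) by (auto simp: subset_iff not_less)
  then have "inner g f = 0"
    using eigenvectors_orthogonal[OF _ eigenvectorsD(1)[OF fE] g(4) eigenvectorsD(3)[OF fE]] g(1,2)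
    by (auto simp: K_def)
  with f show False by simp
qed

text \<open>The members of a maximal system with eigenvalue \<alpha> span the eigenspace, because a
  nonzero residual would yield an eigenvector orthogonal to the whole system. Finiteness matters
  since \<open>l2_complex.dim\<close> is the cardinality of a basis, which would be 0 for an
  infinite one.\<close>

lemma eigenspace_finite_span:
  assumes "\<alpha> > 0"
  shows "\<exists>S. finite S \<and> S \<subseteq> {f \<in> H. A f = \<alpha> *\<^sub>R f} \<and> {f \<in> H. A f = \<alpha> *\<^sub>R f} \<subseteq> span S"
proof -
  obtain C where C: "C \<subseteq> eigenvectors" "orthonormal_family C id"
    "\<And>g. g \<in> eigenvectors \<Longrightarrow> \<exists>f\<in>C. inner g f \<noteq> 0"
    using maximal_orthonormal_eigenvectors by blast
  define S where "S = {f \<in> C. ev f = \<alpha>}"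
  have "S \<subseteq> {f \<in> C. ev f > \<alpha> / 2}" using assms by (auto simp: S_def)
  then have finS: "finite S"
    by (rule finite_subset) (rule finite_large_eigenvectors[OF C(1,2)], use assms in simp)
  have onS: "orthonormal_family S id" using C(2) by (rule orthonormal_family_subset) (auto simp: S_def)
  have SE: "f \<in> H" "A f = \<alpha> *\<^sub>R f" if "f \<in> S" for f
    using that C(1) eigenvectorsD[of f] by (auto simp: S_def)
  have "x \<in> span S" if x: "x \<in> H" "A x = \<alpha> *\<^sub>R x" for x
  proof -
    define s where "s = x - (\<Sum>f\<in>S. inner x f *\<^sub>R f)"
    have sH: "s \<in> H" using x SE by (auto simp: s_def intro!: sum_mem H_simps)
    have As: "A s = \<alpha> *\<^sub>R s"
    proof -
      have "A (\<Sum>f\<in>S. inner x f *\<^sub>R f) = \<alpha> *\<^sub>R (\<Sum>f\<in>S. inner x f *\<^sub>R f)"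
        using SE by (simp add: A_sum scaleR_sum_right mult.commute)
      moreover have "(\<Sum>f\<in>S. inner x f *\<^sub>R f) \<in> H" using SE by (intro sum_mem) auto
      ultimately show ?thesis using x by (simp add: s_def A_diff scaleR_diff_right)
    qed
    have "inner s f = 0" if "f \<in> C" for f
    proof (cases "f \<in> S")
      case True
      then show ?thesis using orthonormal_residual(1)[OF onS finS, of f x] by (simp add: s_def)
    next
      case False
      have "f \<in> eigenvectors" using that C by auto
      then show ?thesis
        using eigenvectors_orthogonal[OF sH _ As, of f "ev f"] eigenvectorsD[of f] False that by (auto simp: S_def)
    qed
    then have "s /\<^sub>R norm s \<notin> eigenvectors" using C(3)[of "s /\<^sub>R norm s"] by auto
    have "s = 0"
    proof (rule ccontr)
      assume "s \<noteq> 0"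
      then have "norm (s /\<^sub>R norm s) = 1" by simp
      moreover have "A (s /\<^sub>R norm s) = \<alpha> *\<^sub>R (s /\<^sub>R norm s)"
        unfolding A_scale[OF sH] As by (simp add: mult.commute)
      moreover have "s /\<^sub>R norm s \<in> H" using sH by simp
      ultimately have "s /\<^sub>R norm s \<in> eigenvectors"
        using assms unfolding eigenvectors_def by blast
      then show False using \<open>s /\<^sub>R norm s \<notin> eigenvectors\<close> by blast
    qed
    then have "x = (\<Sum>f\<in>S. inner x f *\<^sub>R f)" by (simp add: s_def)
    then show ?thesis by (metis (no_types, lifting) span_base span_scale span_sum)
  qed
  then show ?thesis using finS SE by blast
qed

section \<open>The quadratic form of the operator on orthonormal families\<close>

lemma inner_A_le:
  assumes D: "finite D" "D \<subseteq> eigenvectors" "orthonormal_family D id"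
    and x: "x \<in> H" "norm x = 1"
    and small: "\<And>y. y \<in> H \<Longrightarrow> (\<And>f. f \<in> D \<Longrightarrow> inner y f = 0) \<Longrightarrow> norm (A y) \<le> \<delta> * norm y" "\<delta> > 0"
  shows "inner (A x) x \<le> (\<Sum>f\<in>D. ev f * (inner x f)\<^sup>2) + \<delta>"
proof -
  define p where "p = (\<Sum>f\<in>D. inner x f *\<^sub>R f)"
  define s where "s = x - p"
  have DE: "f \<in> H" "A f = ev f *\<^sub>R f" if "f \<in> D" for f
    using that D(2) eigenvectorsD[of f] by auto
  have pH: "p \<in> H" unfolding p_def using DE by (intro sum_mem) auto
  have sH: "s \<in> H" using pH x by (simp add: s_def)
  have sf: "inner s f = 0" if "f \<in> D" for f
    using orthonormal_residual(1)[OF D(3,1), of f x] that by (simp add: s_def p_def)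
  have "(norm s)\<^sup>2 \<le> 1\<^sup>2"
    using orthonormal_residual(2)[OF D(3,1), of x] sum_nonneg[of D "\<lambda>f. (inner x f)\<^sup>2"] x
    by (simp add: s_def p_def)
  then have s1: "norm s \<le> 1" by (rule power2_le_imp_le) simp
  have Ap: "A p = (\<Sum>f\<in>D. (inner x f * ev f) *\<^sub>R f)"
    unfolding p_def using DE by (subst A_sum) auto
  \<comment> \<open>The span of \<open>D\<close> is invariant under A and s is orthogonal to it, so
    the mixed terms of the quadratic form vanish.\<close>
  have "inner s (A p) = 0" unfolding Ap inner_sum_right by (simp add: sf)
  then have o: "inner (A p) s = 0" "inner (A s) p = 0"
    using A_sym[OF sH pH] by (simp_all add: inner_commute)
  have pp: "inner (A p) p = (\<Sum>f\<in>D. ev f * (inner x f)\<^sup>2)"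
    using inner_orthonormal_sum_self[OF D(3,1), of "\<lambda>f. inner x f * ev f" "\<lambda>f. inner x f"]
    unfolding Ap unfolding p_def by (simp add: power2_eq_square mult_ac)
  have "inner (A s) s \<le> norm (A s) * norm s" by (rule norm_cauchy_schwarz)
  also have "\<dots> \<le> (\<delta> * norm s) * norm s"
    by (intro mult_right_mono small(1) sH sf) auto
  also have "\<dots> \<le> (\<delta> * 1) * 1"
    using s1 small(2) by (intro mult_mono) auto
  finally have "inner (A s) s \<le> \<delta>" by simp
  moreover have "x = p + s" by (simp add: s_def)
  ultimately show ?thesis
    using o pp by (simp add: A_add[OF pH sH] inner_add_left inner_add_right)
qed

text \<open>The quadratic form is split into a part on finitely many eigenvectors \<open>F\<close>,
  a tail with small square sum, and an error \<delta> for each vector. The order of the quantifiers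
  is the point: \<open>F\<close> and \<open>M\<close> do not depend on the family or on its size, so
  the number of vectors may be chosen afterwards, as long as \<theta> bounds their components along
  \<open>F\<close>.\<close>

lemma sum_inner_A_sq_small:
  assumes trace: "\<And>F. finite F \<Longrightarrow> F \<subseteq> eigenvectors \<Longrightarrow> orthonormal_family F id \<Longrightarrow>
      (\<Sum>f\<in>F. (ev f)\<^sup>2) \<le> S"
    and "\<eta> > 0"
  shows "\<exists>F M. finite F \<and> F \<subseteq> H \<and> (\<forall>(I :: 'i set) e \<theta>. finite I \<longrightarrow> orthonormal_family I e \<longrightarrow>
      e ` I \<subseteq> H \<longrightarrow> (\<forall>i\<in>I. \<forall>f\<in>F. \<bar>inner (e i) f\<bar> \<le> \<theta>) \<longrightarrow>
      (\<Sum>i\<in>I. (inner (A (e i)) (e i))\<^sup>2) \<le> \<eta> + M * \<theta>\<^sup>2)"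
proof -
  obtain C where C: "C \<subseteq> eigenvectors" "orthonormal_family C id"
    "\<And>g. g \<in> eigenvectors \<Longrightarrow> \<exists>f\<in>C. inner g f \<noteq> 0"
    using maximal_orthonormal_eigenvectors by blast
  define \<T> where "\<T> = (\<lambda>F. \<Sum>f\<in>F. (ev f)\<^sup>2) ` {F. finite F \<and> F \<subseteq> C}"
  have bdd: "bdd_above \<T>" unfolding bdd_above_def \<T>_def
    using C(1) orthonormal_family_subset[OF C(2)] by (auto intro!: exI[of _ S] trace)
  have ne: "\<T> \<noteq> {}" by (auto simp: \<T>_def)
  \<comment> \<open>\<open>F\<close> comes within \<eta>/6 of the supremum, so a finite subset of
    \<open>C\<close> disjoint from it has square sum at most \<eta>/6. The 6 is the factor 3 of
    \<open>sq3\<close> times the two error terms that share \<eta>.\<close>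
  obtain F where F: "finite F" "F \<subseteq> C" "(\<Sum>f\<in>F. (ev f)\<^sup>2) > Sup \<T> - \<eta> / 6"
    using less_cSup_iff[OF ne bdd, of "Sup \<T> - \<eta> / 6"] \<open>\<eta> > 0\<close> by (auto simp: \<T>_def)
  have tail: "(\<Sum>f\<in>G. (ev f)\<^sup>2) \<le> \<eta> / 6" if G: "finite G" "G \<subseteq> C" "G \<inter> F = {}" for G
  proof -
    have "(\<Sum>f\<in>F \<union> G. (ev f)\<^sup>2) \<in> \<T>" using F G by (auto simp: \<T>_def)
    then have "(\<Sum>f\<in>F \<union> G. (ev f)\<^sup>2) \<le> Sup \<T>" by (rule cSup_upper[OF _ bdd])
    moreover have "(\<Sum>f\<in>F \<union> G. (ev f)\<^sup>2) = (\<Sum>f\<in>F. (ev f)\<^sup>2) + (\<Sum>f\<in>G. (ev f)\<^sup>2)"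
      using F G by (intro sum.union_disjoint) auto
    ultimately show ?thesis using F(3) by linarith
  qed
  define m where "m = (\<Sum>f\<in>F. ev f)"
  have evpos: "ev f > 0" if "f \<in> C" for f using eigenvectorsD(4) C(1) that by blast
  have m0: "m \<ge> 0" unfolding m_def using F(2) evpos by (intro sum_nonneg) (auto intro: less_imp_le)
  have bound: "(\<Sum>i\<in>I. (inner (A (e i)) (e i))\<^sup>2) \<le> \<eta> + 3 * m\<^sup>2 * \<theta>\<^sup>2"
    if I: "finite I" "orthonormal_family I e" "e ` I \<subseteq> H" "\<forall>i\<in>I. \<forall>f\<in>F. \<bar>inner (e i) f\<bar> \<le> \<theta>"
    for I :: "'i set" and e \<theta>
  proof -
    \<comment> \<open>Unlike \<open>F\<close>, this \<delta> may depend on the size of the family: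
      all the errors together must stay below \<eta>/2. The set \<open>G\<close> of further
      eigenvectors may become large as \<delta> shrinks, but its square sum is still controlled by
      \<open>tail\<close>. The summand 1 covers the empty family.\<close>
    define \<delta> where "\<delta> = sqrt (\<eta> / (6 * (card I + 1)))"
    have \<delta>: "\<delta> > 0" using \<open>\<eta> > 0\<close> by (simp add: \<delta>_def)
    have "\<delta>\<^sup>2 = \<eta> / (6 * (card I + 1))" using \<open>\<eta> > 0\<close> by (simp add: \<delta>_def)
    then have "(card I + 1) * \<delta>\<^sup>2 = \<eta> / 6" by (simp add: field_simps)
    then have card\<delta>: "card I * \<delta>\<^sup>2 \<le> \<eta> / 6" using zero_le_power2[of \<delta>] by (simp only: of_nat_add of_nat_1 ring_distribs)
    define G where "G = {f \<in> C. ev f > \<delta>} - F"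
    have G: "finite G" "G \<subseteq> C" "G \<inter> F = {}"
      unfolding G_def by (rule finite_Diff[OF finite_large_eigenvectors[OF C(1,2) \<delta>]]) blast+
    define a where "a i = (\<Sum>f\<in>F. ev f * (inner (e i) f)\<^sup>2)" for i
    define b where "b i = (\<Sum>f\<in>G. ev f * (inner (e i) f)\<^sup>2)" for i
    have onF: "orthonormal_family F id" and onG: "orthonormal_family G id"
      by (rule orthonormal_family_subset[OF C(2)], rule F G)+
    have ab: "inner (A (e i)) (e i) \<le> a i + b i + \<delta>" if "i \<in> I" for i
    proof -
      have "inner (A (e i)) (e i) \<le> (\<Sum>f\<in>F \<union> G. ev f * (inner (e i) f)\<^sup>2) + \<delta>"
      proof (rule inner_A_le)
        show "finite (F \<union> G)" "F \<union> G \<subseteq> eigenvectors" using F(1,2) G(1,2) C(1) by auto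
        show "orthonormal_family (F \<union> G) id"
          by (rule orthonormal_family_subset[OF C(2)]) (use F(2) G(2) in blast)
        show "e i \<in> H" "norm (e i) = 1" using I that by (auto simp: orthonormal_family_def)
        show "norm (A y) \<le> \<delta> * norm y"
          if "y \<in> H" "\<And>f. f \<in> F \<union> G \<Longrightarrow> inner y f = 0" for y
          by (rule norm_A_le_orthogonal[OF C(1,3) \<delta>, of "F \<union> G"]) (use F G that in \<open>auto simp: G_def\<close>)
      qed (rule \<delta>)
      also have "(\<Sum>f\<in>F \<union> G. ev f * (inner (e i) f)\<^sup>2) = a i + b i"
        unfolding a_def b_def using F G by (intro sum.union_disjoint) auto
      finally show ?thesis .
    qed
    have a0: "a i \<ge> 0" for i unfolding a_def using F(2) evpos by (intro sum_nonneg mult_nonneg_nonneg) (auto intro: less_imp_le)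
    have b0: "b i \<ge> 0" for i unfolding b_def using G(2) evpos by (intro sum_nonneg mult_nonneg_nonneg) (auto intro: less_imp_le)
    have sq3: "(x + y + z)\<^sup>2 \<le> 3 * x\<^sup>2 + 3 * y\<^sup>2 + 3 * z\<^sup>2" for x y z :: real
      using zero_le_power2[of "x - y"] zero_le_power2[of "y - z"] zero_le_power2[of "x - z"]
      by (simp add: power2_eq_square algebra_simps)
    have "(\<Sum>i\<in>I. (inner (A (e i)) (e i))\<^sup>2) \<le> (\<Sum>i\<in>I. 3 * (a i)\<^sup>2 + 3 * (b i)\<^sup>2 + 3 * \<delta>\<^sup>2)"
    proof (rule sum_mono)
      fix i assume "i \<in> I"
      then have "(inner (A (e i)) (e i))\<^sup>2 \<le> (a i + b i + \<delta>)\<^sup>2"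
        using I(3) by (intro power_mono ab A_pos) auto
      then show "(inner (A (e i)) (e i))\<^sup>2 \<le> 3 * (a i)\<^sup>2 + 3 * (b i)\<^sup>2 + 3 * \<delta>\<^sup>2"
        using sq3 order_trans by blast
    qed
    also have "\<dots> = 3 * (\<Sum>i\<in>I. (a i)\<^sup>2) + 3 * (\<Sum>i\<in>I. (b i)\<^sup>2) + 3 * (card I * \<delta>\<^sup>2)"
      by (simp add: sum.distrib sum_distrib_left)
    also have "\<dots> \<le> 3 * (m\<^sup>2 * \<theta>\<^sup>2) + 3 * (\<eta> / 6) + 3 * (\<eta> / 6)"
    proof (intro add_mono mult_left_mono card\<delta>)
      have bessel: "(\<Sum>i\<in>I. (inner (e i) f)\<^sup>2) \<le> 1" if "f \<in> C" for f
        using Bessel_inequality[OF I(2,1), of f] eigenvectorsD(2)[of f] C(1) that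
        by (auto simp: inner_commute)
      \<comment> \<open>One factor \<open>a i\<close> is bounded pointwise by
        \<open>m * \<theta>\<^sup>2\<close>. The other is summed over i by Bessel's inequality,
        which gives at most m, whatever the number of vectors.\<close>
      have "(\<Sum>i\<in>I. (a i)\<^sup>2) \<le> (\<Sum>i\<in>I. m * \<theta>\<^sup>2 * a i)"
      proof (rule sum_mono)
        fix i assume i: "i \<in> I"
        have "a i \<le> (\<Sum>f\<in>F. ev f * \<theta>\<^sup>2)"
          unfolding a_def
        proof (intro sum_mono mult_left_mono)
          fix f assume "f \<in> F"
          then have "\<bar>inner (e i) f\<bar> \<le> \<theta>" using I(4) i by blast
          then show "(inner (e i) f)\<^sup>2 \<le> \<theta>\<^sup>2" using power_mono[of "\<bar>inner (e i) f\<bar>" \<theta> 2] by simp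
          show "0 \<le> ev f" using \<open>f \<in> F\<close> F(2) evpos by (auto intro: less_imp_le)
        qed
        then have "a i \<le> m * \<theta>\<^sup>2" by (simp add: m_def sum_distrib_right)
        then show "(a i)\<^sup>2 \<le> m * \<theta>\<^sup>2 * a i"
          using a0 by (simp add: power2_eq_square mult_right_mono)
      qed
      also have "\<dots> = m * \<theta>\<^sup>2 * (\<Sum>f\<in>F. ev f * (\<Sum>i\<in>I. (inner (e i) f)\<^sup>2))"
        unfolding a_def sum_distrib_left[symmetric]
        by (subst sum.swap) (simp add: sum_distrib_left)
      also have "\<dots> \<le> m * \<theta>\<^sup>2 * (\<Sum>f\<in>F. ev f * 1)"
        using m0 F(2) evpos by (intro mult_left_mono sum_mono bessel) (auto intro: less_imp_le)
      also have "\<dots> = m\<^sup>2 * \<theta>\<^sup>2" by (simp add: m_def power2_eq_square)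
      finally show "(\<Sum>i\<in>I. (a i)\<^sup>2) \<le> m\<^sup>2 * \<theta>\<^sup>2" .
      have "(\<Sum>i\<in>I. (b i)\<^sup>2) \<le> (\<Sum>i\<in>I. \<Sum>f\<in>G. (ev f)\<^sup>2 * (inner (e i) f)\<^sup>2)"
      proof (rule sum_mono)
        fix i assume i: "i \<in> I"
        \<comment> \<open>This grouping puts the whole eigenvalue into one factor for
          Cauchy-Schwarz. Bessel over \<open>G\<close> then removes the other factor, and Bessel
          over the family leaves the square sum of the tail.\<close>
        have "(b i)\<^sup>2 = (\<Sum>f\<in>G. (ev f * inner (e i) f) * inner (e i) f)\<^sup>2"
          by (simp add: b_def power2_eq_square mult.assoc)
        also have "\<dots> \<le> (\<Sum>f\<in>G. (ev f * inner (e i) f)\<^sup>2) * (\<Sum>f\<in>G. (inner (e i) f)\<^sup>2)"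
          by (rule Cauchy_Schwarz_ineq_sum)
        also have "\<dots> \<le> (\<Sum>f\<in>G. (ev f * inner (e i) f)\<^sup>2) * 1"
          using Bessel_inequality[OF onG G(1), of "e i"] I(2) i
          by (intro mult_left_mono sum_nonneg) (auto simp: orthonormal_family_def)
        finally show "(b i)\<^sup>2 \<le> (\<Sum>f\<in>G. (ev f)\<^sup>2 * (inner (e i) f)\<^sup>2)"
          by (simp add: power_mult_distrib)
      qed
      also have "\<dots> = (\<Sum>f\<in>G. (ev f)\<^sup>2 * (\<Sum>i\<in>I. (inner (e i) f)\<^sup>2))"
        by (subst sum.swap) (simp add: sum_distrib_left)
      also have "\<dots> \<le> (\<Sum>f\<in>G. (ev f)\<^sup>2 * 1)"
        using G(2) by (intro mult_left_mono sum_mono bessel) auto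
      also have "\<dots> \<le> \<eta> / 6" using tail[OF G] by simp
      finally show "(\<Sum>i\<in>I. (b i)\<^sup>2) \<le> \<eta> / 6" .
    qed auto
    finally show ?thesis by simp
  qed
  have FH: "F \<subseteq> H" using F(2) C(1) eigenvectorsD(1) by blast
  show ?thesis
    by (rule exI[of _ F], rule exI[of _ "3 * m\<^sup>2"], intro conjI allI impI F(1) FH bound)
qed

end

section \<open>Trace-class operators and functional calculus\<close>

lemma scaleC_complex: "c *\<^sub>C f = Re c *\<^sub>R f + Im c *\<^sub>R (\<i> *\<^sub>C f)"
proof -
  have "c *\<^sub>C f = (complex_of_real (Re c) + complex_of_real (Im c) * \<i>) *\<^sub>C f"
    by (simp add: complex_eq_iff)
  also have "\<dots> = Re c *\<^sub>R f + Im c *\<^sub>R (\<i> *\<^sub>C f)"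
    by (simp only: l2_complex.scale_left_distrib l2_complex.scale_scale[symmetric] scaleC_of_real)
  finally show ?thesis .
qed

lemma complex_subspace_imp_subspace: "l2_complex.subspace V \<Longrightarrow> subspace V"
  unfolding l2_complex.subspace_def subspace_def by (metis scaleC_of_real)

lemma span_subset_complex_span: "span S \<subseteq> l2_complex.span S"
  by (intro span_minimal l2_complex.span_superset complex_subspace_imp_subspace l2_complex.subspace_span)

lemma complex_span_subset_real_span:
  "l2_complex.span S \<subseteq> span (S \<union> (\<lambda>f. \<i> *\<^sub>C f) ` S)"
proof (rule l2_complex.span_minimal)
  let ?W = "S \<union> (\<lambda>f. \<i> *\<^sub>C f) ` S"
  show "S \<subseteq> span ?W" using span_superset[of ?W] by blast
  have J: "\<i> *\<^sub>C f \<in> span ?W" if "f \<in> span ?W" for f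
    using that
  proof (induction rule: span_induct_alt)
    case base
    then show ?case by (simp add: span_zero)
  next
    case (step c g h)
    have "\<i> *\<^sub>C g \<in> span ?W"
    proof (cases "g \<in> S")
      case True
      then show ?thesis by (auto intro: span_base)
    next
      case False
      then obtain k where k: "k \<in> S" "g = \<i> *\<^sub>C k" using step by auto
      have "\<i> *\<^sub>C g = - k"
        unfolding k l2_complex.scale_scale using scaleC_of_real[of "-1" k] by simp
      then show ?thesis using k by (auto intro: span_base span_neg)
    qed
    moreover have "\<i> *\<^sub>C (c *\<^sub>R g + h) = c *\<^sub>R (\<i> *\<^sub>C g) + \<i> *\<^sub>C h"
      by (simp only: scaleC_of_real[symmetric] l2_complex.scale_right_distrib l2_complex.scale_scale mult.commute)
    ultimately show ?case using step by (simp add: span_add span_scale)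
  qed
  show "l2_complex.subspace (span ?W)"
    unfolding l2_complex.subspace_def
  proof (intro conjI allI ballI)
    fix c f assume "f \<in> span ?W"
    then show "c *\<^sub>C f \<in> span ?W"
      by (subst scaleC_complex) (intro span_add span_scale J)
  qed (auto simp: span_zero span_add)
qed

text \<open>Orthonormality refers to the real inner product, for which f and its multiple by the
  imaginary unit are orthogonal; this is the origin of the factor 2. The finite set S makes a
  complex basis of V finite, so that its cardinality is a genuine dimension.\<close>

lemma card_orthonormal_le_complex_dim:
  assumes "finite S" "V \<subseteq> span S"
    and F: "finite F" "F \<subseteq> V" "orthonormal_family F id"
  shows "card F \<le> 2 * l2_complex.dim V"
proof -
  obtain Bs where Bs: "Bs \<subseteq> V" "l2_complex.independent Bs" "V \<subseteq> l2_complex.span Bs"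
    "card Bs = l2_complex.dim V"
    using l2_complex.basis_exists by blast
  have finBs: "finite Bs"
    using l2_complex.independent_span_bound[OF assms(1) Bs(2)] Bs(1) assms(2)
      span_subset_complex_span[of S] by blast
  let ?W = "Bs \<union> (\<lambda>f. \<i> *\<^sub>C f) ` Bs"
  have "independent F"
    using F(3) by (intro pairwise_orthogonal_independent)
      (auto simp: orthonormal_family_def pairwise_def orthogonal_def)
  moreover have "F \<subseteq> span ?W" using F(2) Bs(3) complex_span_subset_real_span[of Bs] by blast
  ultimately have "card F \<le> card ?W"
    using independent_span_bound[of ?W F] finBs by blast
  also have "\<dots> \<le> card Bs + card ((\<lambda>f. \<i> *\<^sub>C f) ` Bs)" by (rule card_Un_le)
  also have "\<dots> \<le> 2 * card Bs" using card_image_le[OF finBs] by (simp add: mult_2)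
  finally show ?thesis using Bs(4) by simp
qed

lemma (in compact_square) eigenvalue_iff:
  assumes "f \<in> H" "\<alpha> > 0"
  shows "A (A f) = \<alpha>\<^sup>2 *\<^sub>R f \<longleftrightarrow> A f = \<alpha> *\<^sub>R f"
  using AA_eigen_imp_A_eigen[of f \<alpha>] assms A_scale[of f \<alpha>] by (auto simp: power2_eq_square)

text \<open>The vectors are grouped by their eigenvalue \<alpha>. The \<alpha>-eigenspace of A is
  the eigenspace of B for \<alpha>^2, so each group contributes at most twice a term of the summable
  family in \<open>trace_class\<close>; distinct positive \<alpha> have distinct squares, so no term
  is used twice.\<close>

lemma trace_class_eigenvalue_sum_bounded:
  fixes H :: "('a::euclidean_space, 'm::finite) l2 set"
  assumes cs: "compact_square H A"
    and B: "trace_class H B" "\<And>f. f \<in> H \<Longrightarrow> B f = A (A f)"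
  shows "\<exists>S. \<forall>F. finite F \<longrightarrow> F \<subseteq> compact_square.eigenvectors H A \<longrightarrow> orthonormal_family F id \<longrightarrow>
      (\<Sum>f\<in>F. (compact_square.ev A f)\<^sup>2) \<le> S"
proof -
  interpret compact_square H A by (rule cs)
  define d where "d \<mu> = real (l2_complex.dim (eigenspace H B \<mu>)) * norm \<mu>" for \<mu>
  define Z where "Z = {\<mu>. \<mu> \<noteq> 0 \<and> (\<exists>f\<in>eigenspace H B \<mu>. f \<noteq> 0)}"
  have sumd: "d summable_on Z"
    using B(1) unfolding trace_class_def d_def Z_def by blast
  have "(\<Sum>f\<in>F. (ev f)\<^sup>2) \<le> 2 * infsum d Z"
    if F: "finite F" "F \<subseteq> eigenvectors" "orthonormal_family F id" for F
  proof -
    have evF: "f \<in> H" "norm f = 1" "A f = ev f *\<^sub>R f" "ev f > 0" if "f \<in> F" for f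
      using eigenvectorsD[of f] F(2) that by auto
    have eig: "eigenspace H B (complex_of_real (\<alpha>\<^sup>2)) = {f \<in> H. A f = \<alpha> *\<^sub>R f}" if "\<alpha> > 0" for \<alpha>
      unfolding eigenspace_def scaleC_of_real using eigenvalue_iff[OF _ that] B(2)
      by (intro Collect_cong conj_cong refl) simp
    have "(\<Sum>f\<in>F. (ev f)\<^sup>2) = (\<Sum>\<alpha>\<in>ev ` F. \<Sum>f\<in>{f\<in>F. ev f = \<alpha>}. (ev f)\<^sup>2)"
      by (rule sum.image_gen[OF F(1)])
    also have "\<dots> = (\<Sum>\<alpha>\<in>ev ` F. card {f\<in>F. ev f = \<alpha>} * \<alpha>\<^sup>2)"
      by (rule sum.cong) auto
    also have "\<dots> \<le> (\<Sum>\<alpha>\<in>ev ` F. 2 * d (complex_of_real (\<alpha>\<^sup>2)))"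
    proof (rule sum_mono)
      fix \<alpha> assume "\<alpha> \<in> ev ` F"
      then have "\<alpha> > 0" using evF by auto
      then obtain S where S: "finite S" "{f \<in> H. A f = \<alpha> *\<^sub>R f} \<subseteq> span S"
        using eigenspace_finite_span by blast
      have "card {f\<in>F. ev f = \<alpha>} \<le> 2 * l2_complex.dim {f \<in> H. A f = \<alpha> *\<^sub>R f}"
        by (rule card_orthonormal_le_complex_dim[OF S])
          (use F(1) evF orthonormal_family_subset[OF F(3)] in auto)
      then have "card {f\<in>F. ev f = \<alpha>} \<le> 2 * real (l2_complex.dim {f \<in> H. A f = \<alpha> *\<^sub>R f})"
        using of_nat_mono[where 'a = real] by (fastforce simp only: of_nat_mult of_nat_numeral)
      from mult_right_mono[OF this zero_le_power2[of \<alpha>]]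
      show "card {f\<in>F. ev f = \<alpha>} * \<alpha>\<^sup>2 \<le> 2 * d (complex_of_real (\<alpha>\<^sup>2))"
        unfolding d_def eig[OF \<open>\<alpha> > 0\<close>] norm_of_real by simp
    qed
    also have "\<dots> = 2 * (\<Sum>\<alpha>\<in>ev ` F. d (complex_of_real (\<alpha>\<^sup>2)))"
      by (simp only: sum_distrib_left)
    also have "(\<Sum>\<alpha>\<in>ev ` F. d (complex_of_real (\<alpha>\<^sup>2))) = sum d ((\<lambda>\<alpha>. complex_of_real (\<alpha>\<^sup>2)) ` ev ` F)"
    proof -
      have "inj_on (\<lambda>\<alpha>. complex_of_real (\<alpha>\<^sup>2)) (ev ` F)"
      proof (rule inj_onI)
        fix x y assume xy: "x \<in> ev ` F" "y \<in> ev ` F" "complex_of_real (x\<^sup>2) = complex_of_real (y\<^sup>2)"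
        have "x\<^sup>2 = y\<^sup>2" using xy(3) unfolding of_real_eq_iff .
        moreover have "x > 0" "y > 0" using xy(1,2) evF(4) by blast+
        ultimately show "x = y" by (simp add: power2_eq_imp_eq)
      qed
      then show ?thesis by (simp only: sum.reindex o_def)
    qed
    also have "\<dots> \<le> infsum d Z"
    proof (rule finite_sum_le_infsum[OF sumd])
      show "(\<lambda>\<alpha>. complex_of_real (\<alpha>\<^sup>2)) ` ev ` F \<subseteq> Z"
      proof clarify
        fix f assume f: "f \<in> F"
        have "f \<in> eigenspace H B (complex_of_real ((ev f)\<^sup>2))" using f evF by (simp only: eig) simp
        moreover have "f \<noteq> 0" using evF(2)[OF f] by auto
        ultimately show "complex_of_real ((ev f)\<^sup>2) \<in> Z" using evF(4)[OF f] by (auto simp: Z_def)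
      qed
    qed (use F in \<open>auto simp: d_def\<close>)
    finally show ?thesis by simp
  qed
  then show ?thesis by blast
qed

section \<open>Bounded operators, adjoints and polynomial powers\<close>

lemma bounded_operatorD:
  assumes "bounded_operator H1 H2 T"
  shows "f \<in> H1 \<Longrightarrow> T f \<in> H2"
    and "f \<in> H1 \<Longrightarrow> g \<in> H1 \<Longrightarrow> T (f + g) = T f + T g"
    and "f \<in> H1 \<Longrightarrow> T (r *\<^sub>R f) = r *\<^sub>R T f"
  using assms unfolding bounded_operator_def by (auto simp: scaleC_of_real[symmetric])

lemma is_adjoint_inner:
  "is_adjoint H1 H2 T S \<Longrightarrow> f \<in> H1 \<Longrightarrow> g \<in> H2 \<Longrightarrow> inner (T f) g = inner f (S g)"
  unfolding is_adjoint_def Re_cinner_l2[symmetric] by simp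

text \<open>The definition quantifies over all polynomial approximations of \<open>x powr s\<close>.
  If one polynomial agrees with this function on the half-line, the constant sequence is admissible
  and forces B to be P(A). The exponents 1 and 2 are of this kind.\<close>

lemma is_operator_powr_limit:
  assumes "is_operator_powr H A s B" "\<And>f. f \<in> H \<Longrightarrow> norm (A f) \<le> M * norm f"
    and "\<And>x. x \<ge> 0 \<Longrightarrow> poly P x = x powr s" "f \<in> H"
  shows "B f = poly_operator P A f"
proof -
  have "uniform_limit {0..M} (\<lambda>k. poly P) (\<lambda>x. x powr s) sequentially"
    using assms(3) by (auto simp: uniform_limit_iff)
  then have *: "\<forall>\<epsilon>>0. \<forall>\<^sub>F k in sequentially. \<forall>f\<in>H. norm (poly_operator P A f - B f) \<le> \<epsilon> * norm f"
    using assms(1)[unfolded is_operator_powr_def, THEN conjunct2, rule_format, of M "\<lambda>k. P"] assms(2)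
    by blast
  have "norm (poly_operator P A f - B f) \<le> 0"
  proof (rule field_le_epsilon)
    fix e :: real assume "e > 0"
    define \<epsilon> where "\<epsilon> = e / (norm f + 1)"
    have "\<epsilon> > 0" using \<open>e > 0\<close> by (simp add: \<epsilon>_def add_nonneg_pos)
    then have "norm (poly_operator P A f - B f) \<le> \<epsilon> * norm f" using * assms(4) by auto
    also have "\<dots> \<le> \<epsilon> * (norm f + 1)" using \<open>\<epsilon> > 0\<close> by simp
    also have "\<dots> = e" using norm_ge_zero[of f] unfolding \<epsilon>_def by (metis add_nonneg_pos
      less_numeral_extra(3) nonzero_eq_divide_eq zero_less_one)
    finally show "norm (poly_operator P A f - B f) \<le> 0 + e" by simp
  qed
  then show ?thesis by simp
qed

lemma is_operator_powr_2:
  assumes "is_operator_powr H A 2 B" "\<And>f. f \<in> H \<Longrightarrow> norm (A f) \<le> M * norm f" "f \<in> H"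
  shows "B f = A (A f)"
proof -
  have "B f = poly_operator [:0, 0, 1:] A f"
    by (rule is_operator_powr_limit[OF assms(1,2) _ assms(3)])
      (auto simp: powr_numeral power2_eq_square)
  then show ?thesis by (simp add: poly_operator_def numeral_2_eq_2)
qed

lemma is_operator_powr_1:
  assumes "is_operator_powr H A 1 B" "\<And>f. f \<in> H \<Longrightarrow> norm (A f) \<le> M * norm f" "f \<in> H"
  shows "B f = A f"
proof -
  have "B f = poly_operator [:0, 1:] A f"
    by (rule is_operator_powr_limit[OF assms(1,2) _ assms(3)]) auto
  then show ?thesis by (simp add: poly_operator_def)
qed

text \<open>The adjoint is given only by its pairing identity, and its bound comes from |Sg|^2 =
  <TSg, g>. With a common constant, \<open>M * M\<close> bounds the composition of S and T, and this
  bound names the interval in \<open>is_operator_powr\<close>.\<close>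

lemma bounded_operator_adjoint:
  assumes T: "bounded_operator H1 H2 T" and S: "is_adjoint H1 H2 T S"
  obtains M where "M \<ge> 0" "\<And>f. f \<in> H1 \<Longrightarrow> norm (T f) \<le> M * norm f" "\<And>g. g \<in> H2 \<Longrightarrow> norm (S g) \<le> M * norm g"
proof -
  obtain M where M: "\<And>f. f \<in> H1 \<Longrightarrow> norm (T f) \<le> M * norm f"
    using T unfolding bounded_operator_def by blast
  define M' where "M' = max M 0"
  have M': "norm (T f) \<le> M' * norm f" if "f \<in> H1" for f
    using M[OF that] mult_right_mono[of M M' "norm f"] by (simp add: M'_def)
  have "norm (S g) \<le> M' * norm g" if g: "g \<in> H2" for g
  proof (cases "S g = 0")
    case False
    have Sg: "S g \<in> H1" using S g by (simp add: is_adjoint_def)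
    have "norm (S g) * norm (S g) = inner (T (S g)) g"
      using is_adjoint_inner[OF S Sg g] by (simp add: norm_eq_sqrt_inner)
    also have "\<dots> \<le> norm (T (S g)) * norm g" by (rule norm_cauchy_schwarz)
    also have "\<dots> \<le> (M' * norm (S g)) * norm g" by (intro mult_right_mono M' Sg) auto
    finally have "norm (S g) * norm (S g) \<le> norm (S g) * (M' * norm g)" by (simp add: mult_ac)
    then show ?thesis using False by (simp add: mult_le_cancel_left)
  qed (simp add: M'_def)
  then show ?thesis using that[of M'] M' by (simp add: M'_def)
qed

lemma compact_square_trace_class:
  fixes H :: "('a::euclidean_space, 'm::finite) l2 set"
  assumes H: "subspace H" "closed H"
    and A: "\<And>f. f \<in> H \<Longrightarrow> A f \<in> H" "\<And>f g. f \<in> H \<Longrightarrow> g \<in> H \<Longrightarrow> A (f + g) = A f + A g"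
      "\<And>c f. f \<in> H \<Longrightarrow> A (c *\<^sub>R f) = c *\<^sub>R A f"
      "\<And>f g. f \<in> H \<Longrightarrow> g \<in> H \<Longrightarrow> inner (A f) g = inner f (A g)"
      "\<And>f. f \<in> H \<Longrightarrow> 0 \<le> inner (A f) f"
    and B: "trace_class H B" "\<And>f. f \<in> H \<Longrightarrow> B f = A (A f)"
  shows "compact_square H A"
proof
  have "compact (closure (B ` (H \<inter> cball 0 1)))"
    using B(1) by (simp add: trace_class_def compact_operator_def)
  also have "B ` (H \<inter> cball 0 1) = (\<lambda>x. A (A x)) ` (H \<inter> cball 0 1)"
    using B(2) by (intro image_cong) auto
  finally show "compact (closure ((\<lambda>x. A (A x)) ` (H \<inter> cball 0 1)))" .
qed (use H A in auto)

section \<open>Smooth functions\<close>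

abbreviation dirderiv :: "'a::euclidean_space \<Rightarrow> ('a \<Rightarrow> 'b::real_normed_vector) \<Rightarrow> 'a \<Rightarrow> 'b" where
  "dirderiv v f \<equiv> (\<lambda>x. frechet_derivative f (at x) v)"

lemma dirderiv_eq: "(f has_derivative f') (at x) \<Longrightarrow> dirderiv v f x = f' v"
  by (simp add: frechet_derivative_at[symmetric])

lemma frechet_derivative_worksI:
  "f differentiable (at x) \<Longrightarrow> (f has_derivative frechet_derivative f (at x)) (at x)"
  by (simp add: frechet_derivative_works)

lemma Ck_on_continuous: "Ck_on k f S \<Longrightarrow> continuous_on S f"
  by (cases k) (auto intro!: differentiable_imp_continuous_on simp: differentiable_on_def differentiable_at_withinI)

lemma Ck_on_SucD: "Ck_on (Suc k) f S \<Longrightarrow> Ck_on k f S"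
proof (induction k arbitrary: f)
  case 0
  then show ?case using Ck_on_continuous by fastforce
next
  case (Suc k)
  show ?case unfolding Ck_on.simps(2)[of k f]
  proof (intro conjI allI)
    fix v
    have "Ck_on (Suc k) (dirderiv v f) S" using Suc.prems unfolding Ck_on.simps(2)[of "Suc k" f] by blast
    then show "Ck_on k (dirderiv v f) S" by (rule Suc.IH)
  qed (use Suc.prems in auto)
qed

lemma Ck_on_const: "Ck_on k (\<lambda>x. c) S"
  by (induction k arbitrary: c) (auto simp: frechet_derivative_const)

lemma Ck_on_bounded_linear:
  assumes "bounded_linear L"
  shows "Ck_on k L S"
proof (cases k)
  case 0
  then show ?thesis using assms by (simp add: linear_continuous_on)
next
  case (Suc l)
  have "(L has_derivative L) (at x)" for x using assms by (rule bounded_linear_imp_has_derivative)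
  then have "dirderiv v L = (\<lambda>x. L v)" "L differentiable (at x)" for v x
    using dirderiv_eq by (blast, auto simp: differentiable_def)
  then show ?thesis using Suc by (simp add: Ck_on_const)
qed

lemma dirderiv_bounded_linear:
  assumes "bounded_linear L" "f differentiable (at x)"
  shows "dirderiv v (\<lambda>x. L (f x)) x = L (dirderiv v f x)"
  using bounded_linear.has_derivative[OF assms(1) frechet_derivative_worksI[OF assms(2)]]
  by (rule dirderiv_eq)

lemma Ck_on_compose_bounded_linear:
  assumes "bounded_linear L" "Ck_on k f UNIV"
  shows "Ck_on k (\<lambda>x. L (f x)) UNIV"
  using assms(2)
proof (induction k arbitrary: f)
  case 0
  then show ?case using assms(1) by (simp add: bounded_linear.continuous_on)
next
  case (Suc k)
  then have "f differentiable (at x)" for x by simp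
  then have "(\<lambda>x. L (f x)) differentiable (at x)" "dirderiv v (\<lambda>x. L (f x)) = (\<lambda>x. L (dirderiv v f x))" for x v
    using dirderiv_bounded_linear[OF assms(1)]
      bounded_linear.has_derivative[OF assms(1) frechet_derivative_worksI]
    unfolding differentiable_def[of "\<lambda>x. L (f x)"] by blast+
  then show ?case using Suc by simp
qed

lemma Ck_on_add:
  assumes "Ck_on k f UNIV" "Ck_on k g UNIV"
  shows "Ck_on k (\<lambda>x. f x + g x) UNIV"
  using assms
proof (induction k arbitrary: f g)
  case 0
  then show ?case by (auto intro: continuous_on_add)
next
  case (Suc k)
  then have d: "f differentiable (at x)" "g differentiable (at x)" for x by simp_all
  have "dirderiv v (\<lambda>x. f x + g x) = (\<lambda>x. dirderiv v f x + dirderiv v g x)" for v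
    by (intro ext dirderiv_eq has_derivative_add frechet_derivative_worksI d)
  then show ?case using Suc d by simp
qed

lemma Ck_on_mult:
  fixes f g :: "'a::euclidean_space \<Rightarrow> 'b::real_normed_algebra"
  assumes "Ck_on k f UNIV" "Ck_on k g UNIV"
  shows "Ck_on k (\<lambda>x. f x * g x) UNIV"
  using assms
proof (induction k arbitrary: f g)
  case 0
  then show ?case by (auto intro: continuous_on_mult)
next
  case (Suc k)
  then have d: "f differentiable (at x)" "g differentiable (at x)" for x by simp_all
  have "dirderiv v (\<lambda>x. f x * g x) = (\<lambda>x. f x * dirderiv v g x + dirderiv v f x * g x)" for v
    by (intro ext dirderiv_eq has_derivative_mult frechet_derivative_worksI d)
  moreover have "Ck_on k (\<lambda>x. f x * dirderiv v g x + dirderiv v f x * g x) UNIV" for v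
    using Suc.prems Ck_on_SucD[OF Suc.prems(1)] Ck_on_SucD[OF Suc.prems(2)]
    by (intro Ck_on_add Suc.IH) auto
  ultimately show ?case using d by simp
qed

lemma has_derivative_rescale:
  assumes "f differentiable (at ((x - c) /\<^sub>R \<epsilon>))"
  shows "((\<lambda>x. f ((x - c) /\<^sub>R \<epsilon>)) has_derivative (\<lambda>v. frechet_derivative f (at ((x - c) /\<^sub>R \<epsilon>)) v /\<^sub>R \<epsilon>)) (at x)"
proof -
  let ?D = "frechet_derivative f (at ((x - c) /\<^sub>R \<epsilon>))"
  have "((\<lambda>x. f ((x - c) /\<^sub>R \<epsilon>)) has_derivative (\<lambda>v. ?D (v /\<^sub>R \<epsilon>))) (at x)"
    by (rule has_derivative_compose[where g = f and f = "\<lambda>x. (x - c) /\<^sub>R \<epsilon>", OF _ frechet_derivative_worksI[OF assms]])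
      (auto intro!: derivative_eq_intros)
  moreover have "?D (v /\<^sub>R \<epsilon>) = ?D v /\<^sub>R \<epsilon>" for v
    using linear_frechet_derivative[OF assms] by (rule linear_scale)
  ultimately show ?thesis by simp
qed

lemma dirderiv_rescale:
  assumes "\<And>x. f differentiable (at x)"
  shows "dirderiv v (\<lambda>x. f ((x - c) /\<^sub>R \<epsilon>)) = (\<lambda>x. dirderiv v f ((x - c) /\<^sub>R \<epsilon>) /\<^sub>R \<epsilon>)"
  by (intro ext dirderiv_eq[OF has_derivative_rescale[OF assms]])

lemma Ck_on_rescale:
  assumes "Ck_on k f UNIV"
  shows "Ck_on k (\<lambda>x. f ((x - c) /\<^sub>R \<epsilon>)) UNIV"
  using assms
proof (induction k arbitrary: f)
  case 0
  then show ?case by (auto intro!: continuous_on_compose2[of UNIV f] continuous_intros)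
next
  case (Suc k)
  then have d: "f differentiable (at x)" for x by simp
  have "(\<lambda>x. f ((x - c) /\<^sub>R \<epsilon>)) differentiable (at x)" for x
    using has_derivative_rescale[OF d] unfolding differentiable_def by blast
  moreover have "Ck_on k (\<lambda>x. dirderiv v f ((x - c) /\<^sub>R \<epsilon>) /\<^sub>R \<epsilon>) UNIV" for v
    using Suc by (intro Ck_on_compose_bounded_linear[OF bounded_linear_scaleR_right]) auto
  ultimately show ?case by (simp add: dirderiv_rescale[OF d])
qed

section \<open>Flat functions and a smooth bump\<close>

definition flat_exp :: "nat \<Rightarrow> real \<Rightarrow> real" where
  "flat_exp m t = (if t > 0 then exp (- (1 / t)) / t ^ m else 0)"

text \<open>The inequality exp y \<ge> y at y = 1/(tn) is raised to the power n = m + 2: m factors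
  absorb the denominator \<open>t ^ m\<close> and two remain as \<open>t\<^sup>2\<close>, which is
  what makes the derivative at 0 vanish.\<close>

lemma flat_exp_le_square: "\<bar>flat_exp m t\<bar> \<le> (m + 2) ^ (m + 2) * t\<^sup>2"
proof (cases "t > 0")
  case True
  define n where "n = real (m + 2)"
  have n: "n > 0" by (simp add: n_def)
  have "(1 / (t * n)) ^ (m + 2) \<le> exp (1 / (t * n)) ^ (m + 2)"
    using True n exp_ge_add_one_self[of "1 / (t * n)"] by (intro power_mono) (auto simp del: exp_ge_add_one_self)
  also have "\<dots> = exp (1 / t)"
    unfolding exp_of_nat_mult[symmetric] n_def[symmetric] using n by simp
  finally have "1 / exp (1 / t) \<le> (t * n) ^ (m + 2)"
    using True n by (simp add: power_divide divide_simps mult.commute)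
  then have "exp (- (1 / t)) / t ^ m \<le> (t * n) ^ (m + 2) / t ^ m"
    using True by (intro divide_right_mono) (auto simp: exp_minus inverse_eq_divide)
  also have "\<dots> = n ^ (m + 2) * t\<^sup>2"
    using True by (simp add: power_mult_distrib power_add field_simps power2_eq_square)
  finally show ?thesis using True by (simp add: flat_exp_def n_def add.commute)
qed (simp add: flat_exp_def)

text \<open>The exponent m is carried along to make the family closed under differentiation;
  smoothness of every order then follows by an induction in which m is arbitrary.\<close>

lemma flat_exp_deriv:
  "(flat_exp m has_real_derivative (flat_exp (m + 2) t - m * flat_exp (m + 1) t)) (at t)"
proof -
  consider "t > 0" | "t < 0" | "t = 0" by linarith
  then show ?thesis
  proof cases
    case 1
    define E where "E = exp (- (1 / t))"
    have "((\<lambda>t. exp (- (1 / t)) / t ^ m) has_real_derivative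
        (E * (1 / t\<^sup>2) * t ^ m - E * (m * t ^ (m - 1))) / (t ^ m * t ^ m)) (at t)"
      using 1 by (auto intro!: derivative_eq_intros simp: E_def power2_eq_square)
    also have "(E * (1 / t\<^sup>2) * t ^ m - E * (m * t ^ (m - 1))) / (t ^ m * t ^ m)
        = flat_exp (m + 2) t - m * flat_exp (m + 1) t"
      using 1 by (cases m) (simp_all add: flat_exp_def E_def power2_eq_square field_simps)
    finally have "((\<lambda>t. exp (- (1 / t)) / t ^ m) has_real_derivative
        flat_exp (m + 2) t - m * flat_exp (m + 1) t) (at t)" .
    moreover have "\<forall>\<^sub>F s in nhds t. exp (- (1 / s)) / s ^ m = flat_exp m s"
      using eventually_nhds_in_open[of "{0<..}" t] 1 by (auto simp: flat_exp_def elim!: eventually_mono)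
    ultimately show ?thesis by (rule DERIV_cong_ev[OF refl _ refl, THEN iffD1, rotated])
  next
    case 2
    have "((\<lambda>t. 0) has_real_derivative (flat_exp (m + 2) t - m * flat_exp (m + 1) t)) (at t)"
      using 2 by (simp add: flat_exp_def)
    moreover have "\<forall>\<^sub>F s in nhds t. 0 = flat_exp m s"
      using eventually_nhds_in_open[of "{..<0}" t] 2 by (auto simp: flat_exp_def elim!: eventually_mono)
    ultimately show ?thesis by (rule DERIV_cong_ev[OF refl _ refl, THEN iffD1, rotated])
  next
    case 3
    define K where "K = real ((m + 2) ^ (m + 2))"
    have "(\<lambda>h. flat_exp m h / h) \<midarrow>0\<rightarrow> 0"
    proof (rule Lim_null_comparison)
      show "\<forall>\<^sub>F h in at 0. norm (flat_exp m h / h) \<le> K * \<bar>h\<bar>"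
      proof (rule eventually_at_filter[THEN iffD2], intro always_eventually allI impI)
        fix h :: real assume "h \<noteq> 0"
        then show "norm (flat_exp m h / h) \<le> K * \<bar>h\<bar>"
          using flat_exp_le_square[of m h] by (simp add: K_def field_simps power2_eq_square abs_mult)
      qed
      show "((\<lambda>h. K * \<bar>h\<bar>) \<longlongrightarrow> 0) (at 0)" by (auto intro!: tendsto_eq_intros)
    qed
    then show ?thesis using 3 by (simp add: DERIV_def flat_exp_def)
  qed
qed

lemma Ck_on_flat_exp:
  assumes "\<And>k. Ck_on k r UNIV"
  shows "Ck_on k (\<lambda>x. flat_exp m (r x)) UNIV"
proof (induction k arbitrary: m)
  case 0
  have "continuous_on UNIV (flat_exp m)"
    by (intro continuous_at_imp_continuous_on ballI DERIV_isCont[OF flat_exp_deriv])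
  then show ?case using Ck_on_continuous[OF assms] by (auto intro: continuous_on_compose2)
next
  case (Suc k)
  have d: "r differentiable (at x)" for x using assms[of 1] by simp
  have *: "((\<lambda>x. flat_exp m (r x)) has_derivative
      (\<lambda>v. (flat_exp (m + 2) (r x) + (- real m) * flat_exp (m + 1) (r x)) * dirderiv v r x)) (at x)" for x
    using has_derivative_compose[OF frechet_derivative_worksI[OF d]
        flat_exp_deriv[of m "r x", unfolded has_field_derivative_def]] by simp
  have "Ck_on k (\<lambda>x. (flat_exp (m + 2) (r x) + (- real m) * flat_exp (m + 1) (r x)) * dirderiv v r x) UNIV" for v
    using assms[of "Suc k"] by (intro Ck_on_mult Ck_on_add Suc.IH Ck_on_const) auto
  moreover have "(\<lambda>x. flat_exp m (r x)) differentiable (at x)" for x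
    using * unfolding differentiable_def by blast
  ultimately show ?case by (simp add: dirderiv_eq[OF *])
qed

text \<open>The usual mollifier exp(-1/(1 - |x|^2)) on the open unit ball, extended by zero.\<close>

definition bump :: "'a::euclidean_space \<Rightarrow> real" where
  "bump x = flat_exp 0 (1 - inner x x)"

lemma has_derivative_one_minus_sq:
  "((\<lambda>x. 1 - inner x x) has_derivative (\<lambda>v. - 2 * inner x v)) (at (x :: 'a::euclidean_space))"
  by (auto intro!: derivative_eq_intros simp: inner_commute)

lemma Ck_on_bump: "Ck_on k (bump :: 'a::euclidean_space \<Rightarrow> real) UNIV"
proof -
  have "Ck_on k (\<lambda>x :: 'a. 1 - inner x x) UNIV" for k
  proof (cases k)
    case 0
    then show ?thesis by (simp add: continuous_intros)
  next
    case (Suc l)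
    have "bounded_linear (\<lambda>x :: 'a. - 2 * inner x v)" for v
      by (intro bounded_linear_const_mult bounded_linear_inner_left)
    then have "Ck_on l (\<lambda>x :: 'a. - 2 * inner x v) UNIV" for v
      by (rule Ck_on_bounded_linear)
    then show ?thesis
      unfolding Suc using has_derivative_one_minus_sq
      by (auto simp: dirderiv_eq[OF has_derivative_one_minus_sq] differentiable_def)
  qed
  then show ?thesis unfolding bump_def by (rule Ck_on_flat_exp)
qed

lemma bump_eq_0: "norm x \<ge> 1 \<Longrightarrow> bump x = 0"
  using power_mono[of 1 "norm x" 2] by (auto simp: bump_def flat_exp_def power2_norm_eq_inner)

lemma dirderiv_bump: "dirderiv v bump x = - 2 * inner x v * flat_exp 2 (1 - inner x x)"
proof -
  have "(bump has_derivative (\<lambda>v. - 2 * inner x v * flat_exp 2 (1 - inner x x))) (at x)"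
    using has_derivative_compose[OF has_derivative_one_minus_sq
        flat_exp_deriv[of 0 "1 - inner x x", unfolded has_field_derivative_def]]
    unfolding bump_def by (simp add: mult_ac numeral_2_eq_2)
  then show ?thesis by (rule dirderiv_eq)
qed

text \<open>The mixed second difference of f is symmetric in v and w. Two applications of the mean
  value theorem turn it into \<open>t\<^sup>2\<close> times a mixed derivative at a nearby point, in
  either order, and continuity of the second derivatives identifies the two limits.\<close>

lemma dirderiv_commute_real:
  fixes f :: "'a::euclidean_space \<Rightarrow> real"
  assumes f: "\<And>k. Ck_on k f UNIV"
  shows "dirderiv w (dirderiv v f) x = dirderiv v (dirderiv w f) x"
proof -
  have C: "Ck_on k (dirderiv v f) UNIV" for k v using f[of "Suc k"] by simp
  have df: "(f has_derivative frechet_derivative f (at x)) (at x)" for x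
    using f[of 1] by (intro frechet_derivative_worksI) simp
  have ddf: "(dirderiv v f has_derivative frechet_derivative (dirderiv v f) (at x)) (at x)" for x v
    using C[of 1 v] by (intro frechet_derivative_worksI) simp
  have cont: "continuous_on UNIV (dirderiv w (dirderiv v f))" for v w
    using C[of 1 v] by simp
  have line: "((\<lambda>s. g (y + s *\<^sub>R u)) has_real_derivative dirderiv u g (y + s *\<^sub>R u)) (at s)"
    if "\<And>x. (g has_derivative frechet_derivative g (at x)) (at x)" for g :: "'a \<Rightarrow> real" and u y s
  proof -
    have "((\<lambda>s. g (y + s *\<^sub>R u)) has_derivative (\<lambda>h. dirderiv (h *\<^sub>R u) g (y + s *\<^sub>R u))) (at s)"
      by (rule has_derivative_compose[where g = g, OF _ that]) (auto intro!: derivative_eq_intros)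
    moreover have "dirderiv (h *\<^sub>R u) g z = h * dirderiv u g z" for h z
      using linear_frechet_derivative[of g "at z"] that[of z] by (simp add: linear_scale differentiable_def) (metis linear_scale real_scaleR_def)
    ultimately show ?thesis by (simp add: has_field_derivative_def mult.commute[of _ "dirderiv u g _"])
  qed
  have mean: "\<exists>p q. 0 \<le> p \<and> p \<le> t \<and> 0 \<le> q \<and> q \<le> t \<and>
      f (x + t *\<^sub>R v + t *\<^sub>R w) - f (x + t *\<^sub>R v) - f (x + t *\<^sub>R w) + f x
        = t * (t * dirderiv w (dirderiv v f) (x + p *\<^sub>R v + q *\<^sub>R w))"
    if "t > 0" for t v w
  proof -
    define g where "g s = f (x + t *\<^sub>R w + s *\<^sub>R v) - f (x + s *\<^sub>R v)" for s
    have "(g has_real_derivative dirderiv v f (x + t *\<^sub>R w + s *\<^sub>R v) - dirderiv v f (x + s *\<^sub>R v)) (at s)" for s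
      unfolding g_def by (intro derivative_intros line df)
    from MVT2[OF \<open>t > 0\<close> this] obtain p where p: "0 < p" "p < t"
      "g t - g 0 = t * (dirderiv v f (x + t *\<^sub>R w + p *\<^sub>R v) - dirderiv v f (x + p *\<^sub>R v))"
      by auto
    have "((\<lambda>s. dirderiv v f (x + p *\<^sub>R v + s *\<^sub>R w)) has_real_derivative
        dirderiv w (dirderiv v f) (x + p *\<^sub>R v + s *\<^sub>R w)) (at s)" for s
      by (intro line ddf)
    from MVT2[OF \<open>t > 0\<close> this] obtain q where q: "0 < q" "q < t"
      "dirderiv v f (x + p *\<^sub>R v + t *\<^sub>R w) - dirderiv v f (x + p *\<^sub>R v + 0 *\<^sub>R w)
        = (t - 0) * dirderiv w (dirderiv v f) (x + p *\<^sub>R v + q *\<^sub>R w)"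
      by auto
    have "f (x + t *\<^sub>R v + t *\<^sub>R w) - f (x + t *\<^sub>R v) - f (x + t *\<^sub>R w) + f x = g t - g 0"
      by (simp add: g_def add_ac)
    also have "\<dots> = t * (t * dirderiv w (dirderiv v f) (x + p *\<^sub>R v + q *\<^sub>R w))"
      using p(3) q(3) by (simp add: add_ac)
    finally show ?thesis using p q by (intro exI[of _ p] exI[of _ q]) auto
  qed
  define t where "t n = 1 / real (Suc n)" for n
  have t: "t n > 0" for n by (simp add: t_def)
  have t0: "t \<longlonglongrightarrow> 0" unfolding t_def using LIMSEQ_Suc[OF lim_1_over_n] .
  define \<Delta> where "\<Delta> n v w = f (x + t n *\<^sub>R v + t n *\<^sub>R w) - f (x + t n *\<^sub>R v) - f (x + t n *\<^sub>R w) + f x" for n v w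
  have lim: "(\<lambda>n. \<Delta> n v w / (t n)\<^sup>2) \<longlonglongrightarrow> dirderiv w (dirderiv v f) x" for v w
  proof -
    define P where "P n p q \<longleftrightarrow> 0 \<le> p \<and> p \<le> t n \<and> 0 \<le> q \<and> q \<le> t n \<and>
      \<Delta> n v w = t n * (t n * dirderiv w (dirderiv v f) (x + p *\<^sub>R v + q *\<^sub>R w))" for n p q
    have "\<exists>p q. P n p q" for n using mean[OF t] unfolding P_def \<Delta>_def by blast
    then obtain p q where "\<And>n. P n (p n) (q n)" by metis
    then have pq: "\<And>n. 0 \<le> p n" "\<And>n. p n \<le> t n" "\<And>n. 0 \<le> q n" "\<And>n. q n \<le> t n"
      "\<And>n. \<Delta> n v w = t n * (t n * dirderiv w (dirderiv v f) (x + p n *\<^sub>R v + q n *\<^sub>R w))"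
      unfolding P_def by blast+
    have "p \<longlonglongrightarrow> 0" "q \<longlonglongrightarrow> 0"
      using pq by (auto intro: tendsto_sandwich[OF _ _ tendsto_const t0])
    then have "(\<lambda>n. x + p n *\<^sub>R v + q n *\<^sub>R w) \<longlonglongrightarrow> x + 0 *\<^sub>R v + 0 *\<^sub>R w"
      by (intro tendsto_intros)
    moreover have "isCont (dirderiv w (dirderiv v f)) x"
      using cont by (simp add: continuous_on_eq_continuous_at)
    ultimately have "(\<lambda>n. dirderiv w (dirderiv v f) (x + p n *\<^sub>R v + q n *\<^sub>R w)) \<longlonglongrightarrow> dirderiv w (dirderiv v f) x"
      using isCont_tendsto_compose by fastforce
    moreover have "\<Delta> n v w / (t n)\<^sup>2 = dirderiv w (dirderiv v f) (x + p n *\<^sub>R v + q n *\<^sub>R w)" for n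
      using pq(5)[of n] t[of n] by (simp add: power2_eq_square)
    ultimately show ?thesis by simp
  qed
  have "\<Delta> n v w = \<Delta> n w v" for n by (simp add: \<Delta>_def add_ac)
  then show ?thesis using LIMSEQ_unique[OF lim[of v w]] lim[of w v] by simp
qed

text \<open>The mean value theorem is about real values, so the vector-valued case is read off from
  the coordinates.\<close>

lemma dirderiv_commute:
  fixes f :: "'a::euclidean_space \<Rightarrow> 'b::euclidean_space"
  assumes f: "\<And>k. Ck_on k f UNIV"
  shows "dirderiv w (dirderiv v f) x = dirderiv v (dirderiv w f) x"
proof (rule euclidean_eqI)
  fix b :: 'b assume "b \<in> Basis"
  have L: "bounded_linear (\<lambda>y. inner y b)" by (rule bounded_linear_inner_left)
  have C: "Ck_on k (dirderiv v f) UNIV" for k v using f[of "Suc k"] by simp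
  have d: "f differentiable (at x)" "dirderiv v f differentiable (at x)" for x v
    using f[of 1] C[of 1 v] by simp_all
  have *: "inner (dirderiv w (dirderiv v f) x) b = dirderiv w (dirderiv v (\<lambda>y. inner (f y) b)) x" for v w
    by (simp only: dirderiv_bounded_linear[OF L d(1)] dirderiv_bounded_linear[OF L d(2)])
  show "inner (dirderiv w (dirderiv v f) x) b = inner (dirderiv v (dirderiv w f) x) b"
    unfolding * by (rule dirderiv_commute_real) (rule Ck_on_compose_bounded_linear[OF L f])
qed

section \<open>Integrals of derivatives of compactly supported functions\<close>

lemma integrable_lebesgue_compact_support:
  fixes f :: "'a::euclidean_space \<Rightarrow> 'b::euclidean_space"
  assumes "continuous_on UNIV f" "compact K" "\<And>x. x \<notin> K \<Longrightarrow> f x = 0"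
  shows "integrable lborel f" "integrable lebesgue f"
proof -
  have "integrable lborel (\<lambda>x. indicator K x *\<^sub>R f x)"
    by (rule borel_integrable_compact[OF assms(2) continuous_on_subset[OF assms(1)]]) simp
  also have "(\<lambda>x. indicator K x *\<^sub>R f x) = f"
    using assms(3) by (auto simp: indicator_def)
  finally show "integrable lborel f" .
  then show "integrable lebesgue f"
    using integrable_completion[of f lborel] borel_measurable_continuous_onI[OF assms(1)] by simp
qed

text \<open>By translation invariance every difference quotient in the direction v has integral 0,
  and dominated convergence passes this on to the derivative.\<close>

lemma integral_dirderiv_eq_0:
  fixes f :: "'a::euclidean_space \<Rightarrow> 'b::euclidean_space"
  assumes d: "\<And>x. f differentiable (at x)" and cont: "continuous_on UNIV (dirderiv v f)"
    and K: "compact K" "\<And>x. x \<notin> K \<Longrightarrow> f x = 0"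
  shows "(LINT x|lebesgue. dirderiv v f x) = 0"
proof -
  have contf: "continuous_on UNIV f"
    using d by (intro differentiable_imp_continuous_on) (simp add: differentiable_on_def differentiable_at_withinI)
  obtain R where R: "R > 0" "K \<subseteq> ball 0 R"
    using bounded_subset_ballD[OF compact_imp_bounded[OF K(1)], of 0] by blast
  have f0: "f x = 0" if "norm x \<ge> R" for x using that R K(2)[of x] by (auto simp: subset_iff not_less[symmetric])
  have D0: "dirderiv v f x = 0" if "x \<notin> cball 0 R" for x
  proof -
    have "frechet_derivative f (at x) = frechet_derivative (\<lambda>x. 0) (at x)"
      by (rule frechet_derivative_transform_within_open[OF d, of "- cball 0 R"])
        (use that in \<open>auto intro!: f0\<close>)
    then show ?thesis by simp
  qed
  have "bounded ((dirderiv v f) ` cball 0 R)"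
    by (intro compact_imp_bounded compact_continuous_image continuous_on_subset[OF cont]) auto
  then obtain M0 where M0: "\<And>x. x \<in> cball 0 R \<Longrightarrow> norm (dirderiv v f x) \<le> M0"
    unfolding bounded_iff by blast
  define M where "M = max M0 0"
  have M: "norm (dirderiv v f x) \<le> M" for x
    using M0[of x] D0[of x] by (cases "x \<in> cball 0 R") (auto simp: M_def)
  define t where "t n = 1 / real (Suc n)" for n
  have t: "t n > 0" "t n \<le> 1" for n by (simp_all add: t_def)
  have t0: "t \<longlonglongrightarrow> 0" unfolding t_def using LIMSEQ_Suc[OF lim_1_over_n] .
  define q where "q n x = (f (x + t n *\<^sub>R v) - f x) /\<^sub>R t n" for n x
  have line: "((\<lambda>s. f (x + s *\<^sub>R v)) has_vector_derivative dirderiv v f (x + s *\<^sub>R v)) (at s)" for x s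
  proof -
    have "((\<lambda>s. f (x + s *\<^sub>R v)) has_derivative (\<lambda>h. frechet_derivative f (at (x + s *\<^sub>R v)) (h *\<^sub>R v))) (at s)"
      by (rule has_derivative_compose[where g = f, OF _ frechet_derivative_worksI[OF d]]) (auto intro!: derivative_eq_intros)
    then show ?thesis
      using linear_frechet_derivative[OF d] by (simp add: has_vector_derivative_def linear_scale)
  qed
  have qbound: "norm (q n x) \<le> M" for n x
  proof -
    have "norm (f (x + t n *\<^sub>R v) - f (x + 0 *\<^sub>R v)) \<le> M * norm (t n - 0)"
    proof (rule differentiable_bound[of UNIV "\<lambda>s. f (x + s *\<^sub>R v)" "\<lambda>s h. h *\<^sub>R dirderiv v f (x + s *\<^sub>R v)"])
      show "((\<lambda>s. f (x + s *\<^sub>R v)) has_derivative (\<lambda>h. h *\<^sub>R dirderiv v f (x + s *\<^sub>R v))) (at s within UNIV)" for s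
        using line by (simp add: has_vector_derivative_def)
      show "onorm (\<lambda>h. h *\<^sub>R dirderiv v f (x + s *\<^sub>R v)) \<le> M" for s
        by (rule onorm_le) (simp add: mult.commute[of M] mult_left_mono M)
    qed auto
    moreover have "norm (q n x) = norm (f (x + t n *\<^sub>R v) - f x) / t n"
      using t(1)[of n] by (simp add: q_def divide_inverse mult.commute)
    ultimately show ?thesis using t(1)[of n] by (simp add: pos_divide_le_eq)
  qed
  have qlim: "(\<lambda>n. q n x) \<longlonglongrightarrow> dirderiv v f x" for x
  proof -
    have "((\<lambda>h. (f (x + (0 + h) *\<^sub>R v) - f (x + 0 *\<^sub>R v)) /\<^sub>R h) \<longlongrightarrow> dirderiv v f (x + 0 *\<^sub>R v)) (at 0)"
    proof (rule LIM_zero_cancel, rule tendsto_norm_zero_cancel)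
      let ?D = "dirderiv v f (x + 0 *\<^sub>R v)"
      have "((\<lambda>h. norm (f (x + (0 + h) *\<^sub>R v) - f (x + 0 *\<^sub>R v) - h *\<^sub>R ?D) / norm h) \<longlongrightarrow> 0) (at 0)"
        using line[of x 0] unfolding has_vector_derivative_def has_derivative_at by blast
      moreover have "\<forall>\<^sub>F h in at 0. norm (f (x + (0 + h) *\<^sub>R v) - f (x + 0 *\<^sub>R v) - h *\<^sub>R ?D) / norm h
          = norm ((f (x + (0 + h) *\<^sub>R v) - f (x + 0 *\<^sub>R v)) /\<^sub>R h - ?D)"
      proof (rule eventually_at_filter[THEN iffD2], intro always_eventually allI impI)
        fix h :: real assume "h \<noteq> 0"
        then have "(f (x + (0 + h) *\<^sub>R v) - f (x + 0 *\<^sub>R v)) /\<^sub>R h - ?D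
            = (f (x + (0 + h) *\<^sub>R v) - f (x + 0 *\<^sub>R v) - h *\<^sub>R ?D) /\<^sub>R h"
          by (simp add: scaleR_diff_right)
        then show "norm (f (x + (0 + h) *\<^sub>R v) - f (x + 0 *\<^sub>R v) - h *\<^sub>R ?D) / norm h
            = norm ((f (x + (0 + h) *\<^sub>R v) - f (x + 0 *\<^sub>R v)) /\<^sub>R h - ?D)"
          by (simp only: norm_scaleR) (simp add: divide_inverse mult.commute)
      qed
      ultimately show "((\<lambda>h. norm ((f (x + (0 + h) *\<^sub>R v) - f (x + 0 *\<^sub>R v)) /\<^sub>R h - ?D)) \<longlongrightarrow> 0) (at 0)"
        by (rule Lim_transform_eventually)
    qed
    moreover have "filterlim t (at 0) sequentially"
      using t0 t(1) by (auto simp: filterlim_at intro!: always_eventually less_imp_neq[symmetric])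
    ultimately show ?thesis unfolding q_def using filterlim_compose by fastforce
  qed
  have int: "integrable lborel (\<lambda>x. f (x + t n *\<^sub>R v))" "integrable lborel f"
    "(LINT x|lborel. f (x + t n *\<^sub>R v)) = (LINT x|lborel. f x)" for n
  proof -
    show 1: "integrable lborel f" using contf K by (rule integrable_lebesgue_compact_support)
    have m: "f \<in> borel_measurable borel" using contf by (rule borel_measurable_continuous_onI)
    have eq: "f (x + t n *\<^sub>R v) = f (t n *\<^sub>R v + x)" for x by (simp add: add.commute)
    show "integrable lborel (\<lambda>x. f (x + t n *\<^sub>R v))"
      unfolding eq using 1 integrable_distr_eq[of "(+) (t n *\<^sub>R v)" lborel borel f] m
      by (simp add: lborel_distr_plus)
    show "(LINT x|lborel. f (x + t n *\<^sub>R v)) = (LINT x|lborel. f x)"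
      unfolding eq using integral_distr[of "(+) (t n *\<^sub>R v)" lborel borel f] m
      by (simp add: lborel_distr_plus)
  qed
  \<comment> \<open>Since \<open>t n \<le> 1\<close>, translation moves the support by at most
    \<open>norm v\<close>; so all quotients vanish outside the enlarged ball, and inside it the mean
    value bound M dominates them.\<close>
  have "(\<lambda>n. LINT x|lborel. q n x) \<longlonglongrightarrow> (LINT x|lborel. dirderiv v f x)"
  proof (rule integral_dominated_convergence[where w = "\<lambda>x. indicator (cball 0 (R + norm v)) x *\<^sub>R M"])
    show "dirderiv v f \<in> borel_measurable lborel"
      using borel_measurable_continuous_onI[OF cont] by simp
    show "q n \<in> borel_measurable lborel" for n
      using int unfolding q_def by (intro borel_measurable_integrable) auto
    show "integrable lborel (\<lambda>x. indicator (cball 0 (R + norm v)) x *\<^sub>R M)"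
      by (rule borel_integrable_compact) auto
    show "AE x in lborel. norm (q n x) \<le> indicator (cball 0 (R + norm v)) x *\<^sub>R M" for n
    proof (rule AE_I2)
      fix x :: 'a
      show "norm (q n x) \<le> indicator (cball 0 (R + norm v)) x *\<^sub>R M"
      proof (cases "x \<in> cball 0 (R + norm v)")
        case False
        then have x: "norm x > R + norm v" by (simp add: dist_norm)
        have "norm (t n *\<^sub>R v) \<le> norm v" using t[of n] by (simp add: mult_left_le_one_le)
        moreover have "norm x \<le> norm (x + t n *\<^sub>R v) + norm (t n *\<^sub>R v)"
          using norm_triangle_ineq4[of "x + t n *\<^sub>R v" "t n *\<^sub>R v"] by simp
        ultimately have "norm (x + t n *\<^sub>R v) \<ge> R" using x by linarith
        moreover have "norm x \<ge> R" using x norm_ge_zero[of v] by linarith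
        ultimately have "q n x = 0" using f0 by (simp add: q_def)
        then show ?thesis using False by simp
      qed (use qbound in auto)
    qed
  qed (use qlim in auto)
  moreover have "(LINT x|lborel. q n x) = 0" for n
    unfolding q_def using int by simp
  ultimately have "(LINT x|lborel. dirderiv v f x) = 0" by (simp add: LIMSEQ_const_iff)
  then show ?thesis
    by (subst integral_completion) (use borel_measurable_continuous_onI[OF cont] in simp_all)
qed

section \<open>The Cauchy-Riemann complex\<close>

lemma test_functionD: "test_function \<phi> \<Omega> \<Longrightarrow> Ck_on k \<phi> UNIV"
  by (simp add: test_function_def)

lemma test_functionI:
  assumes "\<And>k. Ck_on k \<phi> UNIV" "compact K" "K \<subseteq> \<Omega>" "\<And>z. z \<notin> K \<Longrightarrow> \<phi> z = 0"
  shows "test_function \<phi> \<Omega>"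
proof -
  have sub: "closure {z. \<phi> z \<noteq> 0} \<subseteq> K"
    using assms(4) by (intro closure_minimal compact_imp_closed[OF assms(2)]) auto
  have "compact (K \<inter> closure {z. \<phi> z \<noteq> 0})"
    by (rule compact_Int_closed[OF assms(2) closed_closure])
  then have "compact (closure {z. \<phi> z \<noteq> 0})" by (simp only: Int_absorb1[OF sub])
  then show ?thesis using assms(1,3) sub unfolding test_function_def by blast
qed

lemma test_functionE:
  assumes "test_function \<phi> \<Omega>"
  obtains K where "compact K" "K \<subseteq> \<Omega>" "\<And>z. z \<notin> K \<Longrightarrow> \<phi> z = 0"
proof (rule that)
  show "compact (closure {z. \<phi> z \<noteq> 0})" "closure {z. \<phi> z \<noteq> 0} \<subseteq> \<Omega>"
    using assms unfolding test_function_def by blast+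
  show "\<phi> z = 0" if "z \<notin> closure {z. \<phi> z \<noteq> 0}" for z
    using that closure_subset[of "{z. \<phi> z \<noteq> 0}"] by auto
qed

lemma test_function_differentiable: "test_function \<phi> \<Omega> \<Longrightarrow> \<phi> differentiable (at z)"
  using test_functionD[of \<phi> \<Omega> 1] by simp

lemma test_function_continuous: "test_function \<phi> \<Omega> \<Longrightarrow> continuous_on UNIV \<phi>"
  using test_functionD[of \<phi> \<Omega> 0] by simp

lemma dirderiv_eq_0_outside:
  assumes "\<phi> differentiable (at z)" "compact K" "z \<notin> K" "\<And>z. z \<notin> K \<Longrightarrow> \<phi> z = 0"
  shows "dirderiv v \<phi> z = 0"
proof -
  have "frechet_derivative \<phi> (at z) = frechet_derivative (\<lambda>z. 0) (at z)"
    by (rule frechet_derivative_transform_within_open[OF assms(1), of "- K"])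
      (use assms compact_imp_closed in \<open>auto simp: open_Compl\<close>)
  then show ?thesis by simp
qed

lemma test_function_dirderiv:
  assumes "test_function \<phi> \<Omega>"
  shows "test_function (dirderiv v \<phi>) \<Omega>"
proof -
  obtain K where K: "compact K" "K \<subseteq> \<Omega>" "\<And>z. z \<notin> K \<Longrightarrow> \<phi> z = 0"
    using assms by (rule test_functionE) blast
  show ?thesis
  proof (rule test_functionI[OF _ K(1,2)])
    show "Ck_on k (dirderiv v \<phi>) UNIV" for k using test_functionD[OF assms, of "Suc k"] by simp
    show "dirderiv v \<phi> z = 0" if "z \<notin> K" for z
      by (rule dirderiv_eq_0_outside[OF test_function_differentiable[OF assms] K(1) that K(3)])
  qed
qed

lemma test_function_bounded_linear:
  assumes "bounded_linear L" "test_function \<phi> \<Omega>"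
  shows "test_function (\<lambda>z. L (\<phi> z)) \<Omega>"
proof -
  obtain K where K: "compact K" "K \<subseteq> \<Omega>" "\<And>z. z \<notin> K \<Longrightarrow> \<phi> z = 0"
    using assms(2) by (rule test_functionE) blast
  interpret bounded_linear L by (rule assms(1))
  show ?thesis
    by (rule test_functionI[OF _ K(1,2)])
      (use Ck_on_compose_bounded_linear[OF assms(1) test_functionD[OF assms(2)]] K(3) in \<open>auto simp: zero\<close>)
qed

lemma test_function_add:
  assumes "test_function f \<Omega>" "test_function g \<Omega>"
  shows "test_function (\<lambda>z. f z + g z) \<Omega>"
proof -
  obtain K L where K: "compact K" "K \<subseteq> \<Omega>" "\<And>z. z \<notin> K \<Longrightarrow> f z = 0"
    and L: "compact L" "L \<subseteq> \<Omega>" "\<And>z. z \<notin> L \<Longrightarrow> g z = 0"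
    using assms by (metis test_functionE)
  show ?thesis
    by (rule test_functionI[of _ "K \<union> L"])
      (use Ck_on_add[OF test_functionD[OF assms(1)] test_functionD[OF assms(2)]] K L in auto)
qed

lemma test_function_mult:
  assumes "test_function f \<Omega>" "test_function g \<Omega>"
  shows "test_function (\<lambda>z. f z * g z) \<Omega>"
proof -
  obtain K where K: "compact K" "K \<subseteq> \<Omega>" "\<And>z. z \<notin> K \<Longrightarrow> f z = 0"
    using assms(1) by (rule test_functionE) blast
  show ?thesis
    by (rule test_functionI[OF _ K(1,2)])
      (use Ck_on_mult[OF test_functionD[OF assms(1)] test_functionD[OF assms(2)]] K in auto)
qed

lemma dzbar_eq_dirderiv:
  "dzbar k \<phi> = (\<lambda>z. (1/2) * dirderiv (axis k 1) \<phi> z + (\<i>/2) * dirderiv (axis k \<i>) \<phi> z)"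
  by (auto simp: dzbar_def fun_eq_iff field_simps)

lemma test_function_dzbar: "test_function \<phi> \<Omega> \<Longrightarrow> test_function (dzbar k \<phi>) \<Omega>"
  unfolding dzbar_eq_dirderiv
  by (intro test_function_add test_function_bounded_linear[OF bounded_linear_mult_right]
      test_function_dirderiv)

lemma dzbar_commute:
  assumes "test_function \<phi> \<Omega>"
  shows "dzbar j (dzbar k \<phi>) = dzbar k (dzbar j \<phi>)"
proof -
  have d: "dirderiv v \<phi> differentiable (at z)" for v z
    using test_function_dirderiv[OF assms] by (rule test_function_differentiable)
  have *: "dirderiv w (dzbar k \<phi>) z
      = (1/2) * dirderiv w (dirderiv (axis k 1) \<phi>) z + (\<i>/2) * dirderiv w (dirderiv (axis k \<i>) \<phi>) z" for k w z
    unfolding dzbar_eq_dirderiv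
    by (intro dirderiv_eq has_derivative_add bounded_linear.has_derivative[OF bounded_linear_mult_right]
        frechet_derivative_worksI d)
  have c: "dirderiv w (dirderiv v \<phi>) z = dirderiv v (dirderiv w \<phi>) z" for v w z
    by (rule dirderiv_commute) (rule test_functionD[OF assms])
  have e: "dzbar j \<psi> z = (1/2) * dirderiv (axis j 1) \<psi> z + (\<i>/2) * dirderiv (axis j \<i>) \<psi> z" for j \<psi> z
    by (simp add: dzbar_eq_dirderiv)
  show ?thesis
    by (rule ext) (simp only: e[of _ "dzbar _ \<phi>"] * c[of "axis k 1"] c[of "axis k \<i>"] ring_distribs mult.left_commute
      add_ac)
qed

lemma integrable_test_function: "test_function \<phi> \<Omega> \<Longrightarrow> integrable lebesgue \<phi>"
  by (metis test_functionE integrable_lebesgue_compact_support(2) test_function_continuous)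

lemma integral_dzbar_eq_0:
  assumes "test_function \<phi> \<Omega>"
  shows "(LINT z|lebesgue. dzbar k \<phi> z) = 0"
proof -
  have 0: "(LINT z|lebesgue. dirderiv v \<phi> z) = 0" for v
  proof -
    obtain K where K: "compact K" "K \<subseteq> \<Omega>" "\<And>z. z \<notin> K \<Longrightarrow> \<phi> z = 0"
      using assms by (rule test_functionE) blast
    show ?thesis
      by (rule integral_dirderiv_eq_0[OF test_function_differentiable[OF assms]
            test_function_continuous[OF test_function_dirderiv[OF assms]] K(1,3)])
  qed
  show ?thesis
    unfolding dzbar_eq_dirderiv
    using integrable_test_function[OF test_function_dirderiv[OF assms]]
    by (subst Bochner_Integration.integral_add) (simp_all add: 0)
qed

lemma dzbar_mult:
  assumes "f differentiable (at z)" "g differentiable (at z)"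
  shows "dzbar k (\<lambda>z. f z * g z) z = f z * dzbar k g z + dzbar k f z * g z"
proof -
  have "dirderiv v (\<lambda>z. f z * g z) z = f z * dirderiv v g z + dirderiv v f z * g z" for v
    by (intro dirderiv_eq has_derivative_mult frechet_derivative_worksI assms)
  then show ?thesis by (simp add: dzbar_eq_dirderiv algebra_simps add_divide_distrib)
qed

lemma dzbar_integration_by_parts:
  assumes f: "test_function f \<Omega>" and g: "test_function g \<Omega>"
  shows "(LINT z|lebesgue. dzbar k f z * g z) = - (LINT z|lebesgue. f z * dzbar k g z)"
proof -
  have "0 = (LINT z|lebesgue. f z * dzbar k g z + dzbar k f z * g z)"
    using integral_dzbar_eq_0[OF test_function_mult[OF f g], of k]
      dzbar_mult[OF test_function_differentiable[OF f] test_function_differentiable[OF g]]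
    by simp
  also have "\<dots> = (LINT z|lebesgue. f z * dzbar k g z) + (LINT z|lebesgue. dzbar k f z * g z)"
    by (intro Bochner_Integration.integral_add
        integrable_test_function[OF test_function_mult[OF f test_function_dzbar[OF g]]]
        integrable_test_function[OF test_function_mult[OF test_function_dzbar[OF f] g]])
  finally show ?thesis by (simp add: eq_neg_iff_add_eq_0 add.commute)
qed

section \<open>Representatives, distributional pairings and spaces of forms\<close>

lemma abs_l2_cases:
  obtains f' where "f = abs_l2 f'" "sq_integrable f'"
  by (induct f rule: l2.abs_induct) blast

lemma sq_integrable_compact_support:
  fixes f :: "'a::euclidean_space \<Rightarrow> 'b::euclidean_space"
  assumes "continuous_on UNIV f" "compact K" "\<And>x. x \<notin> K \<Longrightarrow> f x = 0"
  shows "sq_integrable f"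
  unfolding sq_integrable_def
proof
  show "f \<in> borel_measurable lebesgue"
    using integrable_lebesgue_compact_support(2)[OF assms] by (rule borel_measurable_integrable)
  show "integrable lebesgue (\<lambda>x. (norm (f x))\<^sup>2)"
    using assms by (intro integrable_lebesgue_compact_support(2)[OF _ assms(2)] continuous_intros) auto
qed

lemma inner_abs_l2:
  "sq_integrable f \<Longrightarrow> sq_integrable g \<Longrightarrow> inner (abs_l2 f) (abs_l2 g) = (LINT x|lebesgue. inner (f x) (g x))"
  by (simp add: inner_l2.abs_eq)

lemma l2_pairing_abs_l2:
  "sq_integrable f \<Longrightarrow> l2_pairing (abs_l2 f) J \<phi> = (LINT z|lebesgue. f z $ J * \<phi> z)"
  by (simp add: l2_pairing.abs_eq)

lemma abs_l2_mem_L2_forms: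
  "sq_integrable f \<Longrightarrow> abs_l2 f \<in> L2_forms q \<Omega> \<longleftrightarrow>
     (AE z in lebesgue. \<forall>J. f z $ J \<noteq> 0 \<longrightarrow> z \<in> \<Omega> \<and> card J = q)"
  by (simp add: L2_forms_def is_form.abs_eq)

lemma abs_l2_eq_0_iff: "sq_integrable f \<Longrightarrow> abs_l2 f = 0 \<longleftrightarrow> (AE z in lebesgue. f z = 0)"
  by (subst inner_eq_zero_iff[symmetric])
    (simp add: inner_abs_l2 integral_nonneg_eq_0_iff_AE integrable_inner_sq)

lemma measurable_vec_nth:
  fixes f :: "'a::euclidean_space \<Rightarrow> complex ^ 'm"
  assumes "f \<in> borel_measurable lebesgue"
  shows "(\<lambda>z. f z $ J) \<in> borel_measurable lebesgue"
proof -
  have "continuous_on UNIV (\<lambda>v :: complex ^ 'm. v $ J)" by (intro continuous_intros)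
  from borel_measurable_continuous_on[OF this assms] show ?thesis .
qed

lemma integrable_l2_pairing:
  assumes f: "sq_integrable f" and \<phi>: "test_function \<phi> \<Omega>"
  shows "integrable lebesgue (\<lambda>z. f z $ J * \<phi> z)"
proof (rule Bochner_Integration.integrable_bound)
  have \<phi>2: "sq_integrable \<phi>"
    using \<phi> by (metis test_functionE sq_integrable_compact_support test_function_continuous)
  then show "integrable lebesgue (\<lambda>z. (norm (f z))\<^sup>2 + (norm (\<phi> z))\<^sup>2)"
    using f by (auto simp: sq_integrable_def)
  show "(\<lambda>z. f z $ J * \<phi> z) \<in> borel_measurable lebesgue"
    using f \<phi>2 measurable_vec_nth[of f J] by (intro borel_measurable_times) (auto simp: sq_integrable_def)
  show "AE z in lebesgue. norm (f z $ J * \<phi> z) \<le> norm ((norm (f z))\<^sup>2 + (norm (\<phi> z))\<^sup>2)"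
  proof (rule AE_I2)
    fix z
    have "norm (f z $ J * \<phi> z) \<le> norm (f z) * norm (\<phi> z)"
      by (simp add: norm_mult mult_right_mono Finite_Cartesian_Product.norm_nth_le)
    also have "\<dots> \<le> (norm (f z))\<^sup>2 + (norm (\<phi> z))\<^sup>2"
      using sum_squares_bound[of "norm (f z)" "norm (\<phi> z)"]
        mult_nonneg_nonneg[OF norm_ge_zero[of "f z"] norm_ge_zero[of "\<phi> z"]]
      unfolding mult.assoc by linarith
    finally show "norm (f z $ J * \<phi> z) \<le> norm ((norm (f z))\<^sup>2 + (norm (\<phi> z))\<^sup>2)" by simp
  qed
qed

lemma l2_pairing_diff:
  assumes "test_function \<phi> \<Omega>"
  shows "l2_pairing (f - g) J \<phi> = l2_pairing f J \<phi> - l2_pairing g J \<phi>"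
proof -
  obtain f' g' where f': "f = abs_l2 f'" "sq_integrable f'" and g': "g = abs_l2 g'" "sq_integrable g'"
    using abs_l2_cases by metis
  have "f - g = abs_l2 (\<lambda>x. f' x - g' x)" using f' g' by (simp add: minus_l2.abs_eq)
  then show ?thesis
    using f' g' Bochner_Integration.integral_diff[OF integrable_l2_pairing[OF f'(2) assms]
        integrable_l2_pairing[OF g'(2) assms], of J J]
    by (simp add: l2_pairing_abs_l2 sq_integrable_diff left_diff_distrib)
qed

lemma l2_pairing_zero [simp]: "l2_pairing 0 J \<phi> = 0"
  by transfer simp

text \<open>Realised as an annihilator, the space of forms is visibly a closed subspace.\<close>

lemma L2_forms_eq_annihilator:
  fixes \<Omega> :: "(complex ^ 'n::finite) set"
  assumes "open \<Omega>"
  shows "L2_forms q \<Omega> = (\<Inter>g\<in>{abs_l2 g | g. sq_integrable g \<and>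
      (\<forall>z J. z \<in> \<Omega> \<and> card J = q \<longrightarrow> g z $ J = 0)}. {f. inner g f = 0})" (is "_ = ?R")
proof (intro set_eqI iffI)
  fix f :: "'n form"
  obtain f' where f': "f = abs_l2 f'" "sq_integrable f'" by (rule abs_l2_cases)
  {
    assume "f \<in> L2_forms q \<Omega>"
    then have ae: "AE z in lebesgue. \<forall>J. f' z $ J \<noteq> 0 \<longrightarrow> z \<in> \<Omega> \<and> card J = q"
      using f' by (simp add: abs_l2_mem_L2_forms)
    have "inner (abs_l2 g) f = 0"
      if g: "sq_integrable g" "\<forall>z J. z \<in> \<Omega> \<and> card J = q \<longrightarrow> g z $ J = 0" for g :: "complex ^ 'n \<Rightarrow> complex ^ 'n set"
    proof -
      have "AE z in lebesgue. inner (g z) (f' z) = 0"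
        using ae by eventually_elim (use g(2) in \<open>auto simp: inner_vec_def intro!: sum.neutral, metis inner_zero_left inner_zero_right\<close>)
      then have "(LINT z|lebesgue. inner (g z) (f' z)) = 0" by (rule integral_eq_zero_AE)
      then show ?thesis using f' g(1) by (simp add: inner_abs_l2)
    qed
    then show "f \<in> ?R" by auto
  }
  {
    assume R: "f \<in> ?R"
    \<comment> \<open>This is the representative of f with its admissible components deleted. It
      belongs to the annihilating family, and its inner product with f is its own squared norm, so
      it vanishes almost everywhere.\<close>
    define g where "g z = (\<chi> J. if z \<in> \<Omega> \<and> card J = q then 0 else f' z $ J)" for z
    have "sq_integrable g"
    proof (rule sq_integrable_bound)
      have m: "(\<lambda>z. if z \<in> \<Omega> \<and> card J = q then 0 else f' z $ J) \<in> borel_measurable lebesgue" for J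
      proof (rule measurable_If)
        show "(\<lambda>z. f' z $ J) \<in> borel_measurable lebesgue"
          using f' by (intro measurable_vec_nth) (simp add: sq_integrable_def)
        show "{z \<in> space lebesgue. z \<in> \<Omega> \<and> card J = q} \<in> sets lebesgue"
          using assms by (cases "card J = q") auto
      qed auto
      have "g = (\<lambda>z. \<Sum>J\<in>UNIV. axis J (if z \<in> \<Omega> \<and> card J = q then 0 else f' z $ J))"
        by (auto simp: g_def fun_eq_iff vec_eq_iff axis_def)
      moreover have "(\<lambda>z. axis J (if z \<in> \<Omega> \<and> card J = q then 0 else f' z $ J) :: complex ^ 'n set) \<in> borel_measurable lebesgue" for J
      proof -
        have "continuous_on UNIV (\<lambda>x. axis J x :: complex ^ 'n set)"
          unfolding axis_def
        proof (rule continuous_on_vec_lambda)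
          show "continuous_on UNIV (\<lambda>x :: complex. if I = J then x else 0)" for I
            by (cases "I = J") auto
        qed
        from borel_measurable_continuous_on[OF this m] show ?thesis .
      qed
      ultimately show "g \<in> borel_measurable lebesgue" by simp
      show "integrable lebesgue (\<lambda>z. (norm (f' z))\<^sup>2)" using f' by (simp add: sq_integrable_def)
      show "(norm (g z))\<^sup>2 \<le> (norm (f' z))\<^sup>2" for z
        by (intro power_mono norm_le_componentwise_cart) (auto simp: g_def)
    qed
    moreover have "\<forall>z J. z \<in> \<Omega> \<and> card J = q \<longrightarrow> g z $ J = 0" by (simp add: g_def)
    ultimately have "inner (abs_l2 g) f = 0" using R by blast
    moreover have "inner (g z) (f' z) = inner (g z) (g z)" for z
      by (auto simp: inner_vec_def g_def intro!: sum.cong)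
    ultimately have "inner (abs_l2 g) (abs_l2 g) = 0"
      using f' \<open>sq_integrable g\<close> by (simp add: inner_abs_l2)
    then have "AE z in lebesgue. g z = 0" using \<open>sq_integrable g\<close> by (simp add: abs_l2_eq_0_iff)
    then have "AE z in lebesgue. \<forall>J. f' z $ J \<noteq> 0 \<longrightarrow> z \<in> \<Omega> \<and> card J = q"
      by eventually_elim (auto simp: g_def vec_eq_iff split: if_splits)
    then show "f \<in> L2_forms q \<Omega>" using f' by (simp add: abs_l2_mem_L2_forms)
  }
qed

lemma closed_L2_forms: "open \<Omega> \<Longrightarrow> closed (L2_forms q \<Omega>)"
  unfolding L2_forms_eq_annihilator by (intro closed_INT ballI closed_hyperplane)

lemma subspace_L2_forms: "open \<Omega> \<Longrightarrow> subspace (L2_forms q \<Omega>)"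
  unfolding L2_forms_eq_annihilator by (intro subspace_Inter) (auto simp: subspace_hyperplane)

section \<open>The operator \<open>dbar\<close>, its adjoint and the Neumann operator\<close>

lemma dbar_diff:
  assumes "open \<Omega>" "(f, g) \<in> dbar q \<Omega>" "(f', g') \<in> dbar q \<Omega>"
  shows "(f - f', g - g') \<in> dbar q \<Omega>"
  using assms(2,3) subspace_L2_forms[OF assms(1), THEN subspace_diff]
  by (auto simp: dbar_def l2_pairing_diff l2_pairing_diff[OF test_function_dzbar]
      right_diff_distrib sum_subtractf)

lemma wedge_sign_singleton [simp]: "wedge_sign k {k} = 1"
proof -
  have "{j \<in> {k}. j < k} = {}" by auto
  then show ?thesis unfolding wedge_sign_def by (simp only: card.empty power_0)
qed

lemma dbar_0D:
  assumes "(f, g) \<in> dbar 0 \<Omega>" "test_function \<phi> \<Omega>"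
  shows "l2_pairing g {k} \<phi> = - l2_pairing f {} (dzbar k \<phi>)"
proof -
  have "l2_pairing g K \<phi> = - (\<Sum>k\<in>K. wedge_sign k K * l2_pairing f (K - {k}) (dzbar k \<phi>))"
    if "card K = 1" for K
    using assms that unfolding dbar_def by auto
  from this[of "{k}"] show ?thesis by simp
qed

text \<open>For K = {a, b} with a < b the two wedge signs are opposite. Moving both pairings from g
  to f, with \<open>dzbar a \<phi>\<close> and \<open>dzbar b \<phi>\<close> as test functions,
  leaves two mixed second derivatives of \<phi> that cancel because they commute.\<close>

lemma dbar_dbar_eq_0:
  assumes "open \<Omega>" "(f, g) \<in> dbar 0 \<Omega>"
  shows "(g, 0) \<in> dbar 1 \<Omega>"
proof -
  have g: "g \<in> L2_forms 1 \<Omega>" using assms(2) by (simp add: dbar_def)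
  have 0: "0 \<in> L2_forms (1 + 1) \<Omega>" using subspace_L2_forms[OF assms(1)] by (rule subspace_0)
  have "l2_pairing 0 K \<phi> = - (\<Sum>k\<in>K. wedge_sign k K * l2_pairing g (K - {k}) (dzbar k \<phi>))"
    if K: "card K = 1 + 1" and \<phi>: "test_function \<phi> \<Omega>" for K \<phi>
  proof -
  obtain a b where ab: "a < b" "K = {a, b}"
    using K unfolding one_add_one card_2_iff by (metis insert_commute linorder_less_linear)
  have "{a, b} - {a} = {b}" "{a, b} - {b} = {a}" using ab(1) by auto
  moreover have "wedge_sign a {a, b} = 1" "wedge_sign b {a, b} = -1"
  proof -
    have e: "{j \<in> {a, b}. j < a} = {}" "{j \<in> {a, b}. j < b} = {a}" using ab(1) by auto
    show "wedge_sign a {a, b} = 1" unfolding wedge_sign_def e(1) by simp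
    show "wedge_sign b {a, b} = -1" unfolding wedge_sign_def e(2) by simp
  qed
  ultimately have "(\<Sum>k\<in>K. wedge_sign k K * l2_pairing g (K - {k}) (dzbar k \<phi>))
      = l2_pairing g {b} (dzbar a \<phi>) - l2_pairing g {a} (dzbar b \<phi>)"
    using ab by (simp add: ab(2))
  also have "\<dots> = 0"
    using dbar_0D[OF assms(2) test_function_dzbar[OF \<phi>]] dzbar_commute[OF \<phi>, of a b] by simp
  finally show ?thesis by simp
  qed
  then show ?thesis using g 0 unfolding dbar_def by blast
qed

lemma dbar_adjD:
  "(g, h) \<in> dbar_adj q \<Omega> \<Longrightarrow> (f, Af) \<in> dbar q \<Omega> \<Longrightarrow> inner Af g = inner f h"
  unfolding dbar_adj_def graph_adjoint_def Re_cinner_l2[symmetric] by auto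

lemma complex_laplacianE:
  assumes "(f, Lf) \<in> complex_laplacian \<Omega>"
  obtains p g q h where "Lf = g + h" "(f, p) \<in> dbar_adj 0 \<Omega>" "(p, g) \<in> dbar 0 \<Omega>"
    "(f, q) \<in> dbar 1 \<Omega>" "(q, h) \<in> dbar_adj 1 \<Omega>"
  using assms unfolding complex_laplacian_def by blast

text \<open>As f is the Laplacian of N f, inner products with f become values of the Dirichlet form,
  the sum of the inner products of the \<open>dbar_adj 0\<close> components and of the
  \<open>dbar 1\<close> components. The fact \<open>form\<close> is this identity, and the Dirichlet
  form is symmetric and nonnegative.\<close>

lemma Neumann_symmetric_nonneg:
  assumes N: "is_dbar_Neumann_operator \<Omega> N" and f: "f \<in> L2_forms 1 \<Omega>" and g: "g \<in> L2_forms 1 \<Omega>"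
  shows "inner (N f) g = inner f (N g)" "0 \<le> inner (N f) f"
proof -
  have form: "inner Lf f' = inner p p' + inner q q'"
    if "Lf = a + b" "(p, a) \<in> dbar 0 \<Omega>" "(q, b) \<in> dbar_adj 1 \<Omega>" "(f', p') \<in> dbar_adj 0 \<Omega>" "(f', q') \<in> dbar 1 \<Omega>"
    for Lf f' p p' q q' a b
    using dbar_adjD[OF that(4,2)] dbar_adjD[OF that(3,5)] that(1)
    by (simp add: inner_add_left inner_add_right inner_commute)
  have "(N f, f) \<in> complex_laplacian \<Omega>" "(N g, g) \<in> complex_laplacian \<Omega>"
    using N f g by (auto simp: is_dbar_Neumann_operator_def)
  from this(1) obtain p a q b where 1: "f = a + b" "(N f, p) \<in> dbar_adj 0 \<Omega>" "(p, a) \<in> dbar 0 \<Omega>"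
    "(N f, q) \<in> dbar 1 \<Omega>" "(q, b) \<in> dbar_adj 1 \<Omega>"
    by (rule complex_laplacianE)
  from \<open>(N g, g) \<in> complex_laplacian \<Omega>\<close> obtain p' a' q' b' where 2: "g = a' + b'"
    "(N g, p') \<in> dbar_adj 0 \<Omega>" "(p', a') \<in> dbar 0 \<Omega>"
    "(N g, q') \<in> dbar 1 \<Omega>" "(q', b') \<in> dbar_adj 1 \<Omega>"
    by (rule complex_laplacianE)
  show "inner (N f) g = inner f (N g)"
    using form[OF 1(1,3,5) 2(2,4)] form[OF 2(1,3,5) 1(2,4)] by (simp add: inner_commute)
  show "0 \<le> inner (N f) f"
    using form[OF 1(1,3,5) 1(2,4)] by (simp add: inner_commute)
qed

text \<open>
  The component \<open>h\<close> of \<open>v = dbar u\<close> in the range of \<open>dbar_adj 1\<close> is again \<open>dbar\<close> of something, hence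
  \<open>dbar\<close>-closed, hence zero; then \<open>p = dbar_adj 0 (N v)\<close> and \<open>u\<close> have the same \<open>dbar\<close> and are both
  orthogonal to the kernel of \<open>dbar\<close>.
\<close>

lemma canonical_solution:
  assumes "open \<Omega>" and N: "is_dbar_Neumann_operator \<Omega> N"
    and uv: "(u, v) \<in> dbar 0 \<Omega>" and orth: "\<And>k. (k, 0) \<in> dbar 0 \<Omega> \<Longrightarrow> inner k u = 0"
  shows "inner v (N v) = inner u u"
proof -
  have "v \<in> L2_forms 1 \<Omega>" using uv by (simp add: dbar_def)
  then have "(N v, v) \<in> complex_laplacian \<Omega>" using N by (simp add: is_dbar_Neumann_operator_def)
  then obtain p g q h where L: "v = g + h" "(N v, p) \<in> dbar_adj 0 \<Omega>" "(p, g) \<in> dbar 0 \<Omega>"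
    "(N v, q) \<in> dbar 1 \<Omega>" "(q, h) \<in> dbar_adj 1 \<Omega>"
    by (rule complex_laplacianE)
  have "(u - p, h) \<in> dbar 0 \<Omega>" using dbar_diff[OF assms(1) uv L(3)] L(1) by simp
  then have "(h, 0) \<in> dbar 1 \<Omega>" by (rule dbar_dbar_eq_0[OF assms(1)])
  from dbar_adjD[OF L(5) this] have "h = 0" by simp
  then have k: "(u - p, 0) \<in> dbar 0 \<Omega>" using \<open>(u - p, h) \<in> dbar 0 \<Omega>\<close> by simp
  have "inner (u - p) p = 0" using dbar_adjD[OF L(2) k] by simp
  moreover have "inner (u - p) u = 0" using orth[OF k] .
  ultimately have "inner (u - p) (u - p) = 0" by (simp add: inner_diff_right)
  then have "p = u" by simp
  then show ?thesis using dbar_adjD[OF L(2) uv] by simp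
qed

section \<open>Explicit forms built from test functions\<close>

definition function_form :: "(complex ^ 'n \<Rightarrow> complex) \<Rightarrow> complex ^ 'n::finite \<Rightarrow> complex ^ 'n set" where
  "function_form u z = (\<chi> J. if J = {} then u z else 0)"

text \<open>A set with one element stands for a single conjugate differential, with index
  \<open>the_elem J\<close>. The coefficients carry no sign because
  \<open>wedge_sign k {k} = 1\<close>.\<close>

definition dbar_form :: "(complex ^ 'n \<Rightarrow> complex) \<Rightarrow> complex ^ 'n::finite \<Rightarrow> complex ^ 'n set" where
  "dbar_form u z = (\<chi> J. if card J = 1 then dzbar (the_elem J) u z else 0)"

lemma continuous_on_forms:
  assumes "test_function u \<Omega>"
  shows "continuous_on UNIV (function_form u)" "continuous_on UNIV (dbar_form u)"
proof -
  have "continuous_on UNIV (dzbar k u)" for k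
    by (rule test_function_continuous[OF test_function_dzbar[OF assms]])
  then have "continuous_on UNIV (\<lambda>z. if card J = 1 then dzbar (the_elem J) u z else 0)" for J
    by (cases "card J = 1") auto
  moreover have "continuous_on UNIV (\<lambda>z. if J = {} then u z else 0)" for J :: "'a set"
    using test_function_continuous[OF assms] by (cases "J = {}") auto
  ultimately show "continuous_on UNIV (function_form u)" "continuous_on UNIV (dbar_form u)"
    unfolding function_form_def dbar_form_def by (auto intro!: continuous_on_vec_lambda)
qed

lemma sq_integrable_forms:
  assumes "test_function u \<Omega>"
  shows "sq_integrable (function_form u)" "sq_integrable (dbar_form u)"
proof -
  obtain K where K: "compact K" "K \<subseteq> \<Omega>" "\<And>z. z \<notin> K \<Longrightarrow> u z = 0"
    using assms by (rule test_functionE) blast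
  have "dzbar k u z = 0" if "z \<notin> K" for z k
    using dirderiv_eq_0_outside[OF test_function_differentiable[OF assms] K(1) that K(3)]
    by (simp add: dzbar_eq_dirderiv)
  then have "function_form u z = 0" "dbar_form u z = 0" if "z \<notin> K" for z
    using that K(3) by (simp_all add: function_form_def dbar_form_def vec_eq_iff)
  then show "sq_integrable (function_form u)" "sq_integrable (dbar_form u)"
    by (auto intro: sq_integrable_compact_support[OF _ K(1)] continuous_on_forms[OF assms])
qed

text \<open>Integration by parts identifies the classical derivatives with the distributional ones
  in \<open>dbar\<close>; compact support excludes boundary terms.\<close>

lemma dbar_function_form:
  assumes "test_function u \<Omega>"
  shows "(abs_l2 (function_form u), abs_l2 (dbar_form u)) \<in> dbar 0 \<Omega>"
proof -
  note sq = sq_integrable_forms[OF assms]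
  have supp: "z \<in> \<Omega>" if "u z \<noteq> 0 \<or> dzbar k u z \<noteq> 0" for z k
    using that test_functionE[OF assms] test_functionE[OF test_function_dzbar[OF assms, of k]]
    by (metis subsetD)
  have "abs_l2 (function_form u) \<in> L2_forms 0 \<Omega>" "abs_l2 (dbar_form u) \<in> L2_forms (0 + 1) \<Omega>"
    using sq supp by (auto simp: abs_l2_mem_L2_forms function_form_def dbar_form_def intro!: AE_I2)
  moreover have "l2_pairing (abs_l2 (dbar_form u)) K \<phi>
      = - (\<Sum>k\<in>K. wedge_sign k K * l2_pairing (abs_l2 (function_form u)) (K - {k}) (dzbar k \<phi>))"
    if K: "card K = 0 + 1" and \<phi>: "test_function \<phi> \<Omega>" for K \<phi>
  proof -
    obtain k where "K = {k}" using card_1_singletonE[of K] K by auto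
    then show ?thesis
      using dzbar_integration_by_parts[OF assms \<phi>, of k]
      by (simp add: sq l2_pairing_abs_l2 dbar_form_def function_form_def)
  qed
  ultimately show ?thesis unfolding dbar_def by blast
qed

text \<open>The distributional equation \<open>dbar k = 0\<close> tested against \<open>\<phi>\<close> is orthogonality to the conjugate of
  \<open>dzbar j \<phi>\<close>.\<close>

lemma orthogonal_dbar_kernel:
  assumes \<phi>: "test_function \<phi> \<Omega>" and k: "(k, 0) \<in> dbar 0 \<Omega>"
  shows "inner k (abs_l2 (function_form (\<lambda>z. cnj (dzbar j \<phi> z)))) = 0"
proof -
  obtain k' where k': "k = abs_l2 k'" "sq_integrable k'" by (rule abs_l2_cases)
  define u where "u z = cnj (dzbar j \<phi> z)" for z
  have u: "test_function u \<Omega>"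
    unfolding u_def by (intro test_function_bounded_linear[OF bounded_linear_cnj] test_function_dzbar \<phi>)
  have "inner k (abs_l2 (function_form u)) = (LINT z|lebesgue. inner (k' z) (function_form u z))"
    using k' sq_integrable_forms[OF u] by (simp add: inner_abs_l2)
  also have "\<dots> = (LINT z|lebesgue. Re (k' z $ {} * dzbar j \<phi> z))"
  proof (rule Bochner_Integration.integral_cong[OF refl])
    fix z
    have "inner (k' z) (function_form u z) = (\<Sum>J\<in>UNIV. if J = {} then inner (k' z $ J) (u z) else 0)"
      unfolding inner_vec_def by (rule sum.cong) (auto simp: function_form_def)
    then show "inner (k' z) (function_form u z) = Re (k' z $ {} * dzbar j \<phi> z)"
      by (simp add: u_def inner_complex_def)
  qed
  also have "\<dots> = Re (LINT z|lebesgue. k' z $ {} * dzbar j \<phi> z)"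
    by (rule integral_Re[OF integrable_l2_pairing[OF k'(2) test_function_dzbar[OF \<phi>]]])
  also have "\<dots> = 0"
    using dbar_0D[OF k \<phi>, of j] k' by (simp add: l2_pairing_abs_l2)
  finally show ?thesis unfolding u_def .
qed

section \<open>Concentrated forms\<close>

lemma integral_rescale:
  fixes g :: "'a::euclidean_space \<Rightarrow> real"
  assumes "continuous_on UNIV g" "\<epsilon> > 0"
  shows "(LINT z|lebesgue. g ((z - c) /\<^sub>R \<epsilon>)) = \<epsilon> ^ DIM('a) * (LINT z|lebesgue. g z)"
proof -
  have g: "g \<in> borel_measurable borel" by (rule borel_measurable_continuous_onI[OF assms(1)])
  have g': "(\<lambda>z. g ((z - c) /\<^sub>R \<epsilon>)) \<in> borel_measurable borel" using g by measurable
  have "(LINT z|lebesgue. g ((z - c) /\<^sub>R \<epsilon>)) = (LINT z|lborel. g ((z - c) /\<^sub>R \<epsilon>))"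
    using g' by (simp add: integral_completion)
  also have "\<dots> = (LINT z|density (distr lborel borel (\<lambda>x. c + \<epsilon> *\<^sub>R x)) (\<lambda>_. ennreal (\<bar>\<epsilon>\<bar> ^ DIM('a))). g ((z - c) /\<^sub>R \<epsilon>))"
    using lborel_affine[of \<epsilon> c] assms(2) by simp
  also have "\<dots> = (LINT z|distr lborel borel (\<lambda>x. c + \<epsilon> *\<^sub>R x). \<epsilon> ^ DIM('a) * g ((z - c) /\<^sub>R \<epsilon>))"
    using g' assms(2) by (subst integral_density) auto
  also have "\<dots> = (LINT x|lborel. \<epsilon> ^ DIM('a) * g x)"
    using g' assms(2) by (subst integral_distr) auto
  also have "\<dots> = \<epsilon> ^ DIM('a) * (LINT z|lebesgue. g z)"
    using g by (simp add: integral_completion)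
  finally show ?thesis .
qed

text \<open>Absolute continuity of the integral, uniformly in the centre. The part of g above height
  n has small integral by dominated convergence, and the part below contributes at most n times the
  volume of the ball, which is independent of c.\<close>

lemma integral_small_balls:
  fixes g :: "'a::euclidean_space \<Rightarrow> real"
  assumes g: "integrable lebesgue g" "\<And>x. g x \<ge> 0" and "e > 0"
  shows "\<exists>\<epsilon>0>0. \<forall>c \<epsilon>. 0 < \<epsilon> \<longrightarrow> \<epsilon> \<le> \<epsilon>0 \<longrightarrow> (LINT x|lebesgue. indicator (cball c \<epsilon>) x * g x) \<le> e"
proof -
  define h where "h n x = (if g x > real n then g x else 0)" for n x
  have gm: "g \<in> borel_measurable lebesgue" using g(1) by (rule borel_measurable_integrable)
  have hm: "h n \<in> borel_measurable lebesgue" for n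
    unfolding h_def using gm by measurable
  have hi: "integrable lebesgue (h n)" for n
    by (rule Bochner_Integration.integrable_bound[OF g(1) hm]) (auto simp: h_def)
  have "(\<lambda>n. LINT x|lebesgue. h n x) \<longlonglongrightarrow> (LINT x :: 'a|lebesgue. 0)"
  proof (rule integral_dominated_convergence[where w = g])
    show "AE x in lebesgue. (\<lambda>n. h n x) \<longlonglongrightarrow> 0"
    proof (rule AE_I2)
      fix x
      obtain m where m: "g x \<le> real m" using real_arch_simple by blast
      have "\<forall>\<^sub>F n in sequentially. h n x = 0"
        using eventually_ge_at_top[of m] by eventually_elim (use m in \<open>auto simp: h_def\<close>)
      then show "(\<lambda>n. h n x) \<longlonglongrightarrow> 0" by (rule tendsto_eventually)
    qed
  qed (use g hm in \<open>auto simp: h_def\<close>)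
  then have "(\<lambda>n. LINT x|lebesgue. h n x) \<longlonglongrightarrow> 0" by simp
  from order_tendstoD(2)[OF this, of "e/2"] \<open>e > 0\<close>
  obtain n where n: "(LINT x|lebesgue. h n x) < e / 2"
    by (auto simp: eventually_sequentially)
  define V where "V = unit_ball_vol (real DIM('a))"
  have V: "V \<ge> 0" by (simp add: V_def unit_ball_vol_nonneg)
  \<comment> \<open>The bound 1 allows the power of \<epsilon> in the volume to be replaced by
    \<epsilon> itself; the summand 1 keeps the denominator positive when \<open>real n * V\<close>
    is 0.\<close>
  define \<epsilon>0 where "\<epsilon>0 = min 1 (e / (2 * (real n * V + 1)))"
  have "real n * V \<ge> 0" using V by simp
  then have \<epsilon>0: "\<epsilon>0 > 0" "\<epsilon>0 \<le> 1" "real n * V * \<epsilon>0 \<le> e / 2"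
  proof -
    show "\<epsilon>0 > 0" "\<epsilon>0 \<le> 1" using \<open>e > 0\<close> \<open>real n * V \<ge> 0\<close> by (auto simp: \<epsilon>0_def)
    have "real n * V * \<epsilon>0 \<le> (real n * V + 1) * (e / (2 * (real n * V + 1)))"
      using \<open>real n * V \<ge> 0\<close> \<open>\<epsilon>0 > 0\<close> by (intro mult_mono) (auto simp: \<epsilon>0_def)
    also have "\<dots> = e / 2" using \<open>real n * V \<ge> 0\<close> by (simp add: field_simps)
    finally show "real n * V * \<epsilon>0 \<le> e / 2" .
  qed
  have "(LINT x|lebesgue. indicator (cball c \<epsilon>) x * g x) \<le> e" if \<epsilon>: "0 < \<epsilon>" "\<epsilon> \<le> \<epsilon>0" for c \<epsilon>
  proof -
    have ib: "integrable lebesgue (indicator (cball c \<epsilon>) :: 'a \<Rightarrow> real)"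
      using integrable_real_indicator[of "cball c \<epsilon>" lebesgue] by (simp add: emeasure_cball ennreal_mult_less_top \<epsilon> less_imp_le)
    have "(LINT x|lebesgue. indicator (cball c \<epsilon>) x * g x)
        \<le> (LINT x|lebesgue. h n x + real n * indicator (cball c \<epsilon>) x)"
    proof (rule integral_mono)
      show "integrable lebesgue (\<lambda>x. indicator (cball c \<epsilon>) x * g x)"
        using integrable_mult_indicator[OF _ g(1), of "cball c \<epsilon>"] by simp
      show "integrable lebesgue (\<lambda>x. h n x + real n * indicator (cball c \<epsilon>) x)"
        using hi ib by auto
    qed (use g(2) in \<open>auto simp: h_def indicator_def\<close>)
    also have "\<dots> = (LINT x|lebesgue. h n x) + real n * measure lborel (cball c \<epsilon>)"
      using hi ib by simp
    also have "measure lborel (cball c \<epsilon>) = V * \<epsilon> ^ DIM('a)" using \<epsilon> by (simp add: content_cball V_def)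
    also have "\<epsilon> ^ DIM('a) \<le> \<epsilon>0"
    proof -
      have "\<epsilon> ^ DIM('a) \<le> \<epsilon> ^ 1" using \<epsilon> \<epsilon>0(2) by (intro power_decreasing) (auto simp: Suc_leI)
      then show ?thesis using \<epsilon> by simp
    qed
    finally have "(LINT x|lebesgue. indicator (cball c \<epsilon>) x * g x) \<le> (LINT x|lebesgue. h n x) + real n * (V * \<epsilon>0)"
      using V by (auto simp: mult_left_mono)
    then show ?thesis using n \<epsilon>0(3) by (simp add: mult.assoc)
  qed
  then show ?thesis using \<epsilon>0(1) by blast
qed

text \<open>A quantitative form of weak convergence to 0. Against a function g living on a ball only
  the restriction of f to that ball counts; the norm of this restriction is small uniformly in the
  centre, and Cauchy-Schwarz gives a bound relative to the norm of g.\<close>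

lemma inner_concentrated_small:
  fixes f :: "('a::euclidean_space, 'm::finite) l2"
  assumes "\<theta> > 0"
  shows "\<exists>\<epsilon>0>0. \<forall>c \<epsilon> (g :: 'a \<Rightarrow> complex ^ 'm). 0 < \<epsilon> \<longrightarrow> \<epsilon> \<le> \<epsilon>0 \<longrightarrow> sq_integrable g \<longrightarrow>
      (\<forall>z. z \<notin> cball c \<epsilon> \<longrightarrow> g z = 0) \<longrightarrow> \<bar>inner (abs_l2 g) f\<bar> \<le> \<theta> * norm (abs_l2 g)"
proof -
  obtain f' where f': "f = abs_l2 f'" "sq_integrable f'" by (rule abs_l2_cases)
  have int: "integrable lebesgue (\<lambda>x. (norm (f' x))\<^sup>2)" using f' by (simp add: sq_integrable_def)
  obtain \<epsilon>0 where \<epsilon>0: "\<epsilon>0 > 0" "\<And>c \<epsilon>. 0 < \<epsilon> \<Longrightarrow> \<epsilon> \<le> \<epsilon>0 \<Longrightarrow>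
      (LINT x|lebesgue. indicator (cball c \<epsilon>) x * (norm (f' x))\<^sup>2) \<le> \<theta>\<^sup>2"
    using integral_small_balls[OF int _ zero_less_power[OF assms, of 2]] by auto
  have "\<bar>inner (abs_l2 g) f\<bar> \<le> \<theta> * norm (abs_l2 g)"
    if \<epsilon>: "0 < \<epsilon>" "\<epsilon> \<le> \<epsilon>0" and g: "sq_integrable g" "\<forall>z. z \<notin> cball c \<epsilon> \<longrightarrow> g z = 0"
    for c \<epsilon> and g :: "'a \<Rightarrow> complex ^ 'm"
  proof -
    define k where "k x = indicat_real (cball c \<epsilon>) x *\<^sub>R f' x" for x
    have k: "sq_integrable k"
    proof (rule sq_integrable_bound[OF _ int])
      show "k \<in> borel_measurable lebesgue"
        unfolding k_def using f'(2)
        by (intro borel_measurable_scaleR borel_measurable_indicator) (auto simp: sq_integrable_def)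
      show "(norm (k x))\<^sup>2 \<le> (norm (f' x))\<^sup>2" for x by (auto simp: k_def indicator_def)
    qed
    have "inner (g x) (f' x) = inner (g x) (k x)" for x
      using g(2) by (auto simp: k_def indicator_def)
    then have "inner (abs_l2 g) f = inner (abs_l2 g) (abs_l2 k)"
      using f' g(1) k by (simp add: inner_abs_l2)
    then have "\<bar>inner (abs_l2 g) f\<bar> \<le> norm (abs_l2 g) * norm (abs_l2 k)"
      by (simp add: Cauchy_Schwarz_ineq2)
    moreover have "norm (abs_l2 g) * norm (abs_l2 k) \<le> norm (abs_l2 g) * \<theta>"
    proof (rule mult_left_mono[OF power2_le_imp_le])
      have "(norm (abs_l2 k))\<^sup>2 = (LINT x|lebesgue. inner (k x) (k x))"
        using k by (simp add: power2_norm_eq_inner inner_abs_l2)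
      also have "\<dots> = (LINT x|lebesgue. indicator (cball c \<epsilon>) x * (norm (f' x))\<^sup>2)"
        by (rule Bochner_Integration.integral_cong) (auto simp: k_def indicator_def power2_norm_eq_inner)
      also have "\<dots> \<le> \<theta>\<^sup>2" by (rule \<epsilon>0(2)[OF \<epsilon>])
      finally show "(norm (abs_l2 k))\<^sup>2 \<le> \<theta>\<^sup>2" .
    qed (use assms in simp_all)
    ultimately show ?thesis by (simp add: mult.commute)
  qed
  then show ?thesis using \<epsilon>0(1) by blast
qed

lemma inner_concentrated_small_finite:
  fixes F :: "('a::euclidean_space, 'm::finite) l2 set"
  assumes "finite F" "\<theta> > 0"
  shows "\<exists>\<epsilon>0>0. \<forall>c \<epsilon> (g :: 'a \<Rightarrow> complex ^ 'm). 0 < \<epsilon> \<longrightarrow> \<epsilon> \<le> \<epsilon>0 \<longrightarrow> sq_integrable g \<longrightarrow>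
      (\<forall>z. z \<notin> cball c \<epsilon> \<longrightarrow> g z = 0) \<longrightarrow> (\<forall>f\<in>F. \<bar>inner (abs_l2 g) f\<bar> \<le> \<theta> * norm (abs_l2 g))"
  using assms(1)
proof (induction F)
  case empty
  then show ?case by (auto intro: exI[of _ 1])
next
  case (insert f F)
  obtain \<epsilon>1 where "\<epsilon>1 > 0" and 1: "\<And>c \<epsilon> (g :: 'a \<Rightarrow> complex ^ 'm). 0 < \<epsilon> \<Longrightarrow> \<epsilon> \<le> \<epsilon>1 \<Longrightarrow> sq_integrable g \<Longrightarrow>
      (\<forall>z. z \<notin> cball c \<epsilon> \<longrightarrow> g z = 0) \<Longrightarrow> (\<forall>f\<in>F. \<bar>inner (abs_l2 g) f\<bar> \<le> \<theta> * norm (abs_l2 g))"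
    using insert.IH by blast
  obtain \<epsilon>2 where "\<epsilon>2 > 0" and 2: "\<And>c \<epsilon> (g :: 'a \<Rightarrow> complex ^ 'm). 0 < \<epsilon> \<Longrightarrow> \<epsilon> \<le> \<epsilon>2 \<Longrightarrow> sq_integrable g \<Longrightarrow>
      (\<forall>z. z \<notin> cball c \<epsilon> \<longrightarrow> g z = 0) \<Longrightarrow> \<bar>inner (abs_l2 g) f\<bar> \<le> \<theta> * norm (abs_l2 g)"
    using inner_concentrated_small[OF assms(2), of f] by blast
  show ?case
    by (rule exI[of _ "min \<epsilon>1 \<epsilon>2"], intro conjI allI impI ballI)
      (use \<open>\<epsilon>1 > 0\<close> \<open>\<epsilon>2 > 0\<close> 1 2 in auto)
qed

text \<open>The centres form a grid with k points in each real coordinate direction and spacing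
  3\<epsilon>, more than the 2\<epsilon> needed for disjointness. The displacements from x0 add up
  to at most 3\<epsilon>k times the dimension, which the 6 in the definition of \<epsilon> makes
  \<rho>/2; the radius \<epsilon> fits into the other half.\<close>

lemma disjoint_balls:
  fixes x0 :: "'a::euclidean_space"
  assumes "\<rho> > 0" "k > 0"
  defines "\<epsilon> \<equiv> \<rho> / (6 * real DIM('a) * real k)"
  obtains I :: "('a \<Rightarrow> nat) set" and c where "finite I" "card I = k ^ DIM('a)"
    "\<And>m. m \<in> I \<Longrightarrow> cball (c m) \<epsilon> \<subseteq> cball x0 \<rho>"
    "\<And>m m'. m \<in> I \<Longrightarrow> m' \<in> I \<Longrightarrow> m \<noteq> m' \<Longrightarrow> cball (c m) \<epsilon> \<inter> cball (c m') \<epsilon> = {}"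
proof
  define I where "I = PiE (Basis :: 'a set) (\<lambda>_. {..<k})"
  define c where "c m = x0 + (\<Sum>b\<in>Basis. (3 * \<epsilon> * real (m b)) *\<^sub>R b)" for m
  have \<epsilon>: "\<epsilon> > 0" using assms by (simp add: \<epsilon>_def)
  have k\<epsilon>: "6 * real DIM('a) * real k * \<epsilon> = \<rho>" using assms by (simp add: \<epsilon>_def)
  show "finite I" by (auto simp: I_def intro!: finite_PiE)
  show "card I = k ^ DIM('a)" by (simp add: I_def card_PiE)
  show "cball (c m) \<epsilon> \<subseteq> cball x0 \<rho>" if m: "m \<in> I" for m
  proof -
    have "dist (c m) x0 = norm (\<Sum>b\<in>Basis. (3 * \<epsilon> * real (m b)) *\<^sub>R b)" by (simp add: c_def dist_norm)
    also have "\<dots> \<le> (\<Sum>b\<in>(Basis :: 'a set). 3 * \<epsilon> * real k)"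
    proof (rule sum_norm_le)
      fix b :: 'a assume b: "b \<in> Basis"
      then have "m b \<le> k" using m by (auto simp: I_def PiE_iff less_imp_le)
      then show "norm ((3 * \<epsilon> * real (m b)) *\<^sub>R b) \<le> 3 * \<epsilon> * real k"
        using b \<epsilon> by (simp add: abs_mult)
    qed
    also have "\<dots> = \<rho> / 2" using k\<epsilon> by (simp add: mult_ac)
    finally have "dist (c m) x0 \<le> \<rho> / 2" .
    moreover have "\<epsilon> \<le> \<rho> / 2"
    proof -
      have "1 * 1 \<le> real DIM('a) * real k" using assms(2) by (intro mult_mono) (auto simp: Suc_leI)
      then have "1 * \<epsilon> \<le> (real DIM('a) * real k) * \<epsilon>" using \<epsilon> by (intro mult_right_mono) auto
      moreover have "(real DIM('a) * real k) * \<epsilon> = \<rho> / 6" using k\<epsilon> by (simp add: mult_ac)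
      ultimately show ?thesis using assms(1) by simp
    qed
    ultimately show ?thesis unfolding cball_subset_cball_iff by (simp add: field_simps)
  qed
  show "cball (c m) \<epsilon> \<inter> cball (c m') \<epsilon> = {}" if m: "m \<in> I" "m' \<in> I" "m \<noteq> m'" for m m'
  proof -
    obtain b where b: "b \<in> Basis" "m b \<noteq> m' b"
      using m PiE_ext[of m Basis "\<lambda>_. {..<k}" m'] unfolding I_def by blast
    have cb: "inner (c m) b = inner x0 b + 3 * \<epsilon> * real (m b)" for m
      using b(1) by (simp add: c_def inner_add_left inner_sum_left_Basis)
    have "1 \<le> \<bar>real (m b) - real (m' b)\<bar>" using b(2) by linarith
    then have "3 * \<epsilon> * 1 \<le> 3 * \<epsilon> * \<bar>real (m b) - real (m' b)\<bar>" using \<epsilon> by (intro mult_left_mono) auto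
    also have "\<dots> = \<bar>inner (c m - c m') b\<bar>"
      using \<epsilon> by (simp add: inner_diff_left cb abs_mult right_diff_distrib[symmetric])
    also have "\<dots> \<le> dist (c m) (c m')" using b(1) by (simp add: dist_norm Basis_le_norm)
    finally have "dist (c m) (c m') > \<epsilon> + \<epsilon>" using \<epsilon> by linarith
    show ?thesis
    proof (intro equals0I, elim IntE)
      fix z assume "z \<in> cball (c m) \<epsilon>" "z \<in> cball (c m') \<epsilon>"
      then show False
        using dist_triangle2[of "c m" "c m'" z] \<open>dist (c m) (c m') > \<epsilon> + \<epsilon>\<close> by simp
    qed
  qed
qed

section \<open>Rescaled derivatives of the bump\<close>

definition bump_derivative :: "'n::finite \<Rightarrow> complex ^ 'n \<Rightarrow> complex" where
  "bump_derivative k = (\<lambda>z. cnj (dzbar k (\<lambda>z. complex_of_real (bump z)) z))"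

lemma test_function_bump: "test_function (\<lambda>z. complex_of_real (bump z)) UNIV"
  by (rule test_functionI[of _ "cball 0 1"])
    (auto intro: Ck_on_compose_bounded_linear[OF bounded_linear_of_real Ck_on_bump] simp: bump_eq_0)

lemma test_function_rescale:
  assumes "test_function f UNIV" "\<And>z. z \<notin> cball 0 1 \<Longrightarrow> f z = 0" "\<epsilon> > 0" "cball c \<epsilon> \<subseteq> \<Omega>"
  shows "test_function (\<lambda>z. f ((z - c) /\<^sub>R \<epsilon>)) \<Omega>"
proof (rule test_functionI)
  show "Ck_on k (\<lambda>z. f ((z - c) /\<^sub>R \<epsilon>)) UNIV" for k
    by (rule Ck_on_rescale[OF test_functionD[OF assms(1)]])
  show "f ((z - c) /\<^sub>R \<epsilon>) = 0" if "z \<notin> cball c \<epsilon>" for z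
  proof -
    have "norm ((z - c) /\<^sub>R \<epsilon>) = dist c z / \<epsilon>"
      using assms(3) by (simp add: dist_norm norm_minus_commute divide_inverse mult.commute)
    then have "norm ((z - c) /\<^sub>R \<epsilon>) > 1" using that assms(3) by (simp only: mem_cball) simp
    then show ?thesis by (intro assms(2)) (simp only: mem_cball_0 not_le)
  qed
qed (use assms in auto)

lemma dzbar_rescale:
  assumes "test_function f \<Omega>"
  shows "dzbar k (\<lambda>z. f ((z - c) /\<^sub>R \<epsilon>)) z = dzbar k f ((z - c) /\<^sub>R \<epsilon>) /\<^sub>R \<epsilon>"
  using fun_cong[OF dirderiv_rescale[where f = f and c = c and \<epsilon> = \<epsilon>, OF test_function_differentiable[OF assms]]]
  by (simp add: dzbar_eq_dirderiv scaleR_add_right mult_scaleR_right)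

lemma bump_derivative_nonzero: "\<exists>z. bump_derivative k z \<noteq> 0"
proof -
  \<comment> \<open>At this point the derivative in the direction \<open>axis k \<i>\<close> is 0
    and the one in the direction \<open>axis k 1\<close> is not, so the two parts of
    \<open>dzbar k\<close> cannot cancel.\<close>
  define z :: "complex ^ 'a" where "z = axis k (1/2)"
  have d: "bump differentiable (at z)" using Ck_on_bump[of 1, where 'a = "(complex, 'a) vec"] by simp
  have "inner z (axis k \<i>) = 0" "inner z (axis k 1) = 1/2" "inner z z = 1/4"
    by (simp_all add: z_def inner_axis_axis inner_complex_def)
  then have "dirderiv (axis k 1) bump z = - flat_exp 2 (3/4)" "dirderiv (axis k \<i>) bump z = 0"
    by (simp_all only: dirderiv_bump) simp_all
  moreover have "dirderiv v (\<lambda>z. complex_of_real (bump z)) z = complex_of_real (dirderiv v bump z)" for v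
    by (rule dirderiv_bounded_linear[OF bounded_linear_of_real d])
  ultimately have "bump_derivative k z = - complex_of_real (flat_exp 2 (3/4)) / 2"
    by (simp add: bump_derivative_def dzbar_eq_dirderiv)
  moreover have "flat_exp 2 (3/4) \<noteq> 0" by (simp add: flat_exp_def)
  ultimately show ?thesis by (intro exI[of _ z]) simp
qed

lemma continuous_AE_0_imp_0:
  fixes f :: "'a::euclidean_space \<Rightarrow> 'b::real_normed_vector"
  assumes "continuous_on UNIV f" "AE x in lebesgue. f x = 0"
  shows "f x = 0"
proof (rule ccontr)
  assume "f x \<noteq> 0"
  have "open {x. f x \<noteq> 0}"
    using open_Collect_neq[OF assms(1) continuous_on_const] .
  moreover have "negligible {x. f x \<noteq> 0}"
    using assms(2) AE_iff_null[where M = lebesgue and P = "\<lambda>x. f x = 0"] \<open>open {x. f x \<noteq> 0}\<close>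
    by (simp add: negligible_iff_null_sets)
  ultimately show False using open_not_negligible[of "{x. f x \<noteq> 0}"] \<open>f x \<noteq> 0\<close> by blast
qed

text \<open>Each derivative of the rescaled bump costs a factor 1/\<epsilon>. The function u
  contains one and the form v two, so the squared norms carry \<epsilon>^(-2) and \<epsilon>^(-4)
  besides the same Jacobian, and their quotient is \<open>a / b * \<epsilon>\<^sup>2\<close> once b
  is known to be positive.\<close>

lemma rescaled_bump_forms:
  fixes \<Omega> :: "(complex ^ 'n::{finite,linorder}) set" and k :: 'n
  assumes \<epsilon>: "\<epsilon> > 0" "cball c \<epsilon> \<subseteq> \<Omega>"
  defines "a \<equiv> (LINT z|lebesgue. (norm (function_form (bump_derivative k) z))\<^sup>2)"
    and "b \<equiv> (LINT z|lebesgue. (norm (dbar_form (bump_derivative k) z))\<^sup>2)"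
  obtains u and v where "(abs_l2 u, abs_l2 v) \<in> dbar 0 \<Omega>"
    "\<And>k. (k, 0) \<in> dbar 0 \<Omega> \<Longrightarrow> inner k (abs_l2 u) = 0"
    "sq_integrable v" "\<And>z. z \<notin> cball c \<epsilon> \<Longrightarrow> v z = 0"
    "(norm (abs_l2 u))\<^sup>2 = \<epsilon> ^ DIM((complex, 'n) vec) / \<epsilon>\<^sup>2 * a"
    "(norm (abs_l2 v))\<^sup>2 = \<epsilon> ^ DIM((complex, 'n) vec) / \<epsilon> ^ 4 * b"
proof -
  let ?\<chi> = "\<lambda>z :: (complex, 'n) vec. complex_of_real (bump z)"
  let ?s = "\<lambda>z. (z - c) /\<^sub>R \<epsilon>"
  define U where "U = bump_derivative k"
  define \<phi> where "\<phi> z = ?\<chi> (?s z)" for z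
  have \<chi>0: "?\<chi> z = 0" if "z \<notin> cball 0 1" for z using that by (simp add: bump_eq_0)
  have \<phi>: "test_function \<phi> \<Omega>"
    unfolding \<phi>_def by (rule test_function_rescale[OF test_function_bump \<chi>0 \<epsilon>])
  have U: "test_function U UNIV" unfolding U_def bump_derivative_def
    by (intro test_function_bounded_linear[OF bounded_linear_cnj] test_function_dzbar test_function_bump)
  \<comment> \<open>The bump is real, so this conjugate is the derivative of \<phi> by the
    holomorphic coordinate with index k. In this form it is orthogonal to the kernel of dbar by
    \<open>orthogonal_dbar_kernel\<close>.\<close>
  define w where "w z = cnj (dzbar k \<phi> z)" for z
  have w: "test_function w \<Omega>"
    unfolding w_def by (intro test_function_bounded_linear[OF bounded_linear_cnj] test_function_dzbar \<phi>)
  have w_eq: "w = (\<lambda>z. U (?s z) /\<^sub>R \<epsilon>)"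
    unfolding w_def \<phi>_def dzbar_rescale[OF test_function_bump] U_def bump_derivative_def
    by (simp add: scaleR_conv_of_real)
  have U': "test_function (\<lambda>z. U z /\<^sub>R \<epsilon>) UNIV"
    by (intro test_function_bounded_linear[OF bounded_linear_scaleR_right] U)
  have dw: "dzbar j w z = dzbar j U (?s z) /\<^sub>R \<epsilon>\<^sup>2" for j z
  proof -
    have "dzbar j (\<lambda>z. U z /\<^sub>R \<epsilon>) z = dzbar j U z /\<^sub>R \<epsilon>" for z
      using dirderiv_bounded_linear[OF bounded_linear_scaleR_right[of "inverse \<epsilon>"] test_function_differentiable[OF U]]
      by (simp add: dzbar_eq_dirderiv scaleR_add_right mult_scaleR_right)
    then show ?thesis
      unfolding w_eq using dzbar_rescale[OF U', where k = j and c = c and \<epsilon> = \<epsilon> and z = z] by (simp add: power2_eq_square)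
  qed
  have fw: "function_form w z = function_form U (?s z) /\<^sub>R \<epsilon>" for z
    by (simp add: function_form_def w_eq vec_eq_iff)
  have dfw: "dbar_form w z = dbar_form U (?s z) /\<^sub>R \<epsilon>\<^sup>2" for z
    by (simp add: dbar_form_def dw vec_eq_iff)
  note sq = sq_integrable_forms[OF w]
  have cont: "continuous_on UNIV (function_form U)" "continuous_on UNIV (dbar_form U)"
    by (rule continuous_on_forms[OF U])+
  show thesis
  proof (rule that[of "function_form w" "dbar_form w"])
    show "(abs_l2 (function_form w), abs_l2 (dbar_form w)) \<in> dbar 0 \<Omega>"
      by (rule dbar_function_form[OF w])
    show "inner h (abs_l2 (function_form w)) = 0" if "(h, 0) \<in> dbar 0 \<Omega>" for h
      unfolding w_def by (rule orthogonal_dbar_kernel[OF \<phi> that])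
    show "sq_integrable (dbar_form w)" by (rule sq(2))
    have \<phi>0: "\<phi> z = 0" if "z \<notin> cball c \<epsilon>" for z
    proof -
      have "norm (?s z) = dist c z / \<epsilon>"
        using \<epsilon>(1) by (simp add: dist_norm norm_minus_commute divide_inverse mult.commute)
      then have "norm (?s z) > 1" using that \<epsilon>(1) by (simp only: mem_cball) simp
      then show ?thesis unfolding \<phi>_def by (intro \<chi>0) (simp only: mem_cball_0 not_le)
    qed
    have wz: "w z = 0" if "z \<notin> cball c \<epsilon>" for z
      using dirderiv_eq_0_outside[OF test_function_differentiable[OF \<phi>] compact_cball that \<phi>0]
      by (simp add: w_def dzbar_eq_dirderiv)
    show "dbar_form w z = 0" if "z \<notin> cball c \<epsilon>" for z
      using dirderiv_eq_0_outside[OF test_function_differentiable[OF w] compact_cball that wz]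
      by (simp add: dbar_form_def dzbar_eq_dirderiv vec_eq_iff)
    have "(norm (abs_l2 (function_form w)))\<^sup>2 = (LINT z|lebesgue. (norm (function_form U (?s z)))\<^sup>2 / \<epsilon>\<^sup>2)"
      unfolding power2_norm_eq_inner inner_abs_l2[OF sq(1) sq(1)] fw
      by (simp add: power2_eq_square field_simps)
    also have "\<dots> = \<epsilon> ^ DIM((complex, 'n) vec) / \<epsilon>\<^sup>2 * a"
      using integral_rescale[of "\<lambda>z. (norm (function_form U z))\<^sup>2" \<epsilon> c] \<epsilon>(1) cont(1)
      by (simp add: a_def U_def continuous_intros)
    finally show "(norm (abs_l2 (function_form w)))\<^sup>2 = \<epsilon> ^ DIM((complex, 'n) vec) / \<epsilon>\<^sup>2 * a" .
    have "(norm (abs_l2 (dbar_form w)))\<^sup>2 = (LINT z|lebesgue. (norm (dbar_form U (?s z)))\<^sup>2 / \<epsilon> ^ 4)"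
      unfolding power2_norm_eq_inner inner_abs_l2[OF sq(2) sq(2)] dfw
      by (simp add: power2_eq_square power4_eq_xxxx field_simps)
    also have "\<dots> = \<epsilon> ^ DIM((complex, 'n) vec) / \<epsilon> ^ 4 * b"
      using integral_rescale[of "\<lambda>z. (norm (dbar_form U z))\<^sup>2" \<epsilon> c] \<epsilon>(1) cont(2)
      by (simp add: b_def U_def continuous_intros)
    finally show "(norm (abs_l2 (dbar_form w)))\<^sup>2 = \<epsilon> ^ DIM((complex, 'n) vec) / \<epsilon> ^ 4 * b" .
  qed
qed

text \<open>Isolates what the two operators of the theorem have in common; \<open>lower\<close> is
  the only link to the Neumann problem. The choices are made in the order \<kappa>, then F and M,
  then \<theta>, then \<epsilon>0, and only then the fineness k of the grid, so none of the earlier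
  constants depends on the number of balls.\<close>

lemma not_trace_class_square:
  fixes \<Omega> :: "(complex ^ 'n::{finite,linorder}) set"
  assumes card: "CARD('n) \<ge> 2" and \<Omega>: "open \<Omega>" "\<Omega> \<noteq> {}"
    and A: "\<And>f. f \<in> L2_forms 1 \<Omega> \<Longrightarrow> A f \<in> L2_forms 1 \<Omega>"
      "\<And>f g. f \<in> L2_forms 1 \<Omega> \<Longrightarrow> g \<in> L2_forms 1 \<Omega> \<Longrightarrow> A (f + g) = A f + A g"
      "\<And>c f. f \<in> L2_forms 1 \<Omega> \<Longrightarrow> A (c *\<^sub>R f) = c *\<^sub>R A f"
      "\<And>f g. f \<in> L2_forms 1 \<Omega> \<Longrightarrow> g \<in> L2_forms 1 \<Omega> \<Longrightarrow> inner (A f) g = inner f (A g)"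
      "\<And>f. f \<in> L2_forms 1 \<Omega> \<Longrightarrow> 0 \<le> inner (A f) f"
    and lower: "\<And>u v. (u, v) \<in> dbar 0 \<Omega> \<Longrightarrow> (\<And>k. (k, 0) \<in> dbar 0 \<Omega> \<Longrightarrow> inner k u = 0) \<Longrightarrow>
      inner u u \<le> inner (A v) v"
    and B: "\<And>f. f \<in> L2_forms 1 \<Omega> \<Longrightarrow> B f = A (A f)"
  shows "\<not> trace_class (L2_forms 1 \<Omega>) B"
proof
  assume tr: "trace_class (L2_forms 1 \<Omega>) B"
  have cs: "compact_square (L2_forms 1 \<Omega>) A"
    by (rule compact_square_trace_class[OF subspace_L2_forms[OF \<Omega>(1)] closed_L2_forms[OF \<Omega>(1)] A tr B])
  interpret compact_square "L2_forms 1 \<Omega>" A by (rule cs)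
  obtain S where S: "\<And>F. finite F \<Longrightarrow> F \<subseteq> eigenvectors \<Longrightarrow> orthonormal_family F id \<Longrightarrow> (\<Sum>f\<in>F. (ev f)\<^sup>2) \<le> S"
    using trace_class_eigenvalue_sum_bounded[OF cs tr B] by blast
  define d where "d = DIM((complex, 'n) vec)"
  have d: "d \<ge> 4" using card by (simp add: d_def)
  \<comment> \<open>An arbitrary coordinate direction, the same for all balls.\<close>
  obtain k0 :: 'n where True by simp
  define a where "a = (LINT z|lebesgue. (norm (function_form (bump_derivative k0) z))\<^sup>2)"
  define b where "b = (LINT z|lebesgue. (norm (dbar_form (bump_derivative k0) z))\<^sup>2)"
  have U: "test_function (bump_derivative k0) UNIV"
    unfolding bump_derivative_def
    by (intro test_function_bounded_linear[OF bounded_linear_cnj] test_function_dzbar test_function_bump)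
  have b0: "b \<ge> 0" unfolding b_def by simp
  have a0: "a > 0"
  proof -
    have "a \<ge> 0" unfolding a_def by simp
    moreover have "a \<noteq> 0"
    proof
      assume "a = 0"
      then have "inner (abs_l2 (function_form (bump_derivative k0))) (abs_l2 (function_form (bump_derivative k0))) = 0"
        using sq_integrable_forms[OF U] by (simp add: inner_abs_l2 a_def power2_norm_eq_inner)
      then have "AE z in lebesgue. function_form (bump_derivative k0) z = 0"
        using sq_integrable_forms[OF U] by (simp add: abs_l2_eq_0_iff)
      then have "function_form (bump_derivative k0) z = 0" for z
        by (rule continuous_AE_0_imp_0[OF continuous_on_forms(1)[OF U]])
      then have "function_form (bump_derivative k0) z $ {} = 0" for z by simp
      then have "bump_derivative k0 z = 0" for z by (simp add: function_form_def)
      then show False using bump_derivative_nonzero by blast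
    qed
    ultimately show ?thesis by simp
  qed
  obtain x0 \<rho> where \<rho>: "\<rho> > 0" "cball x0 \<rho> \<subseteq> \<Omega>"
    using \<Omega> open_contains_cball by blast
  \<comment> \<open>If b were 0, v would vanish on the ball of radius \<rho> while u does not,
    against \<open>lower\<close>. Positivity is thus deduced from the hypothesis and not from a
    computation of second derivatives.\<close>
  have b1: "b > 0"
  proof (rule ccontr)
    assume "\<not> b > 0"
    then have "b = 0" using b0 by simp
    obtain u v where uv: "(abs_l2 u, abs_l2 v) \<in> dbar 0 \<Omega>"
      "\<And>k. (k, 0) \<in> dbar 0 \<Omega> \<Longrightarrow> inner k (abs_l2 u) = 0"
      "(norm (abs_l2 u))\<^sup>2 = \<rho> ^ d / \<rho>\<^sup>2 * a"
      "(norm (abs_l2 v))\<^sup>2 = \<rho> ^ d / \<rho> ^ 4 * b"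
      unfolding a_def b_def d_def by (rule rescaled_bump_forms[OF \<rho>, of k0]) blast
    have "abs_l2 v = 0" using uv(4) \<open>b = 0\<close> by simp
    then have "inner (abs_l2 u) (abs_l2 u) \<le> 0" using lower[OF uv(1,2)] by simp
    then have "\<rho> ^ d / \<rho>\<^sup>2 * a \<le> 0" using uv(3) by (simp add: power2_norm_eq_inner)
    moreover have "\<rho> ^ d / \<rho>\<^sup>2 * a > 0" using \<rho> a0 by simp
    ultimately show False by simp
  qed
  \<comment> \<open>This equals \<open>k ^ 4 * (a / b * \<epsilon>\<^sup>2)\<^sup>2\<close> for the
    radius \<epsilon> belonging to k. The powers of k cancel, which is why \<kappa> can be fixed
    before k.\<close>
  define \<kappa> where "\<kappa> = (a / b * (\<rho> / (6 * d))\<^sup>2)\<^sup>2"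
  have \<kappa>: "\<kappa> > 0" using a0 b1 \<rho>(1) d by (simp add: \<kappa>_def)
  obtain F M where F: "finite F" "F \<subseteq> L2_forms 1 \<Omega>" and
    small: "\<And>(I :: ((complex, 'n) vec \<Rightarrow> nat) set) e \<theta>. finite I \<Longrightarrow> orthonormal_family I e \<Longrightarrow>
      e ` I \<subseteq> L2_forms 1 \<Omega> \<Longrightarrow> (\<forall>i\<in>I. \<forall>f\<in>F. \<bar>inner (e i) f\<bar> \<le> \<theta>) \<Longrightarrow>
      (\<Sum>i\<in>I. (inner (A (e i)) (e i))\<^sup>2) \<le> \<kappa> / 4 + M * \<theta>\<^sup>2"
  proof -
    have "\<kappa> / 4 > 0" using \<kappa> by simp
    from sum_inner_A_sq_small[OF S this, where 'i = "(complex, 'n) vec \<Rightarrow> nat"]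
    show thesis using that by blast
  qed
  \<comment> \<open>Makes \<open>M * \<theta>\<^sup>2\<close> at most \<kappa>/4, so that the upper
    bound becomes \<kappa>/2. The sign of M is unknown, hence the absolute value, and the summand 1
    avoids a zero denominator.\<close>
  define \<theta> where "\<theta> = sqrt (\<kappa> / (4 * (\<bar>M\<bar> + 1)))"
  have \<theta>: "\<theta> > 0" using \<kappa> by (simp add: \<theta>_def)
  have M\<theta>: "M * \<theta>\<^sup>2 \<le> \<kappa> / 4"
  proof -
    have "\<theta>\<^sup>2 = \<kappa> / (4 * (\<bar>M\<bar> + 1))" using \<kappa> by (simp add: \<theta>_def)
    then have eq: "(\<bar>M\<bar> + 1) * \<theta>\<^sup>2 = \<kappa> / 4" by (simp add: field_simps)
    have "M * \<theta>\<^sup>2 \<le> (\<bar>M\<bar> + 1) * \<theta>\<^sup>2" by (intro mult_right_mono) auto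
    then show ?thesis using eq by simp
  qed
  obtain \<epsilon>0 where \<epsilon>0: "\<epsilon>0 > 0" "\<And>c \<epsilon> (g :: (complex, 'n) vec \<Rightarrow> (complex, 'n set) vec).
      0 < \<epsilon> \<Longrightarrow> \<epsilon> \<le> \<epsilon>0 \<Longrightarrow> sq_integrable g \<Longrightarrow> (\<forall>z. z \<notin> cball c \<epsilon> \<longrightarrow> g z = 0) \<Longrightarrow>
      \<forall>f\<in>F. \<bar>inner (abs_l2 g) f\<bar> \<le> \<theta> * norm (abs_l2 g)"
    using inner_concentrated_small_finite[OF F(1) \<theta>] by blast
  \<comment> \<open>The second bound gives \<epsilon> \<le> \<epsilon>0, and the first keeps k
    positive in the definition of \<epsilon>.\<close>
  obtain k where k: "real k > max 1 (\<rho> / (6 * d * \<epsilon>0))" using reals_Archimedean2 by blast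
  then have k1: "k > 0" by auto
  define \<epsilon> where "\<epsilon> = \<rho> / (6 * real d * real k)"
  have \<epsilon>: "\<epsilon> > 0" using \<rho> d k1 by (simp add: \<epsilon>_def)
  have \<epsilon>\<epsilon>0: "\<epsilon> \<le> \<epsilon>0"
    using k \<epsilon>0(1) d k1 by (simp add: \<epsilon>_def field_simps)
  obtain I :: "((complex, 'n) vec \<Rightarrow> nat) set" and c where I: "finite I" "card I = k ^ d"
    "\<And>m. m \<in> I \<Longrightarrow> cball (c m) \<epsilon> \<subseteq> cball x0 \<rho>"
    "\<And>m m'. m \<in> I \<Longrightarrow> m' \<in> I \<Longrightarrow> m \<noteq> m' \<Longrightarrow> cball (c m) \<epsilon> \<inter> cball (c m') \<epsilon> = {}"
    using disjoint_balls[OF \<rho>(1) k1, of x0] unfolding \<epsilon>_def d_def by metis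
  define P where "P m u v \<longleftrightarrow> (abs_l2 u, abs_l2 v) \<in> dbar 0 \<Omega> \<and>
      (\<forall>k. (k, 0) \<in> dbar 0 \<Omega> \<longrightarrow> inner k (abs_l2 u) = 0) \<and>
      sq_integrable v \<and> (\<forall>z. z \<notin> cball (c m) \<epsilon> \<longrightarrow> v z = 0) \<and>
      (norm (abs_l2 u))\<^sup>2 = \<epsilon> ^ d / \<epsilon>\<^sup>2 * a \<and> (norm (abs_l2 v))\<^sup>2 = \<epsilon> ^ d / \<epsilon> ^ 4 * b" for m u v
  have "\<exists>u v. P m u v" if "m \<in> I" for m
  proof -
    have "cball (c m) \<epsilon> \<subseteq> \<Omega>" using I(3)[OF that] \<rho>(2) by blast
    show ?thesis
      unfolding P_def a_def b_def d_def
      by (rule rescaled_bump_forms[OF \<epsilon> \<open>cball (c m) \<epsilon> \<subseteq> \<Omega>\<close>, of k0]) blast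
  qed
  then obtain u v where P: "\<And>m. m \<in> I \<Longrightarrow> P m (u m) (v m)" by metis
  note uv = P[unfolded P_def]
  define e where "e m = abs_l2 (v m) /\<^sub>R norm (abs_l2 (v m))" for m
  have vpos: "norm (abs_l2 (v m)) > 0" if "m \<in> I" for m
  proof -
    have "(norm (abs_l2 (v m)))\<^sup>2 > 0" using uv[OF that] \<epsilon> b1 by simp
    then show ?thesis by simp
  qed
  have vH: "abs_l2 (v m) \<in> L2_forms 1 \<Omega>" if "m \<in> I" for m
    using uv[OF that] by (simp add: dbar_def)
  have on: "orthonormal_family I e"
    unfolding orthonormal_family_def
  proof (intro conjI ballI impI)
    show "norm (e m) = 1" if "m \<in> I" for m using vpos[OF that] by (simp add: e_def)
    show "inner (e m) (e m') = 0" if m: "m \<in> I" "m' \<in> I" "m \<noteq> m'" for m m'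
    proof -
      have "v m z = 0 \<or> v m' z = 0" for z
        using uv[OF m(1)] uv[OF m(2)] I(4)[OF m] by blast
      then have "inner (v m z) (v m' z) = 0" for z by (metis inner_zero_left inner_zero_right)
      then have "inner (abs_l2 (v m)) (abs_l2 (v m')) = 0"
        using uv[OF m(1)] uv[OF m(2)] by (simp add: inner_abs_l2)
      then show ?thesis by (simp add: e_def)
    qed
  qed
  have eH: "e ` I \<subseteq> L2_forms 1 \<Omega>" by (auto simp: e_def simp del: One_nat_def intro!: subspace_scale[OF subspace_H] vH)
  have "\<bar>inner (e m) f\<bar> \<le> \<theta>" if "m \<in> I" "f \<in> F" for m f
  proof -
    have "\<bar>inner (abs_l2 (v m)) f\<bar> \<le> \<theta> * norm (abs_l2 (v m))"
      using \<epsilon>0(2)[OF \<epsilon> \<epsilon>\<epsilon>0, of "v m" "c m"] uv[OF that(1)] that(2) by blast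
    then show ?thesis using vpos[OF that(1)] by (simp add: e_def abs_mult field_simps)
  qed
  then have upper: "(\<Sum>m\<in>I. (inner (A (e m)) (e m))\<^sup>2) \<le> \<kappa> / 2"
    using small[OF I(1) on eH, of \<theta>] M\<theta> by simp
  \<comment> \<open>The assumption on the dimension enters here, as d \<ge> 4: the number k^d of
    balls makes up for the factor \<epsilon>^4, which is a constant times k^(-4).\<close>
  have "\<kappa> \<le> k ^ d * (a / b * \<epsilon>\<^sup>2)\<^sup>2"
  proof -
    have "\<kappa> = real k ^ 4 * (a / b * \<epsilon>\<^sup>2)\<^sup>2"
      using k1 d by (simp add: \<kappa>_def \<epsilon>_def power_divide power_mult_distrib field_simps)
    also have "\<dots> \<le> real k ^ d * (a / b * \<epsilon>\<^sup>2)\<^sup>2"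
      using k1 d by (intro mult_right_mono power_increasing) auto
    finally show ?thesis by simp
  qed
  also have "\<dots> = (\<Sum>m\<in>I. (a / b * \<epsilon>\<^sup>2)\<^sup>2)" by (simp add: I(2))
  also have "\<dots> \<le> (\<Sum>m\<in>I. (inner (A (e m)) (e m))\<^sup>2)"
  proof (intro sum_mono power_mono)
    fix m assume m: "m \<in> I"
    define w where "w = abs_l2 (v m)"
    have "inner (A (e m)) (e m) = inner (A w) w / (norm w)\<^sup>2"
      using A_scale[OF vH[OF m]] by (simp add: e_def w_def power2_eq_square divide_inverse mult_ac)
    moreover have "(norm (abs_l2 (u m)))\<^sup>2 \<le> inner (A w) w"
      unfolding w_def power2_norm_eq_inner using uv[OF m] by (intro lower) auto
    ultimately have "(norm (abs_l2 (u m)))\<^sup>2 / (norm w)\<^sup>2 \<le> inner (A (e m)) (e m)"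
      by (simp add: divide_right_mono)
    moreover have "(norm (abs_l2 (u m)))\<^sup>2 / (norm w)\<^sup>2 = a / b * \<epsilon>\<^sup>2"
    proof -
      have 1: "(norm (abs_l2 (u m)))\<^sup>2 = \<epsilon> ^ d / \<epsilon>\<^sup>2 * a" and 2: "(norm w)\<^sup>2 = \<epsilon> ^ d / \<epsilon> ^ 4 * b"
        using uv[OF m] unfolding w_def by blast+
      show ?thesis unfolding 1 2 using \<epsilon> b1
        by (simp add: field_simps power2_eq_square power4_eq_xxxx)
    qed
    ultimately show "a / b * \<epsilon>\<^sup>2 \<le> inner (A (e m)) (e m)" by simp
  qed (use a0 b1 in simp)
  also note upper
  finally show False using \<kappa> by simp
qed

theorem corollary2:
  fixes \<Omega> :: "(complex ^ 'n::{finite,linorder}) set"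
    and N :: "'n form \<Rightarrow> 'n form"
  assumes "CARD('n) \<ge> 2"
    and "bounded_domain \<Omega>"
    and "C2_boundary \<Omega>"
    and "pseudoconvex \<Omega>"
    and "is_dbar_Neumann_operator \<Omega> N"
  shows "\<not> schatten_class 4 (L2_forms 1 \<Omega>) (L2_forms 0 \<Omega>)
             (\<lambda>f. graph_apply (dbar_adj 0 \<Omega>) (N f)) \<and>
         \<not> hilbert_schmidt (L2_forms 1 \<Omega>) (L2_forms 1 \<Omega>) N"
proof (intro conjI notI)
  have \<Omega>: "open \<Omega>" "\<Omega> \<noteq> {}" using assms(2) by (auto simp: bounded_domain_def)
  note N = assms(5)
  let ?H = "L2_forms 1 \<Omega>"
  {
    \<comment> \<open>For p = 4 the exponent p / 2 is 2, so B is the square of A =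
      \<open>S \<circ> T\<close>.\<close>
    define T where "T f = graph_apply (dbar_adj 0 \<Omega>) (N f)" for f
    assume "schatten_class 4 ?H (L2_forms 0 \<Omega>) (\<lambda>f. graph_apply (dbar_adj 0 \<Omega>) (N f))"
    then obtain S B where T: "bounded_operator ?H (L2_forms 0 \<Omega>) T"
      and S: "is_adjoint ?H (L2_forms 0 \<Omega>) T S"
      and B: "is_operator_powr ?H (S \<circ> T) 2 B" "trace_class ?H B"
      unfolding schatten_class_def T_def[symmetric] by auto
    obtain M where M: "M \<ge> 0" "\<And>f. f \<in> ?H \<Longrightarrow> norm (T f) \<le> M * norm f"
      "\<And>g. g \<in> L2_forms 0 \<Omega> \<Longrightarrow> norm (S g) \<le> M * norm g"
      using bounded_operator_adjoint[OF T S] by blast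
    note TD = bounded_operatorD[OF T]
    have STmem: "S (T f) \<in> ?H" if "f \<in> ?H" for f
      using S TD(1)[OF that] by (simp add: is_adjoint_def)
    have ST: "inner (S (T f)) g = inner (T f) (T g)" if "f \<in> ?H" "g \<in> ?H" for f g
      using is_adjoint_inner[OF S that(2) TD(1)[OF that(1)]] by (simp add: inner_commute)
    \<comment> \<open>S is given only by the adjoint identity. Linearity of
      \<open>S \<circ> T\<close> is obtained from that of T by testing against \<open>?H\<close>,
      whose elements are determined by their inner products with \<open>?H\<close>.\<close>
    have eqI: "x = y" if "x \<in> ?H" "y \<in> ?H" "\<And>g. g \<in> ?H \<Longrightarrow> inner x g = inner y g" for x y
    proof -
      have "x - y \<in> ?H" using subspace_L2_forms[OF \<Omega>(1)] that(1,2) by (rule subspace_diff)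
      from that(3)[OF this] have "inner (x - y) (x - y) = 0" by (simp add: inner_diff_left)
      then show ?thesis by simp
    qed
    note sub = subspace_L2_forms[OF \<Omega>(1), of 1]
    have "\<not> trace_class ?H B"
    proof (rule not_trace_class_square[OF assms(1) \<Omega>, where A = "\<lambda>f. S (T f)"])
      show "S (T f) \<in> ?H" if "f \<in> ?H" for f using that by (rule STmem)
      show "S (T (f + g)) = S (T f) + S (T g)" if "f \<in> ?H" "g \<in> ?H" for f g
      proof (rule eqI)
        have fg: "f + g \<in> ?H" using sub that by (rule subspace_add)
        then show "S (T (f + g)) \<in> ?H" by (rule STmem)
        show "S (T f) + S (T g) \<in> ?H" using that by (intro subspace_add[OF sub] STmem)
        show "inner (S (T (f + g))) h = inner (S (T f) + S (T g)) h" if "h \<in> ?H" for h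
          by (subst ST[OF fg that]) (simp only: inner_add_left ST[OF \<open>f \<in> ?H\<close> that] ST[OF \<open>g \<in> ?H\<close> that]
              TD(2)[OF \<open>f \<in> ?H\<close> \<open>g \<in> ?H\<close>])
      qed
      show "S (T (c *\<^sub>R f)) = c *\<^sub>R S (T f)" if "f \<in> ?H" for c f
      proof (rule eqI)
        have cf: "c *\<^sub>R f \<in> ?H" using sub that by (rule subspace_scale)
        then show "S (T (c *\<^sub>R f)) \<in> ?H" by (rule STmem)
        show "c *\<^sub>R S (T f) \<in> ?H" using that by (intro subspace_scale[OF sub] STmem)
        show "inner (S (T (c *\<^sub>R f))) h = inner (c *\<^sub>R S (T f)) h" if "h \<in> ?H" for h
          by (subst ST[OF cf that]) (simp only: inner_scaleR_left ST[OF \<open>f \<in> ?H\<close> that] TD(3)[OF \<open>f \<in> ?H\<close>])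
      qed
      show "inner (S (T f)) g = inner f (S (T g))" if "f \<in> ?H" "g \<in> ?H" for f g
        using ST[OF that] ST[OF that(2,1)] by (simp add: inner_commute)
      show "0 \<le> inner (S (T f)) f" if "f \<in> ?H" for f using ST[OF that that] by simp
      show "B f = S (T (S (T f)))" if "f \<in> ?H" for f
      proof -
        have "norm ((S \<circ> T) f) \<le> (M * M) * norm f" if "f \<in> ?H" for f
          using M(3)[OF TD(1)[OF that]] mult_left_mono[OF M(2)[OF that] M(1)] by (simp add: mult.assoc)
        from is_operator_powr_2[OF B(1) this that] show ?thesis by simp
      qed
      fix u v assume uv: "(u, v) \<in> dbar 0 \<Omega>" "\<And>k. (k, 0) \<in> dbar 0 \<Omega> \<Longrightarrow> inner k u = 0"
      have v: "v \<in> ?H" using uv(1) by (simp add: dbar_def)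
      have "(N v, v) \<in> complex_laplacian \<Omega>" using N v by (simp add: is_dbar_Neumann_operator_def)
      then obtain p where "(N v, p) \<in> dbar_adj 0 \<Omega>" by (rule complex_laplacianE)
      \<comment> \<open>\<open>graph_apply\<close> selects some value of the adjoint at N v. Its
        inner product with u is fixed by the graph: it equals <v, N v>, which is |u|^2, and
        Cauchy-Schwarz then bounds the norm of u by that of T v.\<close>
      then have "(N v, T v) \<in> dbar_adj 0 \<Omega>" unfolding T_def graph_apply_def by (rule someI)
      from dbar_adjD[OF this uv(1)] canonical_solution[OF \<Omega>(1) N uv]
      have "inner u u = inner u (T v)" by simp
      then have "norm u * norm u \<le> norm u * norm (T v)"
        using norm_cauchy_schwarz[of u "T v"] by (simp add: power2_norm_eq_inner[symmetric] power2_eq_square)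
      then have "norm u \<le> norm (T v)" by (cases "u = 0") auto
      then have "(norm u)\<^sup>2 \<le> (norm (T v))\<^sup>2" by (rule power_mono) simp
      then show "inner u u \<le> inner (S (T v)) v" using ST[OF v v] by (simp add: power2_norm_eq_inner)
    qed
    then show False using B(2) by simp
  }
  {
    assume "hilbert_schmidt ?H ?H N"
    then obtain S B where NB: "bounded_operator ?H ?H N" and S: "is_adjoint ?H ?H N S"
      and B: "is_operator_powr ?H (S \<circ> N) 1 B" "trace_class ?H B"
      unfolding hilbert_schmidt_def schatten_class_def by auto
    obtain M where M: "M \<ge> 0" "\<And>f. f \<in> ?H \<Longrightarrow> norm (N f) \<le> M * norm f"
      "\<And>g. g \<in> ?H \<Longrightarrow> norm (S g) \<le> M * norm g"
      using bounded_operator_adjoint[OF NB S] by blast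
    note ND = bounded_operatorD[OF NB]
    \<comment> \<open>For p = 2 the exponent is 1 and B is the composition of S and N; since N is
      symmetric, S agrees with N on \<open>?H\<close> and B is the square of A = N.\<close>
    have SN: "S g = N g" if g: "g \<in> ?H" for g
    proof -
      have mem: "S g - N g \<in> ?H"
        using S g ND(1)[OF g] subspace_diff[OF subspace_L2_forms[OF \<Omega>(1)]] by (simp add: is_adjoint_def)
      have "inner (S g - N g) (S g - N g) = 0"
        using is_adjoint_inner[OF S mem g] Neumann_symmetric_nonneg(1)[OF N mem g]
        by (simp add: inner_diff_right)
      then show ?thesis by simp
    qed
    have "\<not> trace_class ?H B"
    proof (rule not_trace_class_square[OF assms(1) \<Omega> ND Neumann_symmetric_nonneg[OF N]])
      show "inner u u \<le> inner (N v) v"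
        if "(u, v) \<in> dbar 0 \<Omega>" "\<And>k. (k, 0) \<in> dbar 0 \<Omega> \<Longrightarrow> inner k u = 0" for u v
        using canonical_solution[OF \<Omega>(1) N that] by (simp add: inner_commute)
      show "B f = N (N f)" if f: "f \<in> ?H" for f
      proof -
        have "norm ((S \<circ> N) f) \<le> (M * M) * norm f" if "f \<in> ?H" for f
          using M(3)[OF ND(1)[OF that]] mult_left_mono[OF M(2)[OF that] M(1)] by (simp add: mult.assoc)
        from is_operator_powr_1[OF B(1) this f] show ?thesis using SN[OF ND(1)[OF f]] by simp
      qed
    qed
    then show False using B(2) by simp
  }
qed

end
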